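(* Let $T$ be a non-invertible measure-preserving transformation on the probability space $(Y,\mathcal{B},\nu)$ and let $\mathcal{I}$ be the $\sigma$-algebra of all $T$-invariant sets. Suppose $h\in L^2(Y,\mathcal{B},\nu)$ with $\int h(y)\,\nu(dy)=0$ is such that $$\sum_{n=1}^\infty n^{-3/2}\Bigl\lVert\sum_{k=0}^{n-1}\mathcal{P}_T^k h\Bigr\rVert_2<\infty .$$ For $n\ge 1$ and $t\in[0,1]$ let $w_n(t)=\frac{1}{\sqrt n}\sum_{j=0}^{[nt]-1}h\circ T^j$. Then there is $\tilde h\in L^2(Y,\mathcal{B},\nu)$ such that $\mathcal{P}_T\tilde h=0$ and $$\lim_{n\to\infty}\Bigl\lVert\frac{1}{\sqrt n}\sum_{j=0}^{n-1}(h-\tilde h)\circ T^j\Bigr\rVert_2=0,$$ and, with $\eta=E_\nu(\tilde h^2\mid\mathcal{I})$, $$w_n\to^d\sqrt{\eta}\,w .$$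
   Context: $(Y,\mathcal{B},\nu)$ is a probability space, $T:Y\to Y$ is measurable with $\nu(T^{-1}(A))=\nu(A)$ for all $A\in\mathcal{B}$; "non-invertible" means that $T$ is not assumed to be invertible. $T$ is not assumed ergodic. $\lVert\cdot\rVert_2$ is the norm of $L^2(Y,\mathcal{B},\nu)$. The transfer operator $\mathcal{P}_T:L^1(Y,\mathcal{B},\nu)\to L^1(Y,\mathcal{B},\nu)$ is defined by $\int \mathcal{P}_Tf(y)\,g(y)\,\nu(dy)=\int f(y)\,g(T(y))\,\nu(dy)$ for all $f\in L^1(Y,\mathcal{B},\nu)$, $g\in L^\infty(Y,\mathcal{B},\nu)$. $[x]$ is the integer part of $x$, and a sum from $0$ to $-1$ is $0$. A set $A\in\mathcal{B}$ is $T$-invariant if $T^{-1}(A)=A$. Here $w=\{w(t):t\in[0,1]\}$ is a standard Brownian motion and $w_n\to^d\sqrt\eta\,w$ means: the laws under $\nu$ of the random elements $w_n$ of the Skorohod space $D[0,1]$ (with the Skorohod topology) converge weakly to the law of the process $\sqrt\eta\,w$, where $\eta$ (with its distribution under $\nu$) is taken independent of $w$. *)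

theory Defs
  imports "HOL-Probability.Probability"
begin

section \<open>Square-integrable functions\<close>

definition L2_space :: "'a measure \<Rightarrow> ('a \<Rightarrow> real) set" where
  "L2_space M = {f \<in> borel_measurable M. integrable M (\<lambda>y. (f y)\<^sup>2)}"

definition L2_norm :: "'a measure \<Rightarrow> ('a \<Rightarrow> real) \<Rightarrow> real" where
  "L2_norm M f = sqrt (\<integral>y. (f y)\<^sup>2 \<partial>M)"

section \<open>Measure-preserving maps, invariant sets and the transfer operator\<close>

definition measure_preserving_map :: "'a measure \<Rightarrow> ('a \<Rightarrow> 'a) \<Rightarrow> bool" where
  "measure_preserving_map M T \<longleftrightarrow>
     T \<in> measurable M M \<and> (\<forall>A\<in>sets M. emeasure M (T -` A \<inter> space M) = emeasure M A)"

definition invariant_algebra :: "'a measure \<Rightarrow> ('a \<Rightarrow> 'a) \<Rightarrow> 'a measure" where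
  "invariant_algebra M T = sigma (space M) {A \<in> sets M. T -` A \<inter> space M = A}"

definition is_transfer :: "'a measure \<Rightarrow> ('a \<Rightarrow> 'a) \<Rightarrow> ('a \<Rightarrow> real) \<Rightarrow> ('a \<Rightarrow> real) \<Rightarrow> bool" where
  "is_transfer M T f u \<longleftrightarrow> integrable M u \<and>
     (\<forall>g\<in>borel_measurable M. (\<exists>C. AE y in M. \<bar>g y\<bar> \<le> C) \<longrightarrow>
        (\<integral>y. u y * g y \<partial>M) = (\<integral>y. f y * g (T y) \<partial>M))"

text \<open>
  Functions stand for their classes modulo null sets: the operator picks one representative of
  the class of the transferred function. The lemmas below show that this class exists and is
  determined by the class of the argument.
\<close>

definition transfer_operator :: "'a measure \<Rightarrow> ('a \<Rightarrow> 'a) \<Rightarrow> ('a \<Rightarrow> real) \<Rightarrow> 'a \<Rightarrow> real" where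
  "transfer_operator M T f = (SOME u. is_transfer M T f u)"

lemma sets_invariant_algebra:
  assumes "T \<in> measurable M M"
  shows "sets (invariant_algebra M T) = {A \<in> sets M. T -` A \<inter> space M = A}"
proof -
  have "sigma_algebra (space M) {A \<in> sets M. T -` A \<inter> space M = A}"
    unfolding sigma_algebra_iff2
  proof (intro conjI ballI allI impI)
    show "{A \<in> sets M. T -` A \<inter> space M = A} \<subseteq> Pow (space M)"
      using sets.sets_into_space by blast
    show "{} \<in> {A \<in> sets M. T -` A \<inter> space M = A}" by simp
    fix A assume "A \<in> {A \<in> sets M. T -` A \<inter> space M = A}"
    then show "space M - A \<in> {A \<in> sets M. T -` A \<inter> space M = A}"
      using measurable_space[OF assms] by auto
  next
    fix A :: "nat \<Rightarrow> 'a set"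
    assume A: "range A \<subseteq> {A \<in> sets M. T -` A \<inter> space M = A}"
    then have "T -` A i \<inter> space M = A i" for i by blast
    then have "T -` (\<Union>i. A i) \<inter> space M = (\<Union>i. A i)" by blast
    moreover have "(\<Union>i. A i) \<in> sets M" using A by blast
    ultimately show "(\<Union>i. A i) \<in> {A \<in> sets M. T -` A \<inter> space M = A}" by simp
  qed
  moreover have "{A \<in> sets M. T -` A \<inter> space M = A} \<subseteq> Pow (space M)"
    using sets.sets_into_space by blast
  ultimately show ?thesis
    unfolding invariant_algebra_def by (simp add: sigma_algebra.sigma_sets_eq)
qed

lemma transfer_nonneg:
  fixes f :: "'a \<Rightarrow> real"
  assumes "prob_space M" "measure_preserving_map M T"
    and f: "integrable M f" "\<And>y. 0 \<le> f y"
  shows "\<exists>u. integrable M u \<and>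
    (\<forall>g\<in>borel_measurable M. (\<integral>y. u y * g y \<partial>M) = (\<integral>y. f y * g (T y) \<partial>M))"
proof -
  interpret prob_space M by fact
  have T [measurable]: "T \<in> measurable M M"
    and pres: "\<And>A. A \<in> sets M \<Longrightarrow> emeasure M (T -` A \<inter> space M) = emeasure M A"
    using assms(2) by (auto simp: measure_preserving_map_def)
  have [measurable]: "f \<in> borel_measurable M" using f by auto
  define N where "N = distr (density M (\<lambda>y. ennreal (f y))) M T"
  have em: "emeasure N A = (\<integral>\<^sup>+y. ennreal (f y) * indicator (T -` A \<inter> space M) y \<partial>M)"
    if "A \<in> sets M" for A
    using that unfolding N_def by (simp add: emeasure_distr emeasure_density)
  have ac: "absolutely_continuous M N"
    unfolding absolutely_continuous_def
  proof
    fix A assume A: "A \<in> null_sets M"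
    then have "T -` A \<inter> space M \<in> null_sets M"
      using pres[of A] measurable_sets[OF T] by (auto simp: null_sets_def)
    then have "AE y in M. y \<notin> T -` A \<inter> space M"
      by (rule AE_not_in)
    then have "AE y in M. ennreal (f y) * indicator (T -` A \<inter> space M) y = 0"
      by eventually_elim (simp add: indicator_def)
    then have "emeasure N A = 0"
      using A by (subst em) (auto simp: nn_integral_0_iff_AE)
    then show "A \<in> null_sets N"
      using A by (auto simp: N_def null_sets_def)
  qed
  have fin: "finite_measure N"
  proof
    have "emeasure N (space N) \<le> (\<integral>\<^sup>+y. ennreal (f y) \<partial>M)"
      unfolding N_def space_distr
      by (subst em[unfolded N_def]) (auto intro!: nn_integral_mono split: split_indicator)
    also have "\<dots> < \<infinity>"
      using f by (subst nn_integral_eq_integral) auto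
    finally show "emeasure N (space N) \<noteq> \<infinity>" by simp
  qed
  have sN: "sets N = sets M" by (simp add: N_def)
  obtain D where D: "D \<in> borel_measurable M" "AE x in M. RN_deriv M N x = ennreal (D x)"
      "\<And>x. 0 \<le> D x"
    using real_RN_deriv[OF fin ac sN] by metis
  have dens: "density M (\<lambda>x. ennreal (D x)) = N"
    using density_RN_deriv[OF ac sN] D(1,2) density_cong[of "RN_deriv M N" M "\<lambda>x. ennreal (D x)"]
    by auto
  have "integrable (density M (\<lambda>x. ennreal (D x))) (\<lambda>_. 1::real)"
    unfolding dens using fin by (simp add: finite_measure.integrable_const)
  then have "integrable M D"
    using D by (subst (asm) integrable_density) auto
  moreover have "(\<integral>y. D y * g y \<partial>M) = (\<integral>y. f y * g (T y) \<partial>M)"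
    if [measurable]: "g \<in> borel_measurable M" for g
  proof -
    have "(\<integral>y. D y * g y \<partial>M) = (\<integral>y. g y \<partial>N)"
      using D by (subst dens[symmetric], subst integral_density) auto
    also have "\<dots> = (\<integral>y. g (T y) \<partial>density M (\<lambda>y. ennreal (f y)))"
      unfolding N_def by (subst integral_distr) auto
    also have "\<dots> = (\<integral>y. f y * g (T y) \<partial>M)"
      using f by (subst integral_density) auto
    finally show ?thesis .
  qed
  ultimately show ?thesis by blast
qed

lemma integrable_mult_ess_bounded:
  fixes f g :: "'a \<Rightarrow> real"
  assumes "integrable M f" and [measurable]: "g \<in> borel_measurable M"
    and "AE y in M. \<bar>g y\<bar> \<le> C"
  shows "integrable M (\<lambda>y. f y * g y)"
proof (rule Bochner_Integration.integrable_bound)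
  show "integrable M (\<lambda>y. \<bar>C\<bar> * f y)" using assms by auto
  show "(\<lambda>y. f y * g y) \<in> borel_measurable M" using assms by auto
  show "AE y in M. norm (f y * g y) \<le> norm (\<bar>C\<bar> * f y)"
    using assms(3)
  proof eventually_elim
    case (elim y)
    then have "\<bar>g y\<bar> \<le> \<bar>C\<bar>" by linarith
    then show ?case
      by (simp add: abs_mult mult.commute[of "\<bar>C\<bar>"] mult_left_mono)
  qed
qed

lemma AE_measure_preserving:
  assumes "measure_preserving_map M T" "AE y in M. P y"
  shows "AE y in M. P (T y)"
proof -
  obtain A where A: "{y \<in> space M. \<not> P y} \<subseteq> A" "A \<in> sets M" "emeasure M A = 0"
    using assms(2) by (auto elim!: AE_E)
  have "T -` A \<inter> space M \<in> null_sets M"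
    using assms(1) A by (auto simp: measure_preserving_map_def intro!: null_setsI)
  moreover have "{y \<in> space M. \<not> P (T y)} \<subseteq> T -` A \<inter> space M"
    using A assms(1) by (auto simp: measure_preserving_map_def dest: measurable_space)
  ultimately show ?thesis by (rule AE_I')
qed

lemma is_transfer_exists:
  assumes "prob_space M" "measure_preserving_map M T" "integrable M f"
  shows "\<exists>u. is_transfer M T f u"
proof -
  have T [measurable]: "T \<in> measurable M M"
    using assms(2) by (auto simp: measure_preserving_map_def)
  define p where "p = (\<lambda>y. max 0 (f y))"
  define m where "m = (\<lambda>y. max 0 (- f y))"
  have ip: "integrable M p" and im: "integrable M m"
    using assms(3) by (auto simp: p_def m_def)
  have pm: "f y = p y - m y" for y by (auto simp: p_def m_def)
  obtain u where u: "integrable M u"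
      "\<And>g. g \<in> borel_measurable M \<Longrightarrow> (\<integral>y. u y * g y \<partial>M) = (\<integral>y. p y * g (T y) \<partial>M)"
    using transfer_nonneg[OF assms(1,2) ip] by (auto simp: p_def)
  obtain v where v: "integrable M v"
      "\<And>g. g \<in> borel_measurable M \<Longrightarrow> (\<integral>y. v y * g y \<partial>M) = (\<integral>y. m y * g (T y) \<partial>M)"
    using transfer_nonneg[OF assms(1,2) im] by (auto simp: m_def)
  have "is_transfer M T f (\<lambda>y. u y - v y)"
    unfolding is_transfer_def
  proof (intro conjI ballI impI)
    show "integrable M (\<lambda>y. u y - v y)" using u v by auto
    fix g :: "'a \<Rightarrow> real"
    assume g [measurable]: "g \<in> borel_measurable M" and "\<exists>C. AE y in M. \<bar>g y\<bar> \<le> C"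
    then obtain C where C: "AE y in M. \<bar>g y\<bar> \<le> C" by blast
    have CT: "AE y in M. \<bar>g (T y)\<bar> \<le> C" using AE_measure_preserving[OF assms(2) C] .
    have gT: "(\<lambda>y. g (T y)) \<in> borel_measurable M" by measurable
    show "(\<integral>y. (u y - v y) * g y \<partial>M) = (\<integral>y. f y * g (T y) \<partial>M)"
      unfolding pm left_diff_distrib
      using u(2)[OF g] v(2)[OF g]
        integrable_mult_ess_bounded[OF u(1) g C] integrable_mult_ess_bounded[OF v(1) g C]
        integrable_mult_ess_bounded[OF ip gT CT] integrable_mult_ess_bounded[OF im gT CT]
      by simp
  qed
  then show ?thesis by blast
qed

lemma is_transfer_transfer_operator:
  assumes "prob_space M" "measure_preserving_map M T" "integrable M f"
  shows "is_transfer M T f (transfer_operator M T f)"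
  unfolding transfer_operator_def using is_transfer_exists[OF assms] by (rule someI_ex)

lemma is_transfer_unique_AE:
  assumes "measure_preserving_map M T"
    and f: "f \<in> borel_measurable M" "f' \<in> borel_measurable M" "AE y in M. f y = f' y"
    and u: "is_transfer M T f u" and v: "is_transfer M T f' v"
  shows "AE y in M. u y = v y"
proof -
  have T [measurable]: "T \<in> measurable M M"
    using assms(1) by (auto simp: measure_preserving_map_def)
  define g where "g = (\<lambda>y. sgn (u y - v y))"
  have iu: "integrable M u" and iv: "integrable M v"
    using u v by (auto simp: is_transfer_def)
  have [measurable]: "u \<in> borel_measurable M" "v \<in> borel_measurable M"
    using iu iv by auto
  have [measurable]: "g \<in> borel_measurable M" unfolding g_def sgn_if by measurable
  have g1: "AE y in M. \<bar>g y\<bar> \<le> 1" by (auto simp: g_def sgn_if)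
  have "(\<integral>y. u y * g y \<partial>M) = (\<integral>y. f y * g (T y) \<partial>M)"
    using u g1 \<open>g \<in> borel_measurable M\<close> unfolding is_transfer_def by blast
  also have "\<dots> = (\<integral>y. f' y * g (T y) \<partial>M)"
    using f by (intro integral_cong_AE) auto
  also have "\<dots> = (\<integral>y. v y * g y \<partial>M)"
    using v g1 \<open>g \<in> borel_measurable M\<close> unfolding is_transfer_def by metis
  finally have "(\<integral>y. u y * g y - v y * g y \<partial>M) = 0"
    using integrable_mult_ess_bounded[OF iu _ g1] integrable_mult_ess_bounded[OF iv _ g1] by simp
  moreover have "u y * g y - v y * g y = \<bar>u y - v y\<bar>" for y
    by (auto simp: g_def sgn_if abs_if)
  ultimately have "(\<integral>y. \<bar>u y - v y\<bar> \<partial>M) = 0" by simp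
  then have "AE y in M. \<bar>u y - v y\<bar> = 0"
    using iu iv by (subst (asm) integral_nonneg_eq_0_iff_AE) auto
  then show ?thesis by auto
qed

section \<open>The Skorohod space\<close>

text \<open>
  Elements of \<open>D[0,1]\<close> are represented by functions on the reals that are \<open>undefined\<close> outside the
  unit interval. At \<open>0\<close> the left limit and at \<open>1\<close> the right continuity are vacuous, because the
  respective filters are trivial.
\<close>

definition skorohod_space :: "(real \<Rightarrow> real) set" where
  "skorohod_space = {x \<in> extensional {0..1}. \<forall>t\<in>{0..1}.
      (x \<longlongrightarrow> x t) (at t within {t<..1}) \<and> (\<exists>l. (x \<longlongrightarrow> l) (at t within {0..<t}))}"

definition time_changes :: "(real \<Rightarrow> real) set" where
  "time_changes = {\<phi>. strict_mono_on {0..1} \<phi> \<and> continuous_on {0..1} \<phi> \<and> \<phi> ` {0..1} = {0..1}}"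

definition skorohod_within :: "(real \<Rightarrow> real) \<Rightarrow> (real \<Rightarrow> real) \<Rightarrow> real set" where
  "skorohod_within x y = {e. 0 < e \<and> (\<exists>\<phi>\<in>time_changes. \<forall>t\<in>{0..1}.
      \<bar>\<phi> t - t\<bar> \<le> e \<and> \<bar>x t - y (\<phi> t)\<bar> \<le> e)}"

definition skorohod_dist :: "(real \<Rightarrow> real) \<Rightarrow> (real \<Rightarrow> real) \<Rightarrow> real" where
  "skorohod_dist x y =
     (if x \<in> skorohod_space \<and> y \<in> skorohod_space then Inf (skorohod_within x y) else 0)"

definition skorohod_topology :: "(real \<Rightarrow> real) topology" where
  "skorohod_topology = Metric_space.mtopology skorohod_space skorohod_dist"

lemma time_changes_id: "(\<lambda>t. t) \<in> time_changes"
  by (auto simp: time_changes_def strict_mono_on_def)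

lemma time_changes_comp:
  assumes "\<phi> \<in> time_changes" "\<mu> \<in> time_changes"
  shows "(\<lambda>t. \<mu> (\<phi> t)) \<in> time_changes"
proof -
  have im: "\<phi> ` {0..1} = {0..1}" "\<mu> ` {0..1} = {0..1}"
    using assms by (auto simp: time_changes_def)
  have "continuous_on {0..1} (\<lambda>t. \<mu> (\<phi> t))"
    by (rule continuous_on_compose2[of "{0..1}" \<mu>]) (use assms im in \<open>simp_all add: time_changes_def\<close>)
  moreover have "(\<lambda>t. \<mu> (\<phi> t)) ` {0..1} = {0..1}"
    using im by (simp only: image_image[of \<mu> \<phi>, symmetric])
  moreover have "strict_mono_on {0..1} (\<lambda>t. \<mu> (\<phi> t))"
  proof (rule strict_mono_onI)
    fix r s :: real assume rs: "r \<in> {0..1}" "s \<in> {0..1}" "r < s"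
    then have "\<phi> r < \<phi> s" "\<phi> r \<in> {0..1}" "\<phi> s \<in> {0..1}"
      using assms(1) im by (auto simp: time_changes_def strict_mono_on_def)
    then show "\<mu> (\<phi> r) < \<mu> (\<phi> s)"
      using assms(2) by (auto simp: time_changes_def strict_mono_on_def)
  qed
  ultimately show ?thesis by (simp add: time_changes_def)
qed

lemma time_changes_inv:
  assumes "\<phi> \<in> time_changes"
  obtains \<mu> where "\<mu> \<in> time_changes" "\<And>t. t \<in> {0..1} \<Longrightarrow> \<phi> (\<mu> t) = t"
proof -
  have sm: "strict_mono_on {0..1} \<phi>" and im: "\<phi> ` {0..1} = {0..1}"
    and co: "continuous_on {0..1} \<phi>"
    using assms by (auto simp: time_changes_def)
  have inj: "inj_on \<phi> {0..1}" using sm by (rule strict_mono_on_imp_inj_on)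
  define \<mu> where "\<mu> = inv_into {0..1} \<phi>"
  have r: "\<phi> (\<mu> t) = t" "\<mu> t \<in> {0..1}" if "t \<in> {0..1}" for t
    using that im unfolding \<mu>_def by (metis f_inv_into_f, metis inv_into_into)
  have "continuous_on (\<phi> ` {0..1}) \<mu>"
    using co inj by (intro continuous_on_inv) (auto simp: \<mu>_def)
  moreover have "\<mu> ` {0..1} = {0..1}"
    using inv_into_image_cancel[OF inj, of "{0..1}"] im unfolding \<mu>_def by simp
  moreover have "strict_mono_on {0..1} \<mu>"
  proof (rule strict_mono_onI)
    fix a b :: real assume ab: "a \<in> {0..1}" "b \<in> {0..1}" "a < b"
    show "\<mu> a < \<mu> b"
    proof (rule ccontr)
      assume "\<not> \<mu> a < \<mu> b"
      then have "\<mu> b \<le> \<mu> a" by simp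
      then have "\<phi> (\<mu> b) \<le> \<phi> (\<mu> a)"
        using sm r ab by (metis order_le_less strict_mono_onD)
      then show False using r ab by auto
    qed
  qed
  ultimately have "\<mu> \<in> time_changes" using im by (simp add: time_changes_def)
  then show ?thesis using that r by blast
qed

lemma time_changes_1:
  assumes "\<phi> \<in> time_changes" shows "\<phi> 1 = 1"
proof -
  have sm: "strict_mono_on {0..1} \<phi>" and im: "\<phi> ` {0..1} = {0..1}"
    using assms by (auto simp: time_changes_def)
  obtain s where s: "s \<in> {0..1}" "\<phi> s = 1" using im by (metis atLeastAtMost_iff imageE order_refl zero_le_one)
  have "\<phi> 1 \<le> 1" using im by (metis atLeastAtMost_iff image_eqI order_refl zero_le_one)
  moreover have "s < 1 \<Longrightarrow> \<phi> s < \<phi> 1" using sm s strict_mono_onD[OF sm, of s 1] by auto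
  ultimately show ?thesis using s by force
qed

lemma skorohod_space_bounded:
  assumes "x \<in> skorohod_space"
  obtains B where "\<And>t. t \<in> {0..1} \<Longrightarrow> \<bar>x t\<bar> \<le> B"
proof -
  have "\<exists>U B. open U \<and> t \<in> U \<and> (\<forall>s\<in>U \<inter> {0..1}. \<bar>x s\<bar> \<le> B)" if t: "t \<in> {0..1}" for t
  proof -
    obtain l where l: "(x \<longlongrightarrow> l) (at t within {0..<t})"
      and r: "(x \<longlongrightarrow> x t) (at t within {t<..1})"
      using assms t unfolding skorohod_space_def by blast
    have "\<forall>\<^sub>F s in at t within {0..<t}. dist (x s) l < 1"
      using l by (rule tendstoD) simp
    then obtain U where U: "open U" "t \<in> U" "\<And>s. s \<in> U \<Longrightarrow> s \<noteq> t \<Longrightarrow> s \<in> {0..<t} \<Longrightarrow> dist (x s) l < 1"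
      unfolding eventually_at_topological by blast
    have "\<forall>\<^sub>F s in at t within {t<..1}. dist (x s) (x t) < 1"
      using r by (rule tendstoD) simp
    then obtain V where V: "open V" "t \<in> V" "\<And>s. s \<in> V \<Longrightarrow> s \<noteq> t \<Longrightarrow> s \<in> {t<..1} \<Longrightarrow> dist (x s) (x t) < 1"
      unfolding eventually_at_topological by blast
    have "\<bar>x s\<bar> \<le> \<bar>l\<bar> + \<bar>x t\<bar> + 1" if "s \<in> U \<inter> V \<inter> {0..1}" for s
      using U(3)[of s] V(3)[of s] that
      by (cases s t rule: linorder_cases) (auto simp: dist_real_def)
    then show ?thesis using U V
      by (intro exI[of _ "U \<inter> V"] exI[of _ "\<bar>l\<bar> + \<bar>x t\<bar> + 1"]) auto
  qed
  then obtain U B where UB: "\<And>t. t \<in> {0..1} \<Longrightarrow> open (U t) \<and> t \<in> U t \<and> (\<forall>s\<in>U t \<inter> {0..1}. \<bar>x s\<bar> \<le> B t)"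
    by metis
  have "compact {0..1::real}" by simp
  then obtain C where C: "C \<subseteq> {0..1}" "finite C" "{0..1} \<subseteq> (\<Union>t\<in>C. U t)"
    by (rule compactE_image[of _ "{0..1}" U]) (use UB in auto)
  have "\<bar>x t\<bar> \<le> Max (B ` C)" if t: "t \<in> {0..1}" for t
  proof -
    obtain c where "c \<in> C" "t \<in> U c" using C t by blast
    then have "\<bar>x t\<bar> \<le> B c" using UB C t by blast
    also have "\<dots> \<le> Max (B ` C)" using C \<open>c \<in> C\<close> by auto
    finally show ?thesis .
  qed
  then show ?thesis by (rule that)
qed

lemma skorohod_within_nonempty:
  assumes "x \<in> skorohod_space" "y \<in> skorohod_space"
  shows "skorohod_within x y \<noteq> {}"
proof -
  obtain A where A: "\<And>t. t \<in> {0..1} \<Longrightarrow> \<bar>x t\<bar> \<le> A" using skorohod_space_bounded assms by metis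
  obtain B where B: "\<And>t. t \<in> {0..1} \<Longrightarrow> \<bar>y t\<bar> \<le> B" using skorohod_space_bounded assms by metis
  have "0 < A + B + 1" using A[of 0] B[of 0] by auto
  moreover have "\<bar>x t - y t\<bar> \<le> A + B + 1" if "t \<in> {0..1}" for t
    using A[OF that] B[OF that] by linarith
  ultimately have "A + B + 1 \<in> skorohod_within x y"
    unfolding skorohod_within_def using time_changes_id
    by (auto intro!: bexI[of _ "\<lambda>t. t"])
  then show ?thesis by blast
qed

lemma skorohod_within_bdd: "bdd_below (skorohod_within x y)"
  by (rule bdd_belowI[of _ 0]) (auto simp: skorohod_within_def)

lemma skorohod_within_commute: "skorohod_within x y \<subseteq> skorohod_within y x"
proof
  fix e assume "e \<in> skorohod_within x y"
  then obtain \<phi> where e: "0 < e" and l: "\<phi> \<in> time_changes"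
    "\<And>t. t \<in> {0..1} \<Longrightarrow> \<bar>\<phi> t - t\<bar> \<le> e \<and> \<bar>x t - y (\<phi> t)\<bar> \<le> e"
    by (auto simp: skorohod_within_def)
  obtain \<mu> where m: "\<mu> \<in> time_changes" "\<And>t. t \<in> {0..1} \<Longrightarrow> \<phi> (\<mu> t) = t"
    using time_changes_inv[OF l(1)] by blast
  have "\<bar>\<mu> t - t\<bar> \<le> e \<and> \<bar>y t - x (\<mu> t)\<bar> \<le> e" if "t \<in> {0..1}" for t
  proof -
    have "\<mu> t \<in> {0..1}" using m(1) that by (auto simp: time_changes_def)
    from l(2)[OF this] show ?thesis using m(2)[OF that] by (auto simp: abs_minus_commute)
  qed
  then show "e \<in> skorohod_within y x" using e m(1) unfolding skorohod_within_def by blast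
qed

lemma skorohod_within_triangle:
  assumes "a \<in> skorohod_within x y" "b \<in> skorohod_within y z"
  shows "a + b \<in> skorohod_within x z"
proof -
  obtain \<phi> where a: "0 < a" and l: "\<phi> \<in> time_changes"
    "\<And>t. t \<in> {0..1} \<Longrightarrow> \<bar>\<phi> t - t\<bar> \<le> a \<and> \<bar>x t - y (\<phi> t)\<bar> \<le> a"
    using assms by (auto simp: skorohod_within_def)
  obtain \<mu> where b: "0 < b" and m: "\<mu> \<in> time_changes"
    "\<And>t. t \<in> {0..1} \<Longrightarrow> \<bar>\<mu> t - t\<bar> \<le> b \<and> \<bar>y t - z (\<mu> t)\<bar> \<le> b"
    using assms by (auto simp: skorohod_within_def)
  have "\<bar>\<mu> (\<phi> t) - t\<bar> \<le> a + b \<and> \<bar>x t - z (\<mu> (\<phi> t))\<bar> \<le> a + b" if "t \<in> {0..1}" for t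
  proof -
    have "\<phi> t \<in> {0..1}" using l(1) that by (auto simp: time_changes_def)
    from m(2)[OF this] l(2)[OF that] show ?thesis by linarith
  qed
  then show ?thesis
    using a b time_changes_comp[OF l(1) m(1)]
    by (auto simp: skorohod_within_def intro!: bexI[of _ "\<lambda>t. \<mu> (\<phi> t)"])
qed

lemma skorohod_dist_lessE:
  assumes "x \<in> skorohod_space" "y \<in> skorohod_space" "skorohod_dist x y < e"
  obtains a where "a \<in> skorohod_within x y" "a < e"
  using assms cInf_lessD[OF skorohod_within_nonempty[OF assms(1,2)]]
  by (auto simp: skorohod_dist_def)

lemma skorohod_dist_le:
  assumes "x \<in> skorohod_space" "y \<in> skorohod_space" "a \<in> skorohod_within x y"
  shows "skorohod_dist x y \<le> a"
  using assms by (simp add: skorohod_dist_def cInf_lower skorohod_within_bdd)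

lemma skorohod_dist_0_imp_eq:
  assumes x: "x \<in> skorohod_space" and y: "y \<in> skorohod_space" and 0: "skorohod_dist x y = 0"
  shows "x = y"
proof -
  have close: "\<exists>\<phi>\<in>time_changes. \<forall>t\<in>{0..1}. \<bar>\<phi> t - t\<bar> < e \<and> \<bar>x t - y (\<phi> t)\<bar> < e" if e: "e > 0" for e
  proof -
    obtain a where "a \<in> skorohod_within x y" "a < e"
      using skorohod_dist_lessE[OF x y, of e] 0 e by auto
    then show ?thesis
      unfolding skorohod_within_def using le_less_trans[of _ a e] by blast
  qed
  have "x t = y t" if t: "t \<in> {0..1}" for t
  proof (rule ccontr)
    assume ne: "x t \<noteq> y t"
    define e where "e = \<bar>x t - y t\<bar> / 3"
    have e: "e > 0" using ne by (simp add: e_def)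
    show False
    proof (cases "t = 1")
      case True
      from close[OF e] obtain \<phi> where "\<phi> \<in> time_changes" "\<bar>x 1 - y (\<phi> 1)\<bar> < e" by force
      then show False using time_changes_1[of \<phi>] e unfolding e_def True by auto
    next
      case False
      have "(x \<longlongrightarrow> x t) (at t within {t<..1})" "(y \<longlongrightarrow> y t) (at t within {t<..1})"
        using x y t by (auto simp: skorohod_space_def)
      then have "\<forall>\<^sub>F s in at t within {t<..1}. dist (x s) (x t) < e \<and> dist (y s) (y t) < e"
        using e by (intro eventually_conj tendstoD)
      then obtain d where d: "d > 0"
        "\<And>s. s \<in> {t<..1} \<Longrightarrow> dist s t < d \<Longrightarrow> dist (x s) (x t) < e \<and> dist (y s) (y t) < e"
        unfolding eventually_at by force
      define r where "r = min d (1 - t)"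
      have r: "0 < r" "r \<le> d" "t + r \<le> 1" using d False t by (auto simp: r_def)
      define s where "s = t + r / 2"
      have s: "s \<in> {t<..1}" "dist s t < d" using r by (auto simp: s_def dist_real_def)
      from close[of "min e (r / 4)"] e r obtain \<phi> where "\<phi> \<in> time_changes"
        "\<And>t. t \<in> {0..1} \<Longrightarrow> \<bar>\<phi> t - t\<bar> < r / 4 \<and> \<bar>x t - y (\<phi> t)\<bar> < e"
        by auto
      then have ls: "\<bar>\<phi> s - s\<bar> < r / 4" "\<bar>x s - y (\<phi> s)\<bar> < e" using s t by auto
      then have "\<phi> s \<in> {t<..1}" "dist (\<phi> s) t < d"
        using r unfolding s_def dist_real_def by (auto simp: abs_if split: if_splits)
      then have "\<bar>x s - x t\<bar> < e" "\<bar>y (\<phi> s) - y t\<bar> < e"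
        using d(2) s by (auto simp: dist_real_def)
      then have "\<bar>x t - y t\<bar> < 3 * e" using ls(2) by linarith
      then show False by (simp add: e_def)
    qed
  qed
  then show ?thesis
    using x y by (intro extensionalityI[of _ "{0..1}"]) (auto simp: skorohod_space_def)
qed

lemma Metric_space_skorohod: "Metric_space skorohod_space skorohod_dist"
proof
  show nn: "0 \<le> skorohod_dist x y" for x y
    using cInf_greatest[OF skorohod_within_nonempty, of x y 0]
    by (auto simp: skorohod_dist_def skorohod_within_def)
  show "skorohod_dist x y = skorohod_dist y x" for x y
    using skorohod_within_commute[of x y] skorohod_within_commute[of y x]
    by (auto simp: skorohod_dist_def)
  show "skorohod_dist x y = 0 \<longleftrightarrow> x = y" if xy: "x \<in> skorohod_space" "y \<in> skorohod_space" for x y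
  proof
    assume "x = y"
    then have "skorohod_dist x y \<le> e" if "0 < e" for e
      using that xy time_changes_id
      by (intro skorohod_dist_le) (auto simp: skorohod_within_def intro!: bexI[of _ "\<lambda>t. t"])
    then have "skorohod_dist x y \<le> 0" using field_le_epsilon[of "skorohod_dist x y" 0] by simp
    then show "skorohod_dist x y = 0" using nn[of x y] by simp
  qed (rule skorohod_dist_0_imp_eq[OF xy])
  show "skorohod_dist x z \<le> skorohod_dist x y + skorohod_dist y z"
    if xyz: "x \<in> skorohod_space" "y \<in> skorohod_space" "z \<in> skorohod_space" for x y z
  proof (rule field_le_epsilon)
    fix e :: real assume e: "0 < e"
    obtain a where a: "a \<in> skorohod_within x y" "a < skorohod_dist x y + e / 2"
      using skorohod_dist_lessE[OF xyz(1,2), of "skorohod_dist x y + e / 2"] e by auto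
    obtain b where b: "b \<in> skorohod_within y z" "b < skorohod_dist y z + e / 2"
      using skorohod_dist_lessE[OF xyz(2,3), of "skorohod_dist y z + e / 2"] e by auto
    show "skorohod_dist x z \<le> skorohod_dist x y + skorohod_dist y z + e"
      using skorohod_dist_le[OF xyz(1,3) skorohod_within_triangle[OF a(1) b(1)]] a(2) b(2) by simp
  qed
qed

lemma topspace_skorohod [simp]: "topspace skorohod_topology = skorohod_space"
  unfolding skorohod_topology_def
  by (rule Metric_space.topspace_mtopology[OF Metric_space_skorohod])

section \<open>Convergence in distribution\<close>

definition borel_of :: "'a topology \<Rightarrow> 'a measure" where
  "borel_of X = sigma (topspace X) {U. openin X U}"

definition weak_conv_on :: "'a topology \<Rightarrow> (nat \<Rightarrow> 'a measure) \<Rightarrow> 'a measure \<Rightarrow> bool" where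
  "weak_conv_on X \<mu> \<mu>' \<longleftrightarrow>
     (\<forall>f. continuous_map X euclideanreal f \<and> bounded (f ` topspace X) \<longrightarrow>
        (\<lambda>n. \<integral>x. f x \<partial>\<mu> n) \<longlonglongrightarrow> (\<integral>x. f x \<partial>\<mu>'))"

text \<open>
  The random elements and their limit may live on different probability spaces. The measurability
  clauses make the laws genuine image measures.
\<close>

definition conv_in_distr ::
    "'c topology \<Rightarrow> 'a measure \<Rightarrow> (nat \<Rightarrow> 'a \<Rightarrow> 'c) \<Rightarrow> 'b measure \<Rightarrow> ('b \<Rightarrow> 'c) \<Rightarrow> bool" where
  "conv_in_distr X M V Q Z \<longleftrightarrow>
     (\<forall>n. V n \<in> measurable M (borel_of X)) \<and> Z \<in> measurable Q (borel_of X) \<and>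
     weak_conv_on X (\<lambda>n. distr M (borel_of X) (V n)) (distr Q (borel_of X) Z)"

section \<open>Brownian motion and the limit process\<close>

definition standard_brownian_motion :: "'b measure \<Rightarrow> (real \<Rightarrow> 'b \<Rightarrow> real) \<Rightarrow> bool" where
  "standard_brownian_motion Q w \<longleftrightarrow> prob_space Q \<and>
     (\<forall>t\<in>{0..1}. w t \<in> borel_measurable Q) \<and>
     (AE \<omega> in Q. w 0 \<omega> = 0) \<and>
     (\<forall>\<omega>\<in>space Q. continuous_on {0..1} (\<lambda>t. w t \<omega>)) \<and>
     (\<forall>s t. 0 \<le> s \<and> s < t \<and> t \<le> 1 \<longrightarrow>
        distributed Q lborel (\<lambda>\<omega>. w t \<omega> - w s \<omega>) (normal_density 0 (sqrt (t - s)))) \<and>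
     (\<forall>n (\<tau> :: nat \<Rightarrow> real). 0 \<le> \<tau> 0 \<and> (\<forall>i<n. \<tau> i < \<tau> (Suc i)) \<and> \<tau> n \<le> 1 \<longrightarrow>
        prob_space.indep_vars Q (\<lambda>_. borel) (\<lambda>i \<omega>. w (\<tau> (Suc i)) \<omega> - w (\<tau> i) \<omega>) {..<n})"

text \<open>
  Independence of a random variable and a process means independence of the generated
  \<open>\<sigma>\<close>-algebras (\<open>indep_var\<close> would need both to take values in the same type).
\<close>

definition indep_of_process :: "'b measure \<Rightarrow> ('b \<Rightarrow> real) \<Rightarrow> (real \<Rightarrow> 'b \<Rightarrow> real) \<Rightarrow> bool" where
  "indep_of_process Q E w \<longleftrightarrow>
     prob_space.indep_set Q
       (sets (vimage_algebra (space Q) E borel))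
       (sets (vimage_algebra (space Q) (\<lambda>\<omega>. \<lambda>t\<in>{0..1}. w t \<omega>) (Pi\<^sub>M {0..1} (\<lambda>_. borel))))"

text \<open>
  The law of the limit process does not depend on the realisation of \<open>(\<eta>, w)\<close>: \<open>E\<close> ranges over all
  copies of \<open>\<eta>\<close> that are independent of a Brownian motion \<open>w\<close> on the same probability space.
\<close>

definition independent_copy ::
    "'a measure \<Rightarrow> ('a \<Rightarrow> real) \<Rightarrow> 'b measure \<Rightarrow> ('b \<Rightarrow> real) \<Rightarrow> (real \<Rightarrow> 'b \<Rightarrow> real) \<Rightarrow> bool" where
  "independent_copy M \<eta> Q E w \<longleftrightarrow>
     E \<in> borel_measurable Q \<and> distr Q borel E = distr M borel \<eta> \<and> indep_of_process Q E w"

definition partial_sum_process ::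
    "('a \<Rightarrow> 'a) \<Rightarrow> ('a \<Rightarrow> real) \<Rightarrow> nat \<Rightarrow> 'a \<Rightarrow> real \<Rightarrow> real" where
  "partial_sum_process T h n y =
     (\<lambda>t\<in>{0..1}. 1 / sqrt (real n) * (\<Sum>j<nat \<lfloor>real n * t\<rfloor>. h ((T ^^ j) y)))"

end

theory Submission
  imports Defs
begin

text \<open>
  Write \<open>U f = f \<circ> T\<close>, \<open>P\<close> for the transfer operator and \<open>S n f = (\<Sum>j<n. f \<circ> T\<^sup>j)\<close>. Since \<open>P U = 1\<close> and
  \<open>U P\<close> is the conditional expectation given the preimage \<open>\<sigma>\<close>-algebra of \<open>T\<close>, a function \<open>m\<close> with
  \<open>P m = 0\<close> yields a stationary sequence \<open>m \<circ> T\<^sup>j\<close> of martingale differences for the decreasing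
  filtration of the preimages under \<open>T\<^sup>j\<close>: a martingale once time is reversed. The martingale
  property enters only as the identity \<open>\<integral> m \<sqdot> (g \<circ> T) = 0\<close>, expressed by \<open>is_transfer M T m (\<lambda>_. 0)\<close>.

  \<^emph>\<open>Approximation.\<close> The engine is a maximal inequality (\<open>L2_norm_orbit_max_dyadic\<close>):
  \<open>max\<^bsub>k \<le> n\<^esub> |S k f|\<close> has \<open>L\<^sup>2\<close>-norm at most \<open>\<surd>n\<close> times a seminorm of \<open>f\<close>, built from the norms of \<open>f\<close> and of
  \<open>\<Sum>\<^bsub>1 \<le> k \<le> n\<^esub> P\<^sup>k f\<close> along the dyadic \<open>n\<close>. The summability hypothesis makes this seminorm of \<open>h\<close>
  finite, because the norms of the partial sums of \<open>P\<^sup>k h\<close> are subadditive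
  (\<open>summable_dyadic_of_subadditive\<close>). The averages of \<open>P\<^sup>k h\<close> over the first \<open>2\<^sup>s\<close> positive \<open>k\<close>
  tend to zero in the seminorm, and \<open>h\<close> minus such an average is a martingale difference plus a coboundary
  (\<open>martingale_approximation_step\<close>). The martingale differences obtained in this way form a Cauchy
  sequence, and their limit \<open>h'\<close> satisfies \<open>P h' = 0\<close> and approximates \<open>h\<close> even for the maximum of the
  orbit sums (\<open>martingale_approximation\<close>).

  \<^emph>\<open>Finite-dimensional distributions.\<close> Truncation makes the martingale difference bounded. For bounded
  differences McLeish's product argument gives the characteristic functions
  (\<open>martingale_char_tendsto\<close>): by the ergodic theorem the averaged squares converge to the conditional
  variance \<open>\<eta>\<close>, which is random but invariant, hence harmless under the martingale property. The limit
  is \<open>E exp (- c \<eta> / 2)\<close>, the characteristic function of the mixture \<open>\<surd>\<eta> w\<close>. Trigonometric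
  approximation turns this into convergence of bounded continuous functions of the increments.

  \<^emph>\<open>Passage to paths.\<close> It suffices to test weak convergence with bounded Lipschitz functions on the
  Skorohod space (\<open>weak_conv_on_Lipschitz\<close>). For these, a path may be replaced by its values on a grid
  of \<open>k\<close> points, up to an error which is small for large \<open>k\<close> uniformly in large \<open>n\<close>
  (\<open>discretization_error\<close>): fourth moments control the bounded martingale between grid points, the
  maximal inequality controls the rest. The grid values are finite-dimensional, and for the limit
  process the replacement is harmless because its paths are continuous.
\<close>

section \<open>Square-integrable functions\<close>

lemma L2_spaceI:
  "f \<in> borel_measurable M \<Longrightarrow> integrable M (\<lambda>y. (f y)\<^sup>2) \<Longrightarrow> f \<in> L2_space M"
  by (simp add: L2_space_def)

lemma L2_measurable: "f \<in> L2_space M \<Longrightarrow> f \<in> borel_measurable M"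
  by (simp add: L2_space_def)

lemma L2_square_integrable: "f \<in> L2_space M \<Longrightarrow> integrable M (\<lambda>y. (f y)\<^sup>2)"
  by (simp add: L2_space_def)

lemma L2_norm_nonneg [simp]: "0 \<le> L2_norm M f"
  by (simp add: L2_norm_def)

lemma L2_norm_square: "(L2_norm M f)\<^sup>2 = (\<integral>y. (f y)\<^sup>2 \<partial>M)"
  by (simp add: L2_norm_def)

lemma abs_mult_le_squares: "\<bar>a * b\<bar> \<le> a\<^sup>2 + b\<^sup>2" for a b :: real
proof -
  have "0 \<le> (\<bar>a\<bar> - \<bar>b\<bar>)\<^sup>2" by simp
  then have "2 * (\<bar>a\<bar> * \<bar>b\<bar>) \<le> a\<^sup>2 + b\<^sup>2" by (simp add: power2_diff)
  moreover have "0 \<le> \<bar>a\<bar> * \<bar>b\<bar>" by simp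
  ultimately show ?thesis unfolding abs_mult by linarith
qed

lemma L2_mult_integrable:
  assumes "f \<in> L2_space M" "g \<in> L2_space M"
  shows "integrable M (\<lambda>y. f y * g y)"
proof (rule Bochner_Integration.integrable_bound)
  show "integrable M (\<lambda>y. (f y)\<^sup>2 + (g y)\<^sup>2)"
    using assms by (auto simp: L2_space_def)
  show "(\<lambda>y. f y * g y) \<in> borel_measurable M"
    using assms by (auto simp: L2_space_def)
  show "AE y in M. norm (f y * g y) \<le> norm ((f y)\<^sup>2 + (g y)\<^sup>2)"
    using abs_mult_le_squares[of "f _" "g _"] by auto
qed

lemma L2_add:
  assumes f: "f \<in> L2_space M" and g: "g \<in> L2_space M"
  shows "(\<lambda>y. f y + g y) \<in> L2_space M"
proof (rule L2_spaceI)
  show "(\<lambda>y. f y + g y) \<in> borel_measurable M" using f g by (auto simp: L2_space_def)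
  show "integrable M (\<lambda>y. (f y + g y)\<^sup>2)"
    unfolding power2_sum using f g L2_mult_integrable[OF f g]
    by (auto simp: L2_space_def mult.assoc)
qed

lemma L2_cmult: "f \<in> L2_space M \<Longrightarrow> (\<lambda>y. c * f y) \<in> L2_space M"
  by (auto simp: L2_space_def power_mult_distrib)

lemma L2_uminus: "f \<in> L2_space M \<Longrightarrow> (\<lambda>y. - f y) \<in> L2_space M"
  using L2_cmult[of f M "-1"] by simp

lemma L2_diff: "f \<in> L2_space M \<Longrightarrow> g \<in> L2_space M \<Longrightarrow> (\<lambda>y. f y - g y) \<in> L2_space M"
  using L2_add[of f M "\<lambda>y. - g y"] L2_uminus[of g M] by simp

lemma L2_zero: "(\<lambda>_. 0) \<in> L2_space M"
  by (simp add: L2_space_def)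

lemma L2_sum: "(\<And>i. i \<in> I \<Longrightarrow> f i \<in> L2_space M) \<Longrightarrow> (\<lambda>y. \<Sum>i\<in>I. f i y) \<in> L2_space M"
  by (induction I rule: infinite_finite_induct) (auto intro: L2_add L2_zero)

lemma L2_dominated:
  assumes "g \<in> L2_space M" "f \<in> borel_measurable M" "AE y in M. \<bar>f y\<bar> \<le> \<bar>g y\<bar>"
  shows "f \<in> L2_space M"
proof (rule L2_spaceI)
  show "integrable M (\<lambda>y. (f y)\<^sup>2)"
  proof (rule Bochner_Integration.integrable_bound[OF L2_square_integrable[OF assms(1)]])
    show "AE y in M. norm ((f y)\<^sup>2) \<le> norm ((g y)\<^sup>2)"
      using assms(3) by eventually_elim (simp add: abs_le_square_iff)
  qed (use assms in auto)
qed fact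

lemma L2_norm_mono:
  assumes "g \<in> L2_space M" "f \<in> borel_measurable M" "AE y in M. \<bar>f y\<bar> \<le> \<bar>g y\<bar>"
  shows "L2_norm M f \<le> L2_norm M g"
  unfolding L2_norm_def
proof (intro real_sqrt_le_mono integral_mono_AE)
  show "AE y in M. (f y)\<^sup>2 \<le> (g y)\<^sup>2"
    using assms(3) by eventually_elim (simp add: abs_le_square_iff)
qed (use L2_dominated[OF assms] assms in \<open>auto simp: L2_space_def\<close>)

lemma L2_norm_cmult: "L2_norm M (\<lambda>y. c * f y) = \<bar>c\<bar> * L2_norm M f"
  unfolding L2_norm_def power_mult_distrib by (simp add: real_sqrt_mult)

lemma Cauchy_Schwarz_L2:
  assumes f: "f \<in> L2_space M" and g: "g \<in> L2_space M"
  shows "\<bar>\<integral>y. f y * g y \<partial>M\<bar> \<le> L2_norm M f * L2_norm M g"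
proof -
  define a b c where "a = (\<integral>y. (f y)\<^sup>2 \<partial>M)" "b = (\<integral>y. f y * g y \<partial>M)" "c = (\<integral>y. (g y)\<^sup>2 \<partial>M)"
  note int = L2_square_integrable[OF f] L2_square_integrable[OF g] L2_mult_integrable[OF f g]
  have quad: "0 \<le> s\<^sup>2 * a + 2 * (s * t) * b + t\<^sup>2 * c" for s t
  proof -
    have "0 \<le> (\<integral>y. (s * f y + t * g y)\<^sup>2 \<partial>M)" by simp
    also have "\<dots> = (\<integral>y. s\<^sup>2 * (f y)\<^sup>2 + 2 * (s * t) * (f y * g y) + t\<^sup>2 * (g y)\<^sup>2 \<partial>M)"
      by (intro Bochner_Integration.integral_cong) (auto simp: power2_eq_square algebra_simps)
    also have "\<dots> = s\<^sup>2 * a + 2 * (s * t) * b + t\<^sup>2 * c"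
      using int unfolding a_b_c_def by simp
    finally show ?thesis .
  qed
  have ac: "0 \<le> a" "0 \<le> c" by (auto simp: a_b_c_def)
  have "b\<^sup>2 \<le> a * c"
  proof (cases "c = 0")
    case True
    have "b = 0"
    proof (rule ccontr)
      assume b: "b \<noteq> 0"
      have "0 \<le> a + 2 * (- (a + 1) / (2 * b)) * b" using quad[of 1 "- (a + 1) / (2 * b)"] True by simp
      then show False using b by (simp add: field_simps)
    qed
    then show ?thesis using ac by simp
  next
    case False
    have "0 \<le> c\<^sup>2 * a + 2 * (c * - b) * b + (- b)\<^sup>2 * c" by (rule quad)
    then have "0 \<le> c * (a * c - b\<^sup>2)" by (simp add: power2_eq_square algebra_simps)
    then show ?thesis using False ac by (simp add: zero_le_mult_iff)
  qed
  then have "sqrt (b\<^sup>2) \<le> sqrt (a * c)" by (rule real_sqrt_le_mono)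
  then show ?thesis unfolding a_b_c_def L2_norm_def real_sqrt_mult by simp
qed

lemma L2_norm_triangle:
  assumes f: "f \<in> L2_space M" and g: "g \<in> L2_space M"
  shows "L2_norm M (\<lambda>y. f y + g y) \<le> L2_norm M f + L2_norm M g"
proof (rule power2_le_imp_le)
  have "(L2_norm M (\<lambda>y. f y + g y))\<^sup>2 = (\<integral>y. (f y)\<^sup>2 + (g y)\<^sup>2 + 2 * (f y * g y) \<partial>M)"
    unfolding L2_norm_square power2_sum by (simp add: mult.assoc)
  also have "\<dots> = (L2_norm M f)\<^sup>2 + (L2_norm M g)\<^sup>2 + 2 * (\<integral>y. f y * g y \<partial>M)"
    using f g L2_mult_integrable[OF f g] unfolding L2_norm_square by (simp add: L2_space_def)
  also have "\<dots> \<le> (L2_norm M f + L2_norm M g)\<^sup>2"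
    using Cauchy_Schwarz_L2[OF f g] unfolding power2_sum by simp
  finally show "(L2_norm M (\<lambda>y. f y + g y))\<^sup>2 \<le> (L2_norm M f + L2_norm M g)\<^sup>2" .
qed simp

lemma L2_norm_triangle_diff:
  assumes f: "f \<in> L2_space M" and g: "g \<in> L2_space M"
  shows "L2_norm M (\<lambda>y. f y - g y) \<le> L2_norm M f + L2_norm M g"
  using L2_norm_triangle[OF f L2_uminus[OF g]] L2_norm_cmult[of M "-1" g] by simp

lemma L2_norm_sum:
  assumes "finite I" "\<And>i. i \<in> I \<Longrightarrow> f i \<in> L2_space M"
  shows "L2_norm M (\<lambda>y. \<Sum>i\<in>I. f i y) \<le> (\<Sum>i\<in>I. L2_norm M (f i))"
  using assms
proof (induction I)
  case empty
  then show ?case by (simp add: L2_norm_def)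
next
  case (insert i I)
  have "L2_norm M (\<lambda>y. f i y + (\<Sum>i\<in>I. f i y)) \<le> L2_norm M (f i) + L2_norm M (\<lambda>y. \<Sum>i\<in>I. f i y)"
    using insert.prems by (intro L2_norm_triangle L2_sum) auto
  then show ?case using insert by fastforce
qed

lemma L2_norm_sum_orthogonal:
  assumes "finite I" "\<And>i. i \<in> I \<Longrightarrow> f i \<in> L2_space M"
    and "\<And>i j. i \<in> I \<Longrightarrow> j \<in> I \<Longrightarrow> i \<noteq> j \<Longrightarrow> (\<integral>y. f i y * f j y \<partial>M) = 0"
  shows "(L2_norm M (\<lambda>y. \<Sum>i\<in>I. f i y))\<^sup>2 = (\<Sum>i\<in>I. (L2_norm M (f i))\<^sup>2)"
proof -
  have "(L2_norm M (\<lambda>y. \<Sum>i\<in>I. f i y))\<^sup>2 = (\<integral>y. (\<Sum>i\<in>I. \<Sum>j\<in>I. f i y * f j y) \<partial>M)"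
    unfolding L2_norm_square by (simp add: power2_eq_square sum_product)
  also have "\<dots> = (\<Sum>i\<in>I. \<Sum>j\<in>I. \<integral>y. f i y * f j y \<partial>M)"
  proof -
    have int: "integrable M (\<lambda>y. f i y * f j y)" if "i \<in> I" "j \<in> I" for i j
      using assms(2)[OF that(1)] assms(2)[OF that(2)] by (rule L2_mult_integrable)
    have "(\<integral>y. (\<Sum>i\<in>I. \<Sum>j\<in>I. f i y * f j y) \<partial>M) = (\<Sum>i\<in>I. \<integral>y. (\<Sum>j\<in>I. f i y * f j y) \<partial>M)"
      by (intro Bochner_Integration.integral_sum Bochner_Integration.integrable_sum int)
    also have "\<dots> = (\<Sum>i\<in>I. \<Sum>j\<in>I. \<integral>y. f i y * f j y \<partial>M)"
      by (intro sum.cong refl Bochner_Integration.integral_sum int)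
    finally show ?thesis .
  qed
  also have "\<dots> = (\<Sum>i\<in>I. \<integral>y. (f i y)\<^sup>2 \<partial>M)"
  proof (rule sum.cong[OF refl])
    fix i assume i: "i \<in> I"
    have "(\<Sum>j\<in>I. \<integral>y. f i y * f j y \<partial>M) = (\<Sum>j\<in>I. if j = i then \<integral>y. f i y * f i y \<partial>M else 0)"
      using i assms(3) by (intro sum.cong) auto
    then show "(\<Sum>j\<in>I. \<integral>y. f i y * f j y \<partial>M) = (\<integral>y. (f i y)\<^sup>2 \<partial>M)"
      using i assms(1) by (simp add: power2_eq_square)
  qed
  finally show ?thesis unfolding L2_norm_square .
qed

context prob_space
begin

lemma L2_bounded:
  assumes "f \<in> borel_measurable M" "AE y in M. \<bar>f y\<bar> \<le> C"
  shows "f \<in> L2_space M"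
proof (rule L2_dominated[where g = "\<lambda>_. C"])
  show "(\<lambda>_. C) \<in> L2_space M" by (simp add: L2_space_def)
  show "AE y in M. \<bar>f y\<bar> \<le> \<bar>C\<bar>" using assms(2) by eventually_elim simp
qed fact

lemma L2_integrable: "f \<in> L2_space M \<Longrightarrow> integrable M f"
  using L2_mult_integrable[of f M "\<lambda>_. 1"] by (simp add: L2_space_def)

lemma integral_abs_le_L2_norm:
  assumes "f \<in> L2_space M" shows "(\<integral>y. \<bar>f y\<bar> \<partial>M) \<le> L2_norm M f"
proof -
  have "(\<lambda>y. \<bar>f y\<bar>) \<in> L2_space M" "(\<lambda>_. 1) \<in> L2_space M"
    using assms by (auto simp: L2_space_def)
  from Cauchy_Schwarz_L2[OF this] show ?thesis by (simp add: L2_norm_def prob_space)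
qed

lemma L2_Fatou:
  fixes u :: "nat \<Rightarrow> 'a \<Rightarrow> real"
  assumes u: "\<And>n. u n \<in> L2_space M" and c: "\<And>n. L2_norm M (u n) \<le> c"
    and v [measurable]: "v \<in> borel_measurable M" and lim: "AE y in M. (\<lambda>n. u n y) \<longlonglongrightarrow> v y"
  shows "v \<in> L2_space M" "L2_norm M v \<le> c"
proof -
  have [measurable]: "u n \<in> borel_measurable M" for n using u L2_measurable by blast
  have c0: "0 \<le> c" using c[of 0] L2_norm_nonneg[of M "u 0"] by linarith
  have "(\<integral>\<^sup>+y. ennreal ((v y)\<^sup>2) \<partial>M) = (\<integral>\<^sup>+y. liminf (\<lambda>i. ennreal ((u i y)\<^sup>2)) \<partial>M)"
    using lim
  proof (intro nn_integral_cong_AE, eventually_elim)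
    fix y assume "(\<lambda>i. u i y) \<longlonglongrightarrow> v y"
    then have "(\<lambda>i. ennreal ((u i y)\<^sup>2)) \<longlonglongrightarrow> ennreal ((v y)\<^sup>2)"
      by (intro tendsto_intros)
    from lim_imp_Liminf[OF sequentially_bot this]
    show "ennreal ((v y)\<^sup>2) = liminf (\<lambda>i. ennreal ((u i y)\<^sup>2))" by simp
  qed
  also have "\<dots> \<le> liminf (\<lambda>i. \<integral>\<^sup>+y. ennreal ((u i y)\<^sup>2) \<partial>M)"
    by (intro nn_integral_liminf) measurable
  also have "\<dots> \<le> ennreal (c\<^sup>2)"
  proof (rule Liminf_le)
    show "\<forall>\<^sub>F i in sequentially. (\<integral>\<^sup>+y. ennreal ((u i y)\<^sup>2) \<partial>M) \<le> ennreal (c\<^sup>2)"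
    proof (rule always_eventually, rule allI)
      fix i
      have "(L2_norm M (u i))\<^sup>2 \<le> c\<^sup>2" using c by (rule power_mono) simp
      then show "(\<integral>\<^sup>+y. ennreal ((u i y)\<^sup>2) \<partial>M) \<le> ennreal (c\<^sup>2)"
        unfolding L2_norm_square using L2_square_integrable[OF u]
        by (subst nn_integral_eq_integral) (auto intro: ennreal_leI)
    qed
  qed auto
  finally have le: "(\<integral>\<^sup>+y. ennreal ((v y)\<^sup>2) \<partial>M) \<le> ennreal (c\<^sup>2)" .
  then have int: "integrable M (\<lambda>y. (v y)\<^sup>2)"
    by (intro integrableI_nonneg) (auto intro: le_less_trans)
  then show "v \<in> L2_space M" by (intro L2_spaceI) auto
  have "(L2_norm M v)\<^sup>2 \<le> c\<^sup>2"
    using le int unfolding L2_norm_square by (subst (asm) nn_integral_eq_integral) auto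
  then show "L2_norm M v \<le> c" using c0 by (rule power2_le_imp_le)
qed

text \<open>
  A sequence that is Cauchy in mean square is Cauchy in mean, so a subsequence converges almost
  everywhere; by Fatou's lemma its limit is also the limit in mean square.
\<close>

lemma L2_complete:
  fixes u :: "nat \<Rightarrow> 'a \<Rightarrow> real"
  assumes u: "\<And>n. u n \<in> L2_space M"
    and cauchy: "\<And>e. 0 < e \<Longrightarrow> \<exists>N. \<forall>i\<ge>N. \<forall>j\<ge>N. L2_norm M (\<lambda>y. u i y - u j y) < e"
  obtains v where "v \<in> L2_space M" "(\<lambda>n. L2_norm M (\<lambda>y. u n y - v y)) \<longlonglongrightarrow> 0"
proof -
  have [measurable]: "u n \<in> borel_measurable M" for n using u L2_measurable by blast
  have "\<exists>N. \<forall>i\<ge>N. \<forall>j\<ge>N. (\<integral>y. norm (u i y - u j y) \<partial>M) < e" if e: "0 < e" for e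
  proof -
    obtain N where "\<forall>i\<ge>N. \<forall>j\<ge>N. L2_norm M (\<lambda>y. u i y - u j y) < e" using cauchy[OF e] by blast
    moreover have "(\<integral>y. norm (u i y - u j y) \<partial>M) \<le> L2_norm M (\<lambda>y. u i y - u j y)" for i j
      using integral_abs_le_L2_norm[OF L2_diff[OF u[of i] u[of j]]] by simp
    ultimately show ?thesis by (meson le_less_trans)
  qed
  then obtain r where r: "strict_mono r" "AE x in M. Cauchy (\<lambda>i. u (r i) x)"
    using cauchy_L1_AE_cauchy_subseq[of M u] L2_integrable[OF u] by blast
  define v where "v = (\<lambda>y. lim (\<lambda>i. u (r i) y))"
  have [measurable]: "v \<in> borel_measurable M" unfolding v_def by measurable
  have lim: "AE x in M. (\<lambda>i. u (r i) x) \<longlonglongrightarrow> v x"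
    using r(2) unfolding v_def
    by eventually_elim (simp add: Cauchy_convergent_iff convergent_LIMSEQ_iff)
  have fatou: "(\<lambda>y. u n y - v y) \<in> L2_space M \<and> L2_norm M (\<lambda>y. u n y - v y) \<le> e"
    if "\<And>i. i \<ge> N \<Longrightarrow> L2_norm M (\<lambda>y. u n y - u i y) < e" for e n N
  proof -
    have "L2_norm M (\<lambda>y. u n y - u (r (i + N)) y) \<le> e" for i
      using that[of "r (i + N)"] seq_suble[OF r(1), of "i + N"] by force
    moreover have "AE y in M. (\<lambda>i. u n y - u (r (i + N)) y) \<longlonglongrightarrow> u n y - v y"
      using lim
    proof eventually_elim
      case (elim y)
      from LIMSEQ_ignore_initial_segment[OF this, of N] show ?case by (intro tendsto_intros)
    qed
    ultimately show ?thesis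
      using L2_Fatou[of "\<lambda>i y. u n y - u (r (i + N)) y" e "\<lambda>y. u n y - v y"] L2_diff[OF u u] by auto
  qed
  have "v \<in> L2_space M"
  proof -
    obtain N where "\<And>i. i \<ge> N \<Longrightarrow> L2_norm M (\<lambda>y. u N y - u i y) < 1" using cauchy[of 1] by auto
    from fatou[OF this] L2_diff[OF u[of N], of "\<lambda>y. u N y - v y"] show ?thesis by simp
  qed
  moreover have "(\<lambda>n. L2_norm M (\<lambda>y. u n y - v y)) \<longlonglongrightarrow> 0"
  proof (rule LIMSEQ_I)
    fix e :: real assume e: "0 < e"
    obtain N where N: "\<And>i j. i \<ge> N \<Longrightarrow> j \<ge> N \<Longrightarrow> L2_norm M (\<lambda>y. u i y - u j y) < e / 2"
      using cauchy[of "e / 2"] e by auto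
    have "L2_norm M (\<lambda>y. u n y - v y) < e" if "n \<ge> N" for n
      using fatou[of N n "e / 2"] N[OF that] e by auto
    then show "\<exists>N. \<forall>n\<ge>N. norm (L2_norm M (\<lambda>y. u n y - v y) - 0) < e" by auto
  qed
  ultimately show ?thesis by (rule that)
qed

lemma L2_truncation:
  assumes f: "f \<in> L2_space M"
  shows "(\<lambda>k. L2_norm M (\<lambda>y. f y - f y * indicator {y. \<bar>f y\<bar> \<le> real k} y)) \<longlonglongrightarrow> 0"
proof -
  have [measurable]: "f \<in> borel_measurable M" using f by (rule L2_measurable)
  have "(\<lambda>k. \<integral>y. (f y - f y * indicator {y. \<bar>f y\<bar> \<le> real k} y)\<^sup>2 \<partial>M) \<longlonglongrightarrow> (\<integral>y. 0 \<partial>M)"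
  proof (rule integral_dominated_convergence[where w = "\<lambda>y. (f y)\<^sup>2"])
    show "AE y in M. (\<lambda>k. (f y - f y * indicator {y. \<bar>f y\<bar> \<le> real k} y)\<^sup>2) \<longlonglongrightarrow> 0"
    proof (rule AE_I2, rule tendsto_eventually)
      fix y
      show "\<forall>\<^sub>F k in sequentially. (f y - f y * indicator {y. \<bar>f y\<bar> \<le> real k} y)\<^sup>2 = 0"
        using eventually_ge_at_top[of "nat \<lceil>\<bar>f y\<bar>\<rceil>"]
      proof eventually_elim
        case (elim k)
        then have "\<bar>f y\<bar> \<le> real k" by linarith
        then show ?case by simp
      qed
    qed
    show "AE y in M. norm ((f y - f y * indicator {y. \<bar>f y\<bar> \<le> real k} y)\<^sup>2) \<le> (f y)\<^sup>2" for k
      by (auto simp: indicator_def)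
  qed (use f in \<open>auto simp: L2_space_def\<close>)
  then have "(\<lambda>k. sqrt (\<integral>y. (f y - f y * indicator {y. \<bar>f y\<bar> \<le> real k} y)\<^sup>2 \<partial>M)) \<longlonglongrightarrow> sqrt 0"
    by (intro tendsto_real_sqrt) simp
  then show ?thesis unfolding L2_norm_def by simp
qed

end

section \<open>Orbit sums and the transfer relation\<close>

definition orbit_sum :: "('a \<Rightarrow> 'a) \<Rightarrow> ('a \<Rightarrow> real) \<Rightarrow> nat \<Rightarrow> 'a \<Rightarrow> real" where
  "orbit_sum T f n y = (\<Sum>j<n. f ((T ^^ j) y))"

lemma orbit_sum_0 [simp]: "orbit_sum T f 0 y = 0"
  by (simp add: orbit_sum_def)

lemma orbit_sum_Suc: "orbit_sum T f (Suc n) y = orbit_sum T f n y + f ((T ^^ n) y)"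
  by (simp add: orbit_sum_def)

lemma orbit_sum_Suc_shift: "orbit_sum T f (Suc n) y = f y + orbit_sum T f n (T y)"
  unfolding orbit_sum_def by (subst sum.lessThan_Suc_shift) (simp add: funpow_swap1)

lemma orbit_sum_add_index:
  "orbit_sum T f (n + m) y = orbit_sum T f n y + orbit_sum T f m ((T ^^ n) y)"
proof (induction m)
  case (Suc m)
  have "(T ^^ (n + m)) y = (T ^^ m) ((T ^^ n) y)" by (subst add.commute) (simp add: funpow_add)
  then show ?case using Suc by (simp add: orbit_sum_Suc)
qed simp

lemma orbit_sum_add: "orbit_sum T (\<lambda>y. f y + g y) n y = orbit_sum T f n y + orbit_sum T g n y"
  by (simp add: orbit_sum_def sum.distrib)

lemma orbit_sum_diff: "orbit_sum T (\<lambda>y. f y - g y) n y = orbit_sum T f n y - orbit_sum T g n y"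
  by (simp add: orbit_sum_def sum_subtractf)

lemma orbit_sum_uminus: "orbit_sum T (\<lambda>y. - f y) n y = - orbit_sum T f n y"
  by (simp add: orbit_sum_def sum_negf)

lemma orbit_sum_coboundary: "orbit_sum T (\<lambda>y. f (T y) - f y) n y = f ((T ^^ n) y) - f y"
  by (induction n) (auto simp: orbit_sum_Suc)

lemma orbit_sum_bound:
  assumes "\<And>y. \<bar>f y\<bar> \<le> K" shows "\<bar>orbit_sum T f n y\<bar> \<le> real n * K"
  unfolding orbit_sum_def
  by (rule order_trans[OF sum_abs], rule order_trans[OF sum_bounded_above[where K = K]]) (use assms in auto)

lemma measurable_measure_preserving:
  "measure_preserving_map M T \<Longrightarrow> T \<in> measurable M M"
  by (simp add: measure_preserving_map_def)

lemma measurable_funpow_preserving: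
  assumes "measure_preserving_map M T"
  shows "(\<lambda>y. (T ^^ n) y) \<in> measurable M M"
  using measurable_measure_preserving[OF assms] by (induction n) (auto intro: measurable_comp simp: comp_def)

lemma measure_preserving_funpow:
  assumes T: "measure_preserving_map M T"
  shows "measure_preserving_map M (T ^^ n)"
proof (induction n)
  case 0
  then show ?case by (auto simp: measure_preserving_map_def Int_absorb2 sets.sets_into_space)
next
  case (Suc n)
  note m = measurable_measure_preserving[OF T] measurable_measure_preserving[OF Suc]
  have "emeasure M ((T ^^ Suc n) -` A \<inter> space M) = emeasure M A" if A: "A \<in> sets M" for A
  proof -
    have "(T ^^ Suc n) -` A \<inter> space M = (T ^^ n) -` (T -` A \<inter> space M) \<inter> space M"
      using measurable_space[OF m(2)] by auto
    then show ?thesis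
      using A Suc T measurable_sets[OF m(1) A] unfolding measure_preserving_map_def by metis
  qed
  moreover have "T ^^ Suc n \<in> measurable M M" using measurable_comp[OF m(2,1)] by simp
  ultimately show ?case unfolding measure_preserving_map_def by blast
qed

lemma measurable_orbit_sum:
  assumes "measure_preserving_map M T" "f \<in> borel_measurable M"
  shows "(\<lambda>y. orbit_sum T f n y) \<in> borel_measurable M"
  unfolding orbit_sum_def
  by (intro borel_measurable_sum measurable_compose[OF measurable_funpow_preserving[OF assms(1)] assms(2)])

lemma distr_measure_preserving:
  assumes "measure_preserving_map M T" shows "distr M M T = M"
  using assms by (intro measure_eqI) (auto simp: measure_preserving_map_def emeasure_distr)

lemma integral_measure_preserving:
  fixes f :: "'a \<Rightarrow> 'b :: {banach, second_countable_topology}"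
  assumes "measure_preserving_map M T" "f \<in> borel_measurable M"
  shows "(\<integral>y. f (T y) \<partial>M) = (\<integral>y. f y \<partial>M)"
  using integral_distr[OF measurable_measure_preserving[OF assms(1)] assms(2)]
  by (simp add: distr_measure_preserving[OF assms(1)])

lemma integrable_measure_preserving:
  fixes f :: "'a \<Rightarrow> 'b :: {banach, second_countable_topology}"
  assumes "measure_preserving_map M T" "integrable M f"
  shows "integrable M (\<lambda>y. f (T y))"
  using integrable_distr[OF measurable_measure_preserving[OF assms(1)], of f] assms(2)
  by (simp add: distr_measure_preserving[OF assms(1)])

lemma L2_measure_preserving:
  assumes "measure_preserving_map M T" "f \<in> L2_space M"
  shows "(\<lambda>y. f (T y)) \<in> L2_space M"
  using assms measurable_compose[OF measurable_measure_preserving[OF assms(1)] L2_measurable[OF assms(2)]]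
  by (auto simp: L2_space_def intro: integrable_measure_preserving)

lemma L2_norm_measure_preserving:
  assumes "measure_preserving_map M T" "f \<in> borel_measurable M"
  shows "L2_norm M (\<lambda>y. f (T y)) = L2_norm M f"
  unfolding L2_norm_def using integral_measure_preserving[OF assms(1), of "\<lambda>y. (f y)\<^sup>2"] assms(2) by simp

lemma L2_funpow:
  "measure_preserving_map M T \<Longrightarrow> f \<in> L2_space M \<Longrightarrow> (\<lambda>y. f ((T ^^ n) y)) \<in> L2_space M"
  by (rule L2_measure_preserving[OF measure_preserving_funpow])

lemma L2_norm_funpow:
  "measure_preserving_map M T \<Longrightarrow> f \<in> L2_space M \<Longrightarrow> L2_norm M (\<lambda>y. f ((T ^^ n) y)) = L2_norm M f"
  by (rule L2_norm_measure_preserving[OF measure_preserving_funpow L2_measurable])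

lemma L2_orbit_sum:
  "measure_preserving_map M T \<Longrightarrow> f \<in> L2_space M \<Longrightarrow> orbit_sum T f n \<in> L2_space M"
  using L2_sum[of "{..<n}" "\<lambda>j y. f ((T ^^ j) y)" M] L2_funpow[of M T f]
  by (simp add: orbit_sum_def[abs_def])

lemma L2_norm_orbit_sum_le:
  assumes "measure_preserving_map M T" "f \<in> L2_space M"
  shows "L2_norm M (orbit_sum T f n) \<le> real n * L2_norm M f"
  using L2_norm_sum[of "{..<n}" "\<lambda>j y. f ((T ^^ j) y)" M] L2_funpow[OF assms] L2_norm_funpow[OF assms]
  by (simp add: orbit_sum_def[abs_def])

context prob_space
begin

lemma is_transferD:
  assumes "is_transfer M T f u" "g \<in> borel_measurable M" "AE y in M. \<bar>g y\<bar> \<le> C"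
  shows "(\<integral>y. u y * g y \<partial>M) = (\<integral>y. f y * g (T y) \<partial>M)"
  using assms unfolding is_transfer_def by blast

text \<open>
  The transfer operator contracts \<open>L\<^sup>2\<close>: testing \<open>u\<close> against its own truncations and applying the
  Cauchy-Schwarz inequality bounds all truncations by the norm of \<open>f\<close>.
\<close>

lemma is_transfer_L2:
  assumes T: "measure_preserving_map M T" and f: "f \<in> L2_space M" and u: "is_transfer M T f u"
  shows "u \<in> L2_space M" "L2_norm M u \<le> L2_norm M f"
proof -
  have [measurable]: "u \<in> borel_measurable M" using u by (auto simp: is_transfer_def)
  define g where "g = (\<lambda>k y. u y * indicator {y. \<bar>u y\<bar> \<le> real k} y)"
  have [measurable]: "g k \<in> borel_measurable M" for k unfolding g_def by measurable
  have gk: "\<bar>g k y\<bar> \<le> real k" for k y by (auto simp: g_def indicator_def)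
  have gL2: "g k \<in> L2_space M" for k using gk by (intro L2_bounded[of _ "real k"]) auto
  have "L2_norm M (g k) \<le> L2_norm M f" for k
  proof -
    have "(L2_norm M (g k))\<^sup>2 = (\<integral>y. u y * g k y \<partial>M)"
      unfolding L2_norm_square
      by (intro Bochner_Integration.integral_cong) (auto simp: g_def indicator_def power2_eq_square)
    also have "\<dots> = (\<integral>y. f y * g k (T y) \<partial>M)"
      using gk[of k] by (intro is_transferD[OF u, where C = "real k"]) auto
    also have "\<dots> \<le> L2_norm M f * L2_norm M (g k)"
      using Cauchy_Schwarz_L2[OF f L2_measure_preserving[OF T gL2]]
        L2_norm_measure_preserving[OF T L2_measurable[OF gL2]] by (simp add: abs_le_iff)
    finally have "L2_norm M (g k) * L2_norm M (g k) \<le> L2_norm M f * L2_norm M (g k)"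
      by (simp add: power2_eq_square)
    then show ?thesis
      using L2_norm_nonneg[of M "g k"] L2_norm_nonneg[of M f]
      by (cases "L2_norm M (g k) = 0") (auto simp: mult_le_cancel_right)
  qed
  moreover have "(\<lambda>k. g k y) \<longlonglongrightarrow> u y" for y
  proof (rule tendsto_eventually)
    show "\<forall>\<^sub>F k in sequentially. g k y = u y"
      using eventually_ge_at_top[of "nat \<lceil>\<bar>u y\<bar>\<rceil>"]
    proof eventually_elim
      case (elim k)
      then have "\<bar>u y\<bar> \<le> real k" by linarith
      then show ?case by (simp add: g_def)
    qed
  qed
  ultimately show "u \<in> L2_space M" "L2_norm M u \<le> L2_norm M f"
    using L2_Fatou[of g "L2_norm M f" u, OF gL2] by auto
qed

text \<open>
  The transfer relation tests with bounded functions only; truncation extends it to \<open>L\<^sup>2\<close>.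
\<close>

lemma is_transfer_dual:
  assumes T: "measure_preserving_map M T" and f: "f \<in> L2_space M" and u: "is_transfer M T f u"
    and g: "g \<in> L2_space M"
  shows "(\<integral>y. u y * g y \<partial>M) = (\<integral>y. f y * g (T y) \<partial>M)"
proof -
  note uL2 = is_transfer_L2(1)[OF T f u]
  have [measurable]: "g \<in> borel_measurable M" using g by (rule L2_measurable)
  define t where "t = (\<lambda>k y. g y * indicator {y. \<bar>g y\<bar> \<le> real k} y)"
  have [measurable]: "t k \<in> borel_measurable M" for k unfolding t_def by measurable
  have tk: "\<bar>t k y\<bar> \<le> real k" for k y by (auto simp: t_def indicator_def)
  have tL2: "t k \<in> L2_space M" for k using tk by (intro L2_bounded[of _ "real k"]) auto
  define d where "d = (\<integral>y. u y * g y \<partial>M) - (\<integral>y. f y * g (T y) \<partial>M)"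
  have "\<bar>d\<bar> \<le> (L2_norm M u + L2_norm M f) * L2_norm M (\<lambda>y. g y - t k y)" for k
  proof -
    have eq: "(\<integral>y. u y * t k y \<partial>M) = (\<integral>y. f y * t k (T y) \<partial>M)"
      using tk[of k] by (intro is_transferD[OF u, where C = "real k"]) auto
    have dL2: "(\<lambda>y. g y - t k y) \<in> L2_space M" using g tL2 by (rule L2_diff)
    have "(\<integral>y. u y * (g y - t k y) \<partial>M) = (\<integral>y. u y * g y \<partial>M) - (\<integral>y. u y * t k y \<partial>M)"
      using L2_mult_integrable[OF uL2 g] L2_mult_integrable[OF uL2 tL2] by (simp add: right_diff_distrib)
    moreover have "(\<integral>y. f y * (g (T y) - t k (T y)) \<partial>M)
        = (\<integral>y. f y * g (T y) \<partial>M) - (\<integral>y. f y * t k (T y) \<partial>M)"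
      using L2_mult_integrable[OF f L2_measure_preserving[OF T g]]
        L2_mult_integrable[OF f L2_measure_preserving[OF T tL2]] by (simp add: right_diff_distrib)
    ultimately have "d = (\<integral>y. u y * (g y - t k y) \<partial>M) - (\<integral>y. f y * (g (T y) - t k (T y)) \<partial>M)"
      unfolding d_def using eq by simp
    then show ?thesis
      using Cauchy_Schwarz_L2[OF uL2 dL2] Cauchy_Schwarz_L2[OF f L2_measure_preserving[OF T dL2]]
        L2_norm_measure_preserving[OF T L2_measurable[OF dL2]]
      by (simp add: distrib_right)
  qed
  moreover have "(\<lambda>k. (L2_norm M u + L2_norm M f) * L2_norm M (\<lambda>y. g y - t k y)) \<longlonglongrightarrow> 0"
    using tendsto_mult_right_zero[OF L2_truncation[OF g]] unfolding t_def .
  ultimately have "\<bar>d\<bar> \<le> 0" by (intro LIMSEQ_le_const) auto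
  then show ?thesis by (simp add: d_def)
qed

lemma is_transferI:
  assumes "integrable M u"
    and "\<And>g C. g \<in> borel_measurable M \<Longrightarrow> AE y in M. \<bar>g y\<bar> \<le> C \<Longrightarrow>
      (\<integral>y. u y * g y \<partial>M) = (\<integral>y. f y * g (T y) \<partial>M)"
  shows "is_transfer M T f u"
  using assms unfolding is_transfer_def by blast

lemma integrable_is_transfer: "is_transfer M T f u \<Longrightarrow> integrable M u"
  by (simp add: is_transfer_def)

lemma is_transfer_id: "integrable M f \<Longrightarrow> is_transfer M (\<lambda>y. y) f f"
  by (rule is_transferI) auto

lemma is_transfer_cong_AE:
  assumes "is_transfer M T f u" "AE y in M. u y = v y" "v \<in> borel_measurable M"
  shows "is_transfer M T f v"
proof (rule is_transferI)
  have [measurable]: "u \<in> borel_measurable M" "v \<in> borel_measurable M"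
    using assms by (auto simp: is_transfer_def)
  show "integrable M v"
    using integrable_is_transfer[OF assms(1)] assms(2) integrable_cong_AE[of u M v] by auto
  fix g :: "'a \<Rightarrow> real" and C assume g [measurable]: "g \<in> borel_measurable M" "AE y in M. \<bar>g y\<bar> \<le> C"
  have "(\<integral>y. v y * g y \<partial>M) = (\<integral>y. u y * g y \<partial>M)"
    using assms(2) by (intro integral_cong_AE) auto
  then show "(\<integral>y. v y * g y \<partial>M) = (\<integral>y. f y * g (T y) \<partial>M)" using is_transferD[OF assms(1) g] by simp
qed

lemma is_transfer_add:
  assumes T: "measure_preserving_map M T" and f: "integrable M f" "integrable M f'"
    and u: "is_transfer M T f u" "is_transfer M T f' u'"
  shows "is_transfer M T (\<lambda>y. f y + f' y) (\<lambda>y. u y + u' y)"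
proof (rule is_transferI)
  show "integrable M (\<lambda>y. u y + u' y)" using u by (simp add: is_transfer_def)
  fix g :: "'a \<Rightarrow> real" and C assume g: "g \<in> borel_measurable M" "AE y in M. \<bar>g y\<bar> \<le> C"
  have gT: "(\<lambda>y. g (T y)) \<in> borel_measurable M" "AE y in M. \<bar>g (T y)\<bar> \<le> C"
    using measurable_compose[OF measurable_measure_preserving[OF T] g(1)] AE_measure_preserving[OF T g(2)]
    by auto
  show "(\<integral>y. (u y + u' y) * g y \<partial>M) = (\<integral>y. (f y + f' y) * g (T y) \<partial>M)"
    unfolding distrib_right
    using integrable_mult_ess_bounded[OF integrable_is_transfer[OF u(1)] g]
      integrable_mult_ess_bounded[OF integrable_is_transfer[OF u(2)] g]
      integrable_mult_ess_bounded[OF f(1) gT] integrable_mult_ess_bounded[OF f(2) gT]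
      is_transferD[OF u(1) g] is_transferD[OF u(2) g] by simp
qed

lemma is_transfer_cmult: "is_transfer M T f u \<Longrightarrow> is_transfer M T (\<lambda>y. c * f y) (\<lambda>y. c * u y)"
  unfolding is_transfer_def by (simp add: mult.assoc)

lemma is_transfer_zero: "is_transfer M T (\<lambda>_. 0) (\<lambda>_. 0)"
  by (simp add: is_transfer_def)

lemma is_transfer_diff:
  assumes T: "measure_preserving_map M T" and f: "integrable M f" "integrable M f'"
    and u: "is_transfer M T f u" "is_transfer M T f' u'"
  shows "is_transfer M T (\<lambda>y. f y - f' y) (\<lambda>y. u y - u' y)"
  using is_transfer_add[OF T f(1) _ u(1) is_transfer_cmult[OF u(2), of "-1"]] f(2) by simp

lemma is_transfer_sum:
  assumes "measure_preserving_map M T" "\<And>i. i \<in> I \<Longrightarrow> integrable M (f i)"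
    and "\<And>i. i \<in> I \<Longrightarrow> is_transfer M T (f i) (u i)"
  shows "is_transfer M T (\<lambda>y. \<Sum>i\<in>I. f i y) (\<lambda>y. \<Sum>i\<in>I. u i y)"
  using assms
  by (induction I rule: infinite_finite_induct) (auto intro!: is_transfer_zero is_transfer_add)

lemma is_transfer_comp:
  assumes R: "measure_preserving_map M R" and u: "is_transfer M T f u" "is_transfer M R u v"
  shows "is_transfer M (\<lambda>y. R (T y)) f v"
proof (rule is_transferI)
  show "integrable M v" using u by (simp add: is_transfer_def)
  fix g :: "'a \<Rightarrow> real" and C assume g: "g \<in> borel_measurable M" "AE y in M. \<bar>g y\<bar> \<le> C"
  have gR: "(\<lambda>y. g (R y)) \<in> borel_measurable M" "AE y in M. \<bar>g (R y)\<bar> \<le> C"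
    using measurable_compose[OF measurable_measure_preserving[OF R] g(1)] AE_measure_preserving[OF R g(2)]
    by auto
  show "(\<integral>y. v y * g y \<partial>M) = (\<integral>y. f y * g (R (T y)) \<partial>M)"
    using is_transferD[OF u(2) g] is_transferD[OF u(1) gR] by simp
qed

lemma is_transfer_shift:
  assumes T: "measure_preserving_map M T" and f: "integrable M f"
    and u: "is_transfer M (T ^^ k) f u"
  shows "is_transfer M (T ^^ (j + k)) (\<lambda>y. f ((T ^^ j) y)) u"
proof (rule is_transferI)
  show "integrable M u" using u by (simp add: is_transfer_def)
  fix g :: "'a \<Rightarrow> real" and C assume g [measurable]: "g \<in> borel_measurable M" "AE y in M. \<bar>g y\<bar> \<le> C"
  note [measurable] = measurable_funpow_preserving[OF T]
  have "(\<integral>y. f ((T ^^ j) y) * g ((T ^^ (j + k)) y) \<partial>M)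
      = (\<integral>y. f ((T ^^ j) y) * g ((T ^^ k) ((T ^^ j) y)) \<partial>M)"
    by (simp add: add.commute[of j] funpow_add)
  also have "\<dots> = (\<integral>y. f y * g ((T ^^ k) y) \<partial>M)"
    using f by (intro integral_measure_preserving[OF measure_preserving_funpow[OF T]]) auto
  finally show "(\<integral>y. u y * g y \<partial>M) = (\<integral>y. f ((T ^^ j) y) * g ((T ^^ (j + k)) y) \<partial>M)"
    using is_transferD[OF u g] by simp
qed

text \<open>
  The conditional expectation of the orbit sum over \<open>n\<close> steps given the preimage \<open>\<sigma>\<close>-algebra of \<open>T\<^sup>n\<close>
  is \<open>(\<Sum>i = 1..n. P\<^sup>i f) \<circ> T\<^sup>n\<close>: the term at time \<open>n - i\<close> is moved back by \<open>i\<close> steps.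
\<close>

lemma is_transfer_orbit_sum:
  assumes T: "measure_preserving_map M T" and f: "integrable M f"
    and p: "\<And>i. 1 \<le> i \<Longrightarrow> i \<le> n \<Longrightarrow> is_transfer M (T ^^ i) f (p i)"
  shows "is_transfer M (T ^^ n) (orbit_sum T f n) (\<lambda>y. \<Sum>i\<in>{1..n}. p i y)"
proof -
  have "is_transfer M (T ^^ n) (\<lambda>y. \<Sum>i\<in>{1..n}. f ((T ^^ (n - i)) y)) (\<lambda>y. \<Sum>i\<in>{1..n}. p i y)"
  proof (rule is_transfer_sum[OF measure_preserving_funpow[OF T]])
    fix i assume i: "i \<in> {1..n}"
    show "integrable M (\<lambda>y. f ((T ^^ (n - i)) y))"
      by (rule integrable_measure_preserving[OF measure_preserving_funpow[OF T] f])
    show "is_transfer M (T ^^ n) (\<lambda>y. f ((T ^^ (n - i)) y)) (p i)"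
      using is_transfer_shift[OF T f p, of i "n - i"] i by simp
  qed
  moreover have "(\<Sum>i\<in>{1..n}. f ((T ^^ (n - i)) y)) = orbit_sum T f n y" for y
    unfolding orbit_sum_def
    by (rule sum.reindex_bij_witness[of _ "\<lambda>j. n - j" "\<lambda>i. n - i"]) auto
  ultimately show ?thesis by (simp add: orbit_sum_def[abs_def])
qed

end

section \<open>Maximal inequalities for reversed martingale differences\<close>

text \<open>
  The largest of \<open>0\<close> and the sums over \<open>{j..<n}\<close> with \<open>j < n\<close>. The recursion splits off the first
  point of the orbit, so that the maximum over the later points is a function of \<open>T y\<close>, to which the
  martingale property applies.
\<close>

primrec suffix_max :: "('a \<Rightarrow> 'a) \<Rightarrow> ('a \<Rightarrow> real) \<Rightarrow> nat \<Rightarrow> 'a \<Rightarrow> real" where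
  "suffix_max T f 0 y = 0"
| "suffix_max T f (Suc n) y = max (suffix_max T f n (T y)) (orbit_sum T f (Suc n) y)"

primrec orbit_max :: "('a \<Rightarrow> 'a) \<Rightarrow> ('a \<Rightarrow> real) \<Rightarrow> nat \<Rightarrow> 'a \<Rightarrow> real" where
  "orbit_max T f 0 y = 0"
| "orbit_max T f (Suc n) y = max (orbit_max T f n y) \<bar>orbit_sum T f (Suc n) y\<bar>"

lemma suffix_max_nonneg: "0 \<le> suffix_max T f n y"
  by (induction n arbitrary: y) (auto simp: le_max_iff_disj)

lemma orbit_sum_diff_le_suffix_max:
  "j \<le> n \<Longrightarrow> orbit_sum T f n y - orbit_sum T f j y \<le> suffix_max T f n y"
proof (induction n arbitrary: j y)
  case (Suc n)
  show ?case
  proof (cases j)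
    case (Suc i)
    then have "orbit_sum T f n (T y) - orbit_sum T f i (T y) \<le> suffix_max T f n (T y)"
      using Suc.prems by (intro Suc.IH) auto
    then show ?thesis unfolding Suc orbit_sum_Suc_shift by (simp add: le_max_iff_disj)
  qed simp
qed simp

lemma orbit_max_nonneg: "0 \<le> orbit_max T f n y"
  by (induction n) (auto simp: le_max_iff_disj)

lemma abs_orbit_sum_le_orbit_max: "k \<le> n \<Longrightarrow> \<bar>orbit_sum T f k y\<bar> \<le> orbit_max T f n y"
  by (induction n) (auto simp: le_Suc_eq le_max_iff_disj)

lemma orbit_max_le:
  "(\<And>k. k \<le> n \<Longrightarrow> \<bar>orbit_sum T f k y\<bar> \<le> c) \<Longrightarrow> orbit_max T f n y \<le> c"
  by (induction n) fastforce+

lemma orbit_max_mono: "k \<le> n \<Longrightarrow> orbit_max T f k y \<le> orbit_max T f n y"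
  by (rule orbit_max_le) (auto intro: abs_orbit_sum_le_orbit_max)

lemma orbit_max_add_le:
  "orbit_max T (\<lambda>y. f y + g y) n y \<le> orbit_max T f n y + orbit_max T g n y"
proof (rule orbit_max_le)
  fix k assume "k \<le> n"
  then show "\<bar>orbit_sum T (\<lambda>y. f y + g y) k y\<bar> \<le> orbit_max T f n y + orbit_max T g n y"
    unfolding orbit_sum_add
    using abs_orbit_sum_le_orbit_max[of k n T f y] abs_orbit_sum_le_orbit_max[of k n T g y] by linarith
qed

lemma orbit_max_le_suffix_max:
  "orbit_max T f n y \<le> \<bar>orbit_sum T f n y\<bar> + suffix_max T f n y + suffix_max T (\<lambda>y. - f y) n y"
proof (rule orbit_max_le)
  fix k assume "k \<le> n"
  then show "\<bar>orbit_sum T f k y\<bar> \<le> \<bar>orbit_sum T f n y\<bar> + suffix_max T f n y + suffix_max T (\<lambda>y. - f y) n y"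
    using orbit_sum_diff_le_suffix_max[of k n T f y] orbit_sum_diff_le_suffix_max[of k n T "\<lambda>y. - f y" y]
      suffix_max_nonneg[of T f n y] suffix_max_nonneg[of T "\<lambda>y. - f y" n y]
    by (simp add: orbit_sum_uminus)
qed

lemma L2_abs: "f \<in> L2_space M \<Longrightarrow> (\<lambda>y. \<bar>f y\<bar>) \<in> L2_space M"
  by (auto simp: L2_space_def)

lemma L2_max:
  assumes "f \<in> L2_space M" "g \<in> L2_space M"
  shows "(\<lambda>y. max (f y) (g y)) \<in> L2_space M"
proof (rule L2_dominated[OF L2_add[OF L2_abs[OF assms(1)] L2_abs[OF assms(2)]]])
  show "(\<lambda>y. max (f y) (g y)) \<in> borel_measurable M" using assms by (auto simp: L2_space_def)
qed auto

lemma L2_suffix_max: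
  assumes T: "measure_preserving_map M T" and f: "f \<in> L2_space M"
  shows "suffix_max T f n \<in> L2_space M"
proof (induction n)
  case (Suc n)
  then show ?case
    using L2_max[OF L2_measure_preserving[OF T Suc] L2_orbit_sum[OF T f, of "Suc n"]]
    by (subst suffix_max.simps(2)[abs_def]) simp
qed (simp add: L2_zero)

lemma L2_orbit_max:
  assumes T: "measure_preserving_map M T" and f: "f \<in> L2_space M"
  shows "orbit_max T f n \<in> L2_space M"
proof (induction n)
  case (Suc n)
  then show ?case
    using L2_max[OF Suc L2_abs[OF L2_orbit_sum[OF T f, of "Suc n"]]]
    by (subst orbit_max.simps(2)[abs_def]) simp
qed (simp add: L2_zero)

context prob_space
begin

lemma integrable_bounded:
  fixes f :: "'a \<Rightarrow> real"
  assumes "f \<in> borel_measurable M" "\<And>y. \<bar>f y\<bar> \<le> B"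
  shows "integrable M f"
  using assms by (intro integrable_const_bound[where B = B]) auto

lemma abs_power_le: "\<bar>a\<bar> \<le> A \<Longrightarrow> \<bar>a ^ i\<bar> \<le> A ^ i" for a :: real
  unfolding power_abs by (rule power_mono) auto

lemma abs_power_mult_le:
  fixes a b :: real
  assumes "\<bar>a\<bar> \<le> A" "\<bar>b\<bar> \<le> B"
  shows "\<bar>a ^ i * b ^ j\<bar> \<le> A ^ i * B ^ j"
  unfolding abs_mult power_abs using assms by (intro mult_mono power_mono) auto

lemma is_transfer_funpow_zero:
  assumes T: "measure_preserving_map M T" and u: "is_transfer M T m (\<lambda>_. 0)" and n: "1 \<le> n"
  shows "is_transfer M (T ^^ n) m (\<lambda>_. 0)"
proof -
  have "is_transfer M (T ^^ k) (\<lambda>_. 0) (\<lambda>_. 0)" for k by (rule is_transfer_zero)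
  from is_transfer_comp[OF measure_preserving_funpow[OF T] u this, of "n - 1"]
  have "is_transfer M (T ^^ Suc (n - 1)) m (\<lambda>_. 0)"
    by (simp only: funpow_Suc_right comp_def)
  then show ?thesis using n by simp
qed

lemma martingale_difference_orthogonal:
  assumes T: "measure_preserving_map M T" and m: "m \<in> L2_space M" and u: "is_transfer M T m (\<lambda>_. 0)"
    and "i \<noteq> j"
  shows "(\<integral>y. m ((T ^^ i) y) * m ((T ^^ j) y) \<partial>M) = 0"
proof -
  have *: "(\<integral>y. m ((T ^^ i) y) * m ((T ^^ (i + Suc k)) y) \<partial>M) = 0" for i k
  proof -
    note [measurable] = measurable_funpow_preserving[OF T] L2_measurable[OF m] measurable_measure_preserving[OF T]
    have "(\<integral>y. m ((T ^^ i) y) * m ((T ^^ (i + Suc k)) y) \<partial>M)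
       = (\<integral>y. m ((T ^^ i) y) * m ((T ^^ k) (T ((T ^^ i) y))) \<partial>M)"
      by (subst add.commute) (simp add: funpow_add funpow_swap1)
    also have "\<dots> = (\<integral>y. m y * m ((T ^^ k) (T y)) \<partial>M)"
      by (intro integral_measure_preserving[OF measure_preserving_funpow[OF T], of "\<lambda>y. m y * m ((T ^^ k) (T y))"])
         measurable
    also have "\<dots> = 0"
      using is_transfer_dual[OF T m u L2_funpow[OF T m, of k]] by simp
    finally show ?thesis .
  qed
  from \<open>i \<noteq> j\<close> consider k where "j = i + Suc k" | k where "i = j + Suc k"
    by (metis less_iff_Suc_add add_Suc_right nat_neq_iff)
  then show ?thesis
  proof cases
    case 2
    then show ?thesis using *[of j k] by (simp only: mult.commute)
  qed (simp only: *)
qed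

lemma L2_norm_martingale_sum:
  assumes T: "measure_preserving_map M T" and m: "m \<in> L2_space M" and u: "is_transfer M T m (\<lambda>_. 0)"
  shows "L2_norm M (orbit_sum T m n) = sqrt (real n) * L2_norm M m"
proof -
  have "(L2_norm M (orbit_sum T m n))\<^sup>2 = (\<Sum>j<n. (L2_norm M (\<lambda>y. m ((T ^^ j) y)))\<^sup>2)"
    unfolding orbit_sum_def[abs_def]
    by (rule L2_norm_sum_orthogonal) (use L2_funpow[OF T m] martingale_difference_orthogonal[OF T m u] in auto)
  also have "\<dots> = (sqrt (real n) * L2_norm M m)\<^sup>2"
    by (simp add: L2_norm_funpow[OF T m] power_mult_distrib)
  finally show ?thesis by (rule power2_eq_imp_eq) auto
qed

text \<open>
  Read backwards in time, the sums of a reversed martingale difference form a martingale, and the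
  running maximum of that martingale is the suffix maximum. Writing \<open>M\<close> for the maximum and \<open>S\<close> for
  the martingale, \<open>M S - M\<^sup>2 / 2\<close> grows by at least \<open>M m\<close> in every step, because \<open>x \<mapsto> x S - x\<^sup>2 / 2\<close>
  is increasing up to \<open>x = S\<close>; as \<open>M m\<close> has mean zero, \<open>M S - M\<^sup>2 / 2\<close> has nonnegative mean. This is
  Doob's inequality without stopping times.
\<close>

lemma L2_norm_suffix_max_le:
  assumes T: "measure_preserving_map M T" and m: "m \<in> L2_space M" and u: "is_transfer M T m (\<lambda>_. 0)"
  shows "L2_norm M (suffix_max T m n) \<le> 2 * L2_norm M (orbit_sum T m n)"
proof -
  note SL2 = L2_orbit_sum[OF T m] and ML2 = L2_suffix_max[OF T m]
  note [measurable] = L2_measurable[OF SL2] L2_measurable[OF ML2]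
  define D where "D = (\<lambda>n y. suffix_max T m n y * orbit_sum T m n y - (suffix_max T m n y)\<^sup>2 / 2)"
  have D_int: "integrable M (D n)" for n
    unfolding D_def using L2_mult_integrable[OF ML2 SL2] L2_square_integrable[OF ML2] by auto
  have "0 \<le> (\<integral>y. D n y \<partial>M)"
  proof (induction n)
    case (Suc n)
    \<comment> \<open>The maximum only changes when it is overtaken by the new sum \<open>s\<close>, where the parabola peaks.\<close>
    have "D n (T y) + m y * suffix_max T m n (T y) \<le> D (Suc n) y" for y
    proof -
      define x s where "x = suffix_max T m n (T y)" "s = orbit_sum T m n (T y) + m y"
      have "x * s - x\<^sup>2 / 2 \<le> max x s * s - (max x s)\<^sup>2 / 2"
        using zero_le_power2[of "x - s"] by (simp add: max_def power2_eq_square algebra_simps)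
      then show ?thesis unfolding D_def x_s_def suffix_max.simps orbit_sum_Suc_shift
        by (simp add: algebra_simps)
    qed
    then have "(\<integral>y. D n (T y) + m y * suffix_max T m n (T y) \<partial>M) \<le> (\<integral>y. D (Suc n) y \<partial>M)"
      using integrable_measure_preserving[OF T D_int] D_int
        L2_mult_integrable[OF m L2_measure_preserving[OF T ML2]]
      by (intro integral_mono) auto
    moreover have "(\<integral>y. D n (T y) + m y * suffix_max T m n (T y) \<partial>M) = (\<integral>y. D n y \<partial>M)"
      using integrable_measure_preserving[OF T D_int] L2_mult_integrable[OF m L2_measure_preserving[OF T ML2]]
        integral_measure_preserving[OF T borel_measurable_integrable[OF D_int]]
        is_transfer_dual[OF T m u ML2[of n]] by simp
    ultimately show ?case using Suc by simp
  qed (simp add: D_def)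
  moreover have "(\<integral>y. D n y \<partial>M)
      = (\<integral>y. suffix_max T m n y * orbit_sum T m n y \<partial>M) - (L2_norm M (suffix_max T m n))\<^sup>2 / 2"
    unfolding D_def L2_norm_square using L2_mult_integrable[OF ML2 SL2] L2_square_integrable[OF ML2] by simp
  ultimately have "L2_norm M (suffix_max T m n) * L2_norm M (suffix_max T m n)
      \<le> L2_norm M (suffix_max T m n) * (2 * L2_norm M (orbit_sum T m n))"
    using Cauchy_Schwarz_L2[OF ML2[of n] SL2[of n]] by (simp add: power2_eq_square)
  then show ?thesis
    using L2_norm_nonneg[of M "suffix_max T m n"] L2_norm_nonneg[of M "orbit_sum T m n"]
    by (cases "L2_norm M (suffix_max T m n) = 0") (auto simp: mult_le_cancel_left)
qed

text \<open>
  The constant \<open>5\<close> is \<open>1 + 2 + 2\<close>: the partial sums differ from the full sum by suffix sums, whose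
  maximum and minimum are each bounded by Doob's inequality.
\<close>

lemma L2_norm_orbit_max_martingale:
  assumes T: "measure_preserving_map M T" and m: "m \<in> L2_space M" and u: "is_transfer M T m (\<lambda>_. 0)"
  shows "L2_norm M (orbit_max T m n) \<le> 5 * sqrt (real n) * L2_norm M m"
proof -
  have m': "(\<lambda>y. - m y) \<in> L2_space M" using m by (rule L2_uminus)
  have u': "is_transfer M T (\<lambda>y. - m y) (\<lambda>_. 0)" using is_transfer_cmult[OF u, of "-1"] by simp
  have nm: "L2_norm M (\<lambda>y. - m y) = L2_norm M m" using L2_norm_cmult[of M "-1" m] by simp
  note L2s = L2_abs[OF L2_orbit_sum[OF T m, of n]] L2_suffix_max[OF T m, of n] L2_suffix_max[OF T m', of n]
  have "L2_norm M (orbit_max T m n)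
     \<le> L2_norm M (\<lambda>y. \<bar>orbit_sum T m n y\<bar> + suffix_max T m n y + suffix_max T (\<lambda>y. - m y) n y)"
    using orbit_max_le_suffix_max[of T m n] orbit_max_nonneg[of T m n]
    by (intro L2_norm_mono L2_add L2s L2_measurable[OF L2_orbit_max[OF T m]] AE_I2)
       (metis abs_of_nonneg order_trans)
  also have "\<dots> \<le> L2_norm M (\<lambda>y. \<bar>orbit_sum T m n y\<bar>) + L2_norm M (suffix_max T m n)
      + L2_norm M (suffix_max T (\<lambda>y. - m y) n)"
    using L2_norm_triangle[OF L2_add[OF L2s(1,2)] L2s(3)] L2_norm_triangle[OF L2s(1,2)] by simp
  also have "L2_norm M (\<lambda>y. \<bar>orbit_sum T m n y\<bar>) = L2_norm M (orbit_sum T m n)"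
    by (simp add: L2_norm_def)
  finally show ?thesis
    using L2_norm_suffix_max_le[OF T m u, of n] L2_norm_suffix_max_le[OF T m' u', of n]
    unfolding L2_norm_martingale_sum[OF T m u] L2_norm_martingale_sum[OF T m' u'] nm by simp
qed

text \<open>
  The fourth moment serves tightness: over a window of length \<open>n / k\<close> it is of order \<open>(n / k)\<^sup>2\<close>, so
  that the sum over \<open>k\<close> windows is still small compared with \<open>n\<^sup>2\<close>.
\<close>

lemma fourth_moment_martingale_sum:
  assumes T: "measure_preserving_map M T" and m [measurable]: "m \<in> borel_measurable M"
    and K: "\<And>y. \<bar>m y\<bar> \<le> K" and u: "is_transfer M T m (\<lambda>_. 0)"
  shows "(\<integral>y. (orbit_sum T m n y) ^ 4 \<partial>M) \<le> 5 * K ^ 4 * (real n)\<^sup>2"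
proof (induction n)
  case (Suc n)
  have K0: "0 \<le> K" using K[of undefined] by simp
  have mL2: "m \<in> L2_space M" using K by (intro L2_bounded) auto
  note [measurable] = measurable_orbit_sum[OF T m] measurable_measure_preserving[OF T]
  have bd: "\<bar>orbit_sum T m n y\<bar> \<le> real n * K" for y using K by (rule orbit_sum_bound)
  define Y where "Y = (\<lambda>y. orbit_sum T m n (T y))"
  have [measurable]: "Y \<in> borel_measurable M" unfolding Y_def by measurable
  have bY: "\<bar>Y y\<bar> \<le> real n * K" for y unfolding Y_def by (rule bd)
  have int: "integrable M (\<lambda>y. m y ^ i * Y y ^ j)" for i j
    by (rule integrable_bounded[OF _ abs_power_mult_le[OF K bY]]) measurable
  have m2: "(\<integral>y. m y ^ 2 * Y y ^ 2 \<partial>M) \<le> K\<^sup>2 * (real n * K\<^sup>2)"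
  proof -
    have "(\<integral>y. m y ^ 2 * Y y ^ 2 \<partial>M) \<le> (\<integral>y. K\<^sup>2 * (Y y)\<^sup>2 \<partial>M)"
      using int[of 0 2] K by (intro integral_mono int mult_right_mono) (auto simp: abs_le_square_iff[symmetric] K0)
    also have "\<dots> = K\<^sup>2 * (L2_norm M (orbit_sum T m n))\<^sup>2"
      unfolding L2_norm_square Y_def using integral_measure_preserving[OF T, of "\<lambda>y. (orbit_sum T m n y)\<^sup>2"] by simp
    also have "(L2_norm M (orbit_sum T m n))\<^sup>2 = real n * (\<integral>y. (m y)\<^sup>2 \<partial>M)"
      by (simp add: L2_norm_martingale_sum[OF T mL2 u] power_mult_distrib L2_norm_square)
    also have "(\<integral>y. (m y)\<^sup>2 \<partial>M) \<le> (\<integral>y. K\<^sup>2 \<partial>M)"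
      using L2_square_integrable[OF mL2] K by (intro integral_mono) (auto simp: abs_le_square_iff[symmetric] K0)
    finally show ?thesis by (simp add: prob_space mult_left_mono)
  qed
  have m3: "(\<integral>y. m y ^ 3 * Y y ^ 1 \<partial>M) \<le> K ^ 3 * (real n * K)"
  proof -
    have "(\<integral>y. m y ^ 3 * Y y ^ 1 \<partial>M) \<le> (\<integral>y. K ^ 3 * (real n * K) \<partial>M)"
    proof (intro integral_mono int)
      fix y
      have "\<bar>m y ^ 3 * Y y ^ 1\<bar> \<le> K ^ 3 * (real n * K)"
        unfolding abs_mult power_abs using bY[of y] by (intro mult_mono power_mono K) (auto simp: K0)
      then show "m y ^ 3 * Y y ^ 1 \<le> K ^ 3 * (real n * K)" by linarith
    qed auto
    then show ?thesis by (simp add: prob_space)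
  qed
  have m4: "(\<integral>y. m y ^ 4 * Y y ^ 0 \<partial>M) \<le> K ^ 4"
  proof -
    have "(\<integral>y. m y ^ 4 * Y y ^ 0 \<partial>M) \<le> (\<integral>y. K ^ 4 \<partial>M)"
    proof (intro integral_mono int)
      fix y
      show "m y ^ 4 * Y y ^ 0 \<le> K ^ 4"
        using power_mono[OF K[of y], of 4] by (simp add: power_even_abs)
    qed auto
    then show ?thesis by (simp add: prob_space)
  qed
  have m1: "(\<integral>y. m y ^ 1 * Y y ^ 3 \<partial>M) = 0"
  proof -
    have "\<bar>orbit_sum T m n y ^ 3\<bar> \<le> (real n * K) ^ 3" for y
      unfolding power_abs by (intro power_mono bd) auto
    then have "(\<integral>y. m y * orbit_sum T m n (T y) ^ 3 \<partial>M) = 0"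
      using is_transferD[OF u, of "\<lambda>y. orbit_sum T m n y ^ 3" "(real n * K) ^ 3"] by simp
    then show ?thesis by (simp add: Y_def)
  qed
  have m0: "(\<integral>y. m y ^ 0 * Y y ^ 4 \<partial>M) \<le> 5 * K ^ 4 * (real n)\<^sup>2"
    using Suc integral_measure_preserving[OF T, of "\<lambda>y. (orbit_sum T m n y) ^ 4"] by (simp add: Y_def)
  define e where "e = (\<lambda>i j y. m y ^ i * Y y ^ j)"
  have int': "integrable M (e i j)" for i j unfolding e_def by (rule int)
  have "(orbit_sum T m (Suc n) y) ^ 4 = e 0 4 y + 4 * e 1 3 y + 6 * e 2 2 y + 4 * e 3 1 y + e 4 0 y" for y
    unfolding orbit_sum_Suc_shift Y_def e_def by (simp add: eval_nat_numeral algebra_simps)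
  then have "(\<integral>y. (orbit_sum T m (Suc n) y) ^ 4 \<partial>M)
    = (\<integral>y. e 0 4 y \<partial>M) + 4 * (\<integral>y. e 1 3 y \<partial>M) + 6 * (\<integral>y. e 2 2 y \<partial>M)
      + 4 * (\<integral>y. e 3 1 y \<partial>M) + (\<integral>y. e 4 0 y \<partial>M)"
    using int' by simp
  also have "\<dots> \<le> 5 * K ^ 4 * (real n)\<^sup>2 + 6 * (K\<^sup>2 * (real n * K\<^sup>2)) + 4 * (K ^ 3 * (real n * K)) + K ^ 4"
    using m0 m1 m2 m3 m4 unfolding e_def by linarith
  also have "\<dots> = K ^ 4 * (5 * (real n)\<^sup>2 + 10 * real n + 1)"
    by (simp add: eval_nat_numeral algebra_simps)
  also have "\<dots> \<le> K ^ 4 * (5 * (real (Suc n))\<^sup>2)"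
    using K0 by (intro mult_left_mono) (auto simp: power2_eq_square algebra_simps)
  finally show ?case by (simp add: algebra_simps)
qed simp

lemma suffix_max_bound:
  assumes "\<And>y. \<bar>m y\<bar> \<le> K" shows "\<bar>suffix_max T m n y\<bar> \<le> real n * K"
proof (induction n arbitrary: y)
  case (Suc n)
  have "0 \<le> K" using assms[of undefined] by simp
  then have "real n * K \<le> real (Suc n) * K" by (intro mult_right_mono) auto
  moreover have "\<bar>orbit_sum T m (Suc n) y\<bar> \<le> real (Suc n) * K" using assms by (rule orbit_sum_bound)
  ultimately show ?case using Suc[of "T y"] by (auto simp: max_def)
qed simp

text \<open>
  The same argument with \<open>M\<^sup>3 S - 3/4 M\<^sup>4\<close>, since \<open>x\<^sup>3 S - 3/4 x\<^sup>4\<close> also increases up to \<open>x = S\<close>.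
\<close>

lemma fourth_moment_suffix_max:
  assumes T: "measure_preserving_map M T" and m [measurable]: "m \<in> borel_measurable M"
    and K: "\<And>y. \<bar>m y\<bar> \<le> K" and u: "is_transfer M T m (\<lambda>_. 0)"
  shows "(\<integral>y. (suffix_max T m n y) ^ 4 \<partial>M) \<le> 32 * (\<integral>y. (orbit_sum T m n y) ^ 4 \<partial>M)"
proof -
  have K0: "0 \<le> K" using K[of undefined] by simp
  have mL2: "m \<in> L2_space M" using K by (intro L2_bounded) auto
  note [measurable] = measurable_orbit_sum[OF T m] measurable_measure_preserving[OF T]
    L2_measurable[OF L2_suffix_max[OF T mL2]]
  have bd: "\<bar>orbit_sum T m n y\<bar> \<le> real n * K" for n y using K by (rule orbit_sum_bound)
  have bd': "\<bar>suffix_max T m n y\<bar> \<le> real n * K" for n y using K by (rule suffix_max_bound)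
  define D where "D = (\<lambda>n y. suffix_max T m n y ^ 3 * orbit_sum T m n y ^ 1
    - 3 / 4 * (suffix_max T m n y ^ 4 * orbit_sum T m n y ^ 0))"
  have int: "integrable M (\<lambda>y. suffix_max T m n y ^ i * orbit_sum T m n y ^ j)" for i j n
    by (rule integrable_bounded[OF _ abs_power_mult_le[OF bd' bd]]) measurable
  have D_int: "integrable M (D n)" for n
    unfolding D_def by (intro Bochner_Integration.integrable_diff Bochner_Integration.integrable_mult_right int)
  have b3: "\<bar>suffix_max T m n y ^ 3\<bar> \<le> (real n * K) ^ 3" for n y
    unfolding power_abs by (intro power_mono bd') auto
  have int3: "integrable M (\<lambda>y. m y * suffix_max T m n (T y) ^ 3)" for n
    by (rule integrable_const_bound[where B = "K * (real n * K) ^ 3"])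
       (auto simp: abs_mult intro!: mult_mono K K0 b3)
  have "0 \<le> (\<integral>y. D n y \<partial>M)"
  proof (induction n)
    case (Suc n)
    have "D n (T y) + m y * suffix_max T m n (T y) ^ 3 \<le> D (Suc n) y" for y
    proof -
      define x s where "x = suffix_max T m n (T y)" "s = orbit_sum T m n (T y) + m y"
      have x0: "0 \<le> x" unfolding x_s_def by (rule suffix_max_nonneg)
      have "x ^ 3 * s - 3 / 4 * x ^ 4 \<le> max x s ^ 3 * s - 3 / 4 * (max x s) ^ 4"
      proof (cases "x \<le> s")
        case True
        have "0 \<le> (s - x)\<^sup>2 * (s\<^sup>2 + 2 * x * s + 3 * x\<^sup>2)"
          using x0 True by (intro mult_nonneg_nonneg add_nonneg_nonneg) auto
        also have "\<dots> = s ^ 4 - 4 * x ^ 3 * s + 3 * x ^ 4"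
          by (simp add: eval_nat_numeral algebra_simps)
        finally have "4 * (x ^ 3 * s) - 3 * x ^ 4 \<le> s ^ 4" by (simp add: mult.assoc)
        moreover have "s ^ 3 * s = s ^ 4" by (simp add: eval_nat_numeral)
        ultimately show ?thesis using True by (simp add: max_def)
      qed (simp add: max_def)
      then show ?thesis unfolding D_def x_s_def suffix_max.simps orbit_sum_Suc_shift
        by (simp add: algebra_simps)
    qed
    then have "(\<integral>y. D n (T y) + m y * suffix_max T m n (T y) ^ 3 \<partial>M) \<le> (\<integral>y. D (Suc n) y \<partial>M)"
      using integrable_measure_preserving[OF T D_int] D_int int3 by (intro integral_mono) auto
    moreover have "(\<integral>y. m y * suffix_max T m n (T y) ^ 3 \<partial>M) = 0"
      using is_transferD[OF u, of "\<lambda>y. suffix_max T m n y ^ 3" "(real n * K) ^ 3"] b3 by simp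
    ultimately show ?case
      using Suc integrable_measure_preserving[OF T D_int] int3
        integral_measure_preserving[OF T borel_measurable_integrable[OF D_int]] by simp
  qed (simp add: D_def)
  moreover have "D n y \<le> 8 * orbit_sum T m n y ^ 4 - 1 / 4 * suffix_max T m n y ^ 4" for y
  proof -
    define x s where "x = suffix_max T m n y" "s = orbit_sum T m n y"
    have x0: "0 \<le> x" unfolding x_s_def by (rule suffix_max_nonneg)
    \<comment> \<open>Leaves \<open>3/4 - 1/2\<close> of the fourth power of the maximum to be absorbed.\<close>
    have "x ^ 3 * s \<le> 8 * s ^ 4 + 1 / 2 * x ^ 4"
    proof (cases "s \<le> x / 2")
      case True
      then have "x ^ 3 * s \<le> x ^ 3 * (x / 2)" using x0 by (intro mult_left_mono) auto
      also have "\<dots> = 1 / 2 * x ^ 4" by (simp add: eval_nat_numeral)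
      finally have "x ^ 3 * s \<le> 1 / 2 * x ^ 4" .
      moreover have "0 \<le> s ^ 4" by simp
      ultimately show ?thesis by linarith
    next
      case False
      then have "x ^ 3 * s \<le> (2 * s) ^ 3 * s" using x0 by (intro mult_right_mono power_mono) auto
      also have "\<dots> = 8 * s ^ 4" by (simp add: eval_nat_numeral)
      finally have "x ^ 3 * s \<le> 8 * s ^ 4" .
      moreover have "0 \<le> x ^ 4" by simp
      ultimately show ?thesis by linarith
    qed
    then show ?thesis unfolding D_def x_s_def[symmetric] by simp
  qed
  then have "(\<integral>y. D n y \<partial>M) \<le> (\<integral>y. 8 * orbit_sum T m n y ^ 4 - 1 / 4 * suffix_max T m n y ^ 4 \<partial>M)"
    using int[of n 0 4] int[of n 4 0] D_int by (intro integral_mono) auto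
  moreover have "(\<integral>y. 8 * orbit_sum T m n y ^ 4 - 1 / 4 * suffix_max T m n y ^ 4 \<partial>M)
     = 8 * (\<integral>y. orbit_sum T m n y ^ 4 \<partial>M) - 1 / 4 * (\<integral>y. suffix_max T m n y ^ 4 \<partial>M)"
    using int[of n 0 4] int[of n 4 0] by simp
  ultimately show ?thesis by linarith
qed

lemma fourth_moment_orbit_max:
  assumes T: "measure_preserving_map M T" and m [measurable]: "m \<in> borel_measurable M"
    and K: "\<And>y. \<bar>m y\<bar> \<le> K" and u: "is_transfer M T m (\<lambda>_. 0)"
  shows "integrable M (\<lambda>y. (orbit_max T m n y) ^ 4)"
    "(\<integral>y. (orbit_max T m n y) ^ 4 \<partial>M) \<le> 30000 * K ^ 4 * (real n)\<^sup>2"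
proof -
  have K0: "0 \<le> K" using K[of undefined] by simp
  have mL2: "m \<in> L2_space M" using K by (intro L2_bounded) auto
  have m' [measurable]: "(\<lambda>y. - m y) \<in> borel_measurable M" by simp
  have K': "\<bar>- m y\<bar> \<le> K" for y using K by simp
  have mL2': "(\<lambda>y. - m y) \<in> L2_space M" using mL2 by (rule L2_uminus)
  have u': "is_transfer M T (\<lambda>y. - m y) (\<lambda>_. 0)" using is_transfer_cmult[OF u, of "-1"] by simp
  note [measurable] = measurable_orbit_sum[OF T m] L2_measurable[OF L2_suffix_max[OF T mL2]]
    L2_measurable[OF L2_suffix_max[OF T mL2']] L2_measurable[OF L2_orbit_max[OF T mL2]]
  have intS: "integrable M (\<lambda>y. orbit_sum T m n y ^ 4)"
    by (rule integrable_bounded[OF _ abs_power_le[OF orbit_sum_bound[OF K]]]) measurable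
  have intM: "integrable M (\<lambda>y. suffix_max T m n y ^ 4)"
    by (rule integrable_bounded[OF _ abs_power_le[OF suffix_max_bound[OF K]]]) measurable
  have intM': "integrable M (\<lambda>y. suffix_max T (\<lambda>y. - m y) n y ^ 4)"
    by (rule integrable_bounded[OF _ abs_power_le[OF suffix_max_bound[OF K']]]) measurable
  have le: "orbit_max T m n y ^ 4 \<le> 81 * (orbit_sum T m n y ^ 4 + suffix_max T m n y ^ 4
      + suffix_max T (\<lambda>y. - m y) n y ^ 4)" for y
  proof -
    define a b c where "a = \<bar>orbit_sum T m n y\<bar>" "b = suffix_max T m n y" "c = suffix_max T (\<lambda>y. - m y) n y"
    have nn: "0 \<le> a" "0 \<le> b" "0 \<le> c" unfolding a_b_c_def by (auto simp: suffix_max_nonneg)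
    define x where "x = max a (max b c)"
    have "orbit_max T m n y ^ 4 \<le> (3 * x) ^ 4"
      using orbit_max_le_suffix_max[of T m n y] unfolding a_b_c_def[symmetric]
      by (intro power_mono orbit_max_nonneg) (auto simp: x_def)
    also have "\<dots> = 81 * x ^ 4" by (simp add: power_mult_distrib)
    also have "x ^ 4 \<le> a ^ 4 + b ^ 4 + c ^ 4"
      unfolding x_def max_def using nn by auto
    also have "a ^ 4 = orbit_sum T m n y ^ 4" by (simp add: a_b_c_def power_even_abs)
    finally show ?thesis unfolding a_b_c_def by simp
  qed
  show int: "integrable M (\<lambda>y. (orbit_max T m n y) ^ 4)"
  proof (rule Bochner_Integration.integrable_bound)
    show "integrable M (\<lambda>y. 81 * (orbit_sum T m n y ^ 4 + suffix_max T m n y ^ 4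
      + suffix_max T (\<lambda>y. - m y) n y ^ 4))" using intS intM intM' by auto
    show "AE y in M. norm (orbit_max T m n y ^ 4) \<le> norm (81 * (orbit_sum T m n y ^ 4 + suffix_max T m n y ^ 4
      + suffix_max T (\<lambda>y. - m y) n y ^ 4))"
      using le by (intro AE_I2) (auto simp: power_even_abs zero_le_even_power)
  qed measurable
  have "(\<integral>y. (orbit_max T m n y) ^ 4 \<partial>M) \<le> (\<integral>y. 81 * (orbit_sum T m n y ^ 4 + suffix_max T m n y ^ 4
      + suffix_max T (\<lambda>y. - m y) n y ^ 4) \<partial>M)"
    using int intS intM intM' le by (intro integral_mono) auto
  also have "\<dots> = 81 * ((\<integral>y. orbit_sum T m n y ^ 4 \<partial>M) + (\<integral>y. suffix_max T m n y ^ 4 \<partial>M)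
     + (\<integral>y. suffix_max T (\<lambda>y. - m y) n y ^ 4 \<partial>M))"
    using intS intM intM' by simp
  also have "\<dots> \<le> 81 * (65 * (5 * K ^ 4 * (real n)\<^sup>2))"
    using fourth_moment_suffix_max[OF T m K u, of n] fourth_moment_suffix_max[OF T m' K' u', of n]
      fourth_moment_martingale_sum[OF T m K u, of n] by (simp add: orbit_sum_uminus)
  also have "\<dots> \<le> 30000 * K ^ 4 * (real n)\<^sup>2"
    using K0 by (simp add: mult_right_mono)
  finally show "(\<integral>y. (orbit_max T m n y) ^ 4 \<partial>M) \<le> 30000 * K ^ 4 * (real n)\<^sup>2" .
qed

end

lemma abs_mono_nonneg: "0 \<le> a \<Longrightarrow> a \<le> b \<Longrightarrow> \<bar>a\<bar> \<le> \<bar>b\<bar>" for a b :: real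
  by simp

section \<open>A maximal inequality for stationary sequences\<close>

lemma is_transfer_apply:
  assumes T: "measure_preserving_map M T" and f: "integrable M f"
  shows "is_transfer M T (\<lambda>y. f (T y)) f"
  unfolding is_transfer_def
proof (intro conjI ballI impI)
  fix g :: "'a \<Rightarrow> real" assume "g \<in> borel_measurable M"
  then show "(\<integral>y. f y * g y \<partial>M) = (\<integral>y. f (T y) * g (T y) \<partial>M)"
    using integral_measure_preserving[OF T, of "\<lambda>y. f y * g y"] f by auto
qed fact

context prob_space
begin

lemma martingale_part:
  assumes T: "measure_preserving_map M T" and f: "integrable M f" and v: "is_transfer M T f v"
  shows "is_transfer M T (\<lambda>y. f y - v (T y)) (\<lambda>_. 0)"
  using is_transfer_diff[OF T f integrable_measure_preserving[OF T integrable_is_transfer[OF v]] v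
      is_transfer_apply[OF T integrable_is_transfer[OF v]]] by simp

text \<open>
  Replacing \<open>f\<close> by its predictable part \<open>v \<circ> T\<close> removes a martingale difference, whose orbit sum
  transfers to zero. Hence the transferred orbit sum does not change.
\<close>

lemma is_transfer_orbit_sum_predictable:
  assumes T: "measure_preserving_map M T" and f: "integrable M f" and v: "is_transfer M T f v"
    and u: "is_transfer M (T ^^ n) (orbit_sum T f n) u"
  shows "is_transfer M (T ^^ n) (orbit_sum T (\<lambda>y. v (T y)) n) u"
proof -
  define m where "m = (\<lambda>y. f y - v (T y))"
  have int: "integrable M (orbit_sum T f n)" if "integrable M f" for f
    unfolding orbit_sum_def[abs_def]
    by (intro Bochner_Integration.integrable_sum integrable_measure_preserving[OF measure_preserving_funpow[OF T] that])
  have mint: "integrable M m"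
    unfolding m_def using f integrable_measure_preserving[OF T integrable_is_transfer[OF v]] by simp
  have m0: "is_transfer M T m (\<lambda>_. 0)" unfolding m_def by (rule martingale_part[OF T f v])
  have "is_transfer M (T ^^ n) (orbit_sum T m n) (\<lambda>y. \<Sum>i\<in>{1..n}. 0)"
    by (rule is_transfer_orbit_sum[OF T mint is_transfer_funpow_zero[OF T m0]])
  then have "is_transfer M (T ^^ n) (orbit_sum T m n) (\<lambda>y. 0)" by simp
  from is_transfer_diff[OF measure_preserving_funpow[OF T] int[OF f] int[OF mint] u this]
  have "is_transfer M (T ^^ n) (\<lambda>y. orbit_sum T f n y - orbit_sum T m n y) u" by simp
  moreover have "orbit_sum T f n y - orbit_sum T m n y = orbit_sum T (\<lambda>y. v (T y)) n y" for y
    by (simp add: m_def orbit_sum_diff)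
  ultimately show ?thesis by simp
qed

lemma L2_sqrt_sum_squares:
  assumes f: "\<And>i. i < k \<Longrightarrow> f i \<in> L2_space M" and n: "\<And>i. i < k \<Longrightarrow> L2_norm M (f i) = c" and c: "0 \<le> c"
  shows "(\<lambda>y. sqrt (\<Sum>i<k. (f i y)\<^sup>2)) \<in> L2_space M"
    "L2_norm M (\<lambda>y. sqrt (\<Sum>i<k. (f i y)\<^sup>2)) = sqrt (real k) * c"
proof -
  have sq: "(sqrt (\<Sum>i<k. (f i y)\<^sup>2))\<^sup>2 = (\<Sum>i<k. (f i y)\<^sup>2)" for y
    by (simp add: sum_nonneg)
  have int: "integrable M (\<lambda>y. (f i y)\<^sup>2)" if "i < k" for i using f[OF that] by (rule L2_square_integrable)
  have meas: "(\<lambda>y. \<Sum>i<k. (f i y)\<^sup>2) \<in> borel_measurable M"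
    using int by (intro borel_measurable_sum) auto
  have "integrable M (\<lambda>y. \<Sum>i<k. (f i y)\<^sup>2)"
    using int by (intro Bochner_Integration.integrable_sum) auto
  then show "(\<lambda>y. sqrt (\<Sum>i<k. (f i y)\<^sup>2)) \<in> L2_space M"
    unfolding L2_space_def mem_Collect_eq sq using measurable_compose[OF meas borel_measurable_sqrt] by blast
  have "(L2_norm M (\<lambda>y. sqrt (\<Sum>i<k. (f i y)\<^sup>2)))\<^sup>2 = (\<Sum>i<k. (L2_norm M (f i))\<^sup>2)"
    unfolding L2_norm_square sq by (rule Bochner_Integration.integral_sum) (rule int, simp)
  also have "\<dots> = (\<Sum>i<k. c\<^sup>2)" using n by (intro sum.cong) auto
  also have "\<dots> = (sqrt (real k) * c)\<^sup>2" by (simp add: power_mult_distrib)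
  finally show "L2_norm M (\<lambda>y. sqrt (\<Sum>i<k. (f i y)\<^sup>2)) = sqrt (real k) * c"
    by (rule power2_eq_imp_eq) (use c in auto)
qed

text \<open>
  Induction on the scale. Subtracting the martingale difference \<open>f - v\<^sub>0 \<circ> T\<close>, whose maximum is
  controlled by Doob's inequality, leaves the sums of \<open>v\<^sub>0 \<circ> T\<close>. Grouping these in pairs gives sums of
  \<open>v\<^sub>0 \<circ> T + v\<^sub>0 \<circ> T\<^sup>2\<close> along \<open>T\<^sup>2\<close>, whose transferred sums over dyadic times are exactly the next
  terms of the sequence \<open>v\<close>.
\<close>

lemma L2_norm_orbit_max_dyadic:
  assumes "measure_preserving_map M T" "f \<in> L2_space M"
    and "\<And>r. r < R \<Longrightarrow> is_transfer M (T ^^ (2 ^ r)) (orbit_sum T f (2 ^ r)) (v r)"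
  shows "L2_norm M (orbit_max T f (2 ^ R))
    \<le> sqrt (2 ^ R) * (5 * L2_norm M f + 13 * (\<Sum>r<R. L2_norm M (v r) / sqrt (2 ^ r)))"
  using assms
proof (induction R arbitrary: T f v)
  case 0
  have "orbit_max T f (Suc 0) = (\<lambda>y. \<bar>f y\<bar>)" by (simp add: fun_eq_iff orbit_sum_def)
  then have "L2_norm M (orbit_max T f (2 ^ 0)) = L2_norm M f"
    unfolding power_0 One_nat_def by (simp add: L2_norm_def)
  then show ?case using L2_norm_nonneg[of M f] by (simp del: orbit_max.simps)
next
  case (Suc R)
  note T = Suc.prems(1) and f = Suc.prems(2) and v = Suc.prems(3)
  note fint = L2_integrable[OF f]
  define v0 where "v0 = v 0"
  have one: "orbit_sum T f (Suc 0) = f" by (simp add: fun_eq_iff orbit_sum_def)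
  have v0: "is_transfer M T f v0" using v[of 0] by (simp add: v0_def one)
  have v0L2: "v0 \<in> L2_space M" by (rule is_transfer_L2[OF T f v0])
  have v0T: "(\<lambda>y. v0 (T y)) \<in> L2_space M" by (rule L2_measure_preserving[OF T v0L2])
  define m where "m = (\<lambda>y. f y - v0 (T y))"
  have mL2: "m \<in> L2_space M" unfolding m_def by (rule L2_diff[OF f v0T])
  have m0: "is_transfer M T m (\<lambda>_. 0)" unfolding m_def by (rule martingale_part[OF T fint v0])
  have nm: "L2_norm M m \<le> L2_norm M f + L2_norm M v0"
    unfolding m_def using L2_norm_triangle_diff[OF f v0T] L2_norm_measure_preserving[OF T L2_measurable[OF v0L2]]
    by simp
  define T2 where "T2 = T ^^ 2"
  have T2: "measure_preserving_map M T2" unfolding T2_def by (rule measure_preserving_funpow[OF T])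
  have T2pow: "T2 ^^ k = T ^^ (2 * k)" for k unfolding T2_def by (simp add: funpow_mult)
  define f1 where "f1 = (\<lambda>y. v0 (T y) + v0 (T (T y)))"
  have v0TT: "(\<lambda>y. v0 (T (T y))) \<in> L2_space M" by (rule L2_measure_preserving[OF T v0T])
  have f1L2: "f1 \<in> L2_space M" unfolding f1_def by (rule L2_add[OF v0T v0TT])
  have nf1: "L2_norm M f1 \<le> 2 * L2_norm M v0"
    unfolding f1_def using L2_norm_triangle[OF v0T v0TT]
      L2_norm_measure_preserving[OF T L2_measurable[OF v0L2]] L2_norm_measure_preserving[OF T L2_measurable[OF v0T]]
    by simp
  have pair: "orbit_sum T2 f1 k y = orbit_sum T (\<lambda>y. v0 (T y)) (2 * k) y" for k y
    by (induction k) (auto simp: orbit_sum_Suc T2pow f1_def funpow_swap1)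
  have v1: "is_transfer M (T2 ^^ (2 ^ r)) (orbit_sum T2 f1 (2 ^ r)) (v (Suc r))" if "r < R" for r
  proof -
    have "orbit_sum T2 f1 (2 ^ r) = orbit_sum T (\<lambda>y. v0 (T y)) (2 ^ Suc r)"
      by (simp add: fun_eq_iff pair)
    then show ?thesis
      using is_transfer_orbit_sum_predictable[OF T fint v0 v[of "Suc r"]] that by (simp add: T2pow)
  qed
  define q where "q = (\<lambda>y. sqrt (\<Sum>i<2 ^ R. (v0 ((T ^^ (2 * i + 1)) y))\<^sup>2))"
  have qL2: "q \<in> L2_space M" and nq: "L2_norm M q = sqrt (2 ^ R) * L2_norm M v0"
    unfolding q_def
    using L2_sqrt_sum_squares[of "2 ^ R" "\<lambda>i y. v0 ((T ^^ (2 * i + 1)) y)" "L2_norm M v0",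
        OF L2_funpow[OF T v0L2] L2_norm_funpow[OF T v0L2]] by simp_all
  have bound: "orbit_max T f (2 ^ Suc R) y \<le> orbit_max T m (2 ^ Suc R) y + orbit_max T2 f1 (2 ^ R) y + q y" for y
  proof (rule orbit_max_le)
    fix k :: nat assume k: "k \<le> 2 ^ Suc R"
    have "\<bar>orbit_sum T (\<lambda>y. v0 (T y)) k y\<bar> \<le> orbit_max T2 f1 (2 ^ R) y + q y"
    proof (cases "even k")
      case True
      then obtain i where i: "k = 2 * i" by blast
      have "0 \<le> q y" by (simp add: q_def sum_nonneg)
      then show ?thesis
        using k abs_orbit_sum_le_orbit_max[of i "2 ^ R" T2 f1 y] unfolding i pair by simp
    next
      case False
      then obtain i where i: "k = 2 * i + 1" by (elim oddE)
      have i2: "i < 2 ^ R" using k i by simp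
      have "(v0 ((T ^^ (2 * i + 1)) y))\<^sup>2 \<le> (\<Sum>i<2 ^ R. (v0 ((T ^^ (2 * i + 1)) y))\<^sup>2)"
        using i2 by (intro member_le_sum) auto
      then have "\<bar>v0 ((T ^^ (2 * i + 1)) y)\<bar> \<le> q y"
        unfolding q_def by (intro real_le_rsqrt) simp
      moreover have "orbit_sum T (\<lambda>y. v0 (T y)) k y = orbit_sum T2 f1 i y + v0 ((T ^^ (2 * i + 1)) y)"
        unfolding i by (simp add: orbit_sum_Suc pair)
      ultimately show ?thesis
        using abs_orbit_sum_le_orbit_max[of i "2 ^ R" T2 f1 y] i2 by linarith
    qed
    moreover have "orbit_sum T f k y = orbit_sum T m k y + orbit_sum T (\<lambda>y. v0 (T y)) k y"
      by (simp add: m_def orbit_sum_diff)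
    ultimately show "\<bar>orbit_sum T f k y\<bar> \<le> orbit_max T m (2 ^ Suc R) y + orbit_max T2 f1 (2 ^ R) y + q y"
      using abs_orbit_sum_le_orbit_max[OF k, of T m y] by linarith
  qed
  define s where "s = sqrt (2 ^ R :: real)"
  have s0: "0 \<le> s" by (simp add: s_def)
  define \<Sigma> where "\<Sigma> = (\<Sum>r<R. L2_norm M (v (Suc r)) / sqrt (2 ^ r))"
  have "L2_norm M (orbit_max T f (2 ^ Suc R))
     \<le> L2_norm M (\<lambda>y. orbit_max T m (2 ^ Suc R) y + orbit_max T2 f1 (2 ^ R) y + q y)"
    by (intro L2_norm_mono AE_I2 L2_add L2_orbit_max[OF T mL2] L2_orbit_max[OF T2 f1L2] qL2
        L2_measurable[OF L2_orbit_max[OF T f]] abs_mono_nonneg[OF orbit_max_nonneg bound])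
  also have "\<dots> \<le> L2_norm M (orbit_max T m (2 ^ Suc R)) + L2_norm M (orbit_max T2 f1 (2 ^ R)) + L2_norm M q"
    using L2_norm_triangle[OF L2_add[OF L2_orbit_max[OF T mL2] L2_orbit_max[OF T2 f1L2]] qL2]
      L2_norm_triangle[OF L2_orbit_max[OF T mL2] L2_orbit_max[OF T2 f1L2]] by (meson add_right_mono order_trans)
  also have "L2_norm M (orbit_max T m (2 ^ Suc R)) \<le> 5 * (s * sqrt 2) * (L2_norm M f + L2_norm M v0)"
  proof -
    have "L2_norm M (orbit_max T m (2 ^ Suc R)) \<le> 5 * (s * sqrt 2) * L2_norm M m"
      using L2_norm_orbit_max_martingale[OF T mL2 m0, of "2 ^ Suc R"]
      by (simp add: s_def real_sqrt_mult mult.commute)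
    also have "\<dots> \<le> 5 * (s * sqrt 2) * (L2_norm M f + L2_norm M v0)"
      using nm s0 by (intro mult_left_mono) auto
    finally show ?thesis .
  qed
  also have "L2_norm M (orbit_max T2 f1 (2 ^ R)) \<le> s * (10 * L2_norm M v0 + 13 * \<Sigma>)"
  proof -
    have "L2_norm M (orbit_max T2 f1 (2 ^ R)) \<le> s * (5 * L2_norm M f1 + 13 * \<Sigma>)"
      unfolding s_def \<Sigma>_def by (rule Suc.IH[OF T2 f1L2 v1])
    also have "\<dots> \<le> s * (10 * L2_norm M v0 + 13 * \<Sigma>)"
      using nf1 s0 by (intro mult_left_mono) auto
    finally show ?thesis .
  qed
  also have "L2_norm M q = s * L2_norm M v0" unfolding nq s_def ..
  also have "5 * (s * sqrt 2) * (L2_norm M f + L2_norm M v0) + s * (10 * L2_norm M v0 + 13 * \<Sigma>) + s * L2_norm M v0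
     \<le> s * sqrt 2 * (5 * L2_norm M f + 13 * (L2_norm M v0 + \<Sigma> / sqrt 2))"
  proof -
    \<comment> \<open>The new scale costs \<open>5 \<surd>2 + 11\<close> times the norm of \<open>v0\<close>; the constant \<open>13\<close> of the claim absorbs it.\<close>
    have "11 / 8 \<le> sqrt 2" by (rule real_le_rsqrt) (simp add: power2_eq_square)
    then have "11 \<le> 8 * sqrt 2" by simp
    then have "11 * L2_norm M v0 \<le> 8 * sqrt 2 * L2_norm M v0" by (rule mult_right_mono) simp
    then have "s * (11 * L2_norm M v0) \<le> s * (8 * sqrt 2 * L2_norm M v0)" using s0 by (rule mult_left_mono)
    moreover have "s * sqrt 2 * (\<Sigma> / sqrt 2) = s * \<Sigma>" by simp
    ultimately show ?thesis by (simp add: algebra_simps)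
  qed
  also have "L2_norm M v0 + \<Sigma> / sqrt 2 = (\<Sum>r<Suc R. L2_norm M (v r) / sqrt (2 ^ r))"
  proof -
    have "\<Sigma> / sqrt 2 = (\<Sum>r<R. L2_norm M (v (Suc r)) / sqrt (2 ^ Suc r))"
      unfolding \<Sigma>_def sum_divide_distrib by (intro sum.cong) (auto simp: real_sqrt_mult)
    then show ?thesis by (subst sum.lessThan_Suc_shift) (simp add: v0_def)
  qed
  also have "s * sqrt 2 = sqrt (2 ^ Suc R)" by (simp add: s_def real_sqrt_mult)
  finally show ?case by simp
qed

lemma L2_norm_orbit_max_le_suminf:
  assumes T: "measure_preserving_map M T" and f: "f \<in> L2_space M"
    and v: "\<And>r. is_transfer M (T ^^ (2 ^ r)) (orbit_sum T f (2 ^ r)) (v r)"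
    and sum: "summable (\<lambda>r. L2_norm M (v r) / sqrt (2 ^ r))"
  shows "L2_norm M (orbit_max T f n)
    \<le> sqrt (real n) * (sqrt 2 * (5 * L2_norm M f + 13 * (\<Sum>r. L2_norm M (v r) / sqrt (2 ^ r))))"
proof (cases "n = 0")
  case True
  then show ?thesis by (simp add: L2_norm_def orbit_max.simps(1)[abs_def])
next
  case False
  then obtain R where R: "n \<le> 2 ^ R" "2 ^ R \<le> 2 * n"
  proof -
    have "\<exists>R. n \<le> 2 ^ R \<and> 2 ^ R \<le> 2 * n" using False
    proof (induction n)
      case (Suc n)
      show ?case
      proof (cases "n = 0")
        case True
        then show ?thesis by (intro exI[of _ 0]) auto
      next
        case False
        then obtain R where R: "n \<le> 2 ^ R" "2 ^ R \<le> 2 * n" using Suc by auto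
        define x :: nat where "x = 2 ^ R"
        have x: "n \<le> x" "x \<le> 2 * n" "1 \<le> x" using R by (simp_all add: x_def)
        have "Suc n \<le> x \<and> x \<le> 2 * Suc n \<or> Suc n \<le> 2 * x \<and> 2 * x \<le> 2 * Suc n"
          using x by arith
        then show ?thesis unfolding x_def power_Suc[symmetric] by blast
      qed
    qed simp
    then show ?thesis using that by blast
  qed
  have "L2_norm M (orbit_max T f n) \<le> L2_norm M (orbit_max T f (2 ^ R))"
    using orbit_max_mono[OF R(1), of T f] orbit_max_nonneg[of T f]
    by (intro L2_norm_mono L2_orbit_max[OF T f] L2_measurable[OF L2_orbit_max[OF T f]] AE_I2) auto
  also have "\<dots> \<le> sqrt (2 ^ R) * (5 * L2_norm M f + 13 * (\<Sum>r<R. L2_norm M (v r) / sqrt (2 ^ r)))"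
    by (rule L2_norm_orbit_max_dyadic[OF T f v])
  also have "\<dots> \<le> sqrt (2 * real n) * (5 * L2_norm M f + 13 * (\<Sum>r. L2_norm M (v r) / sqrt (2 ^ r)))"
  proof (intro mult_mono add_mono order_refl mult_left_mono)
    show "sqrt (2 ^ R) \<le> sqrt (2 * real n)"
      using R(2) by (metis of_nat_le_iff of_nat_mult of_nat_numeral of_nat_power real_sqrt_le_iff)
    show "(\<Sum>r<R. L2_norm M (v r) / sqrt (2 ^ r)) \<le> (\<Sum>r. L2_norm M (v r) / sqrt (2 ^ r))"
      by (rule sum_le_suminf[OF sum]) auto
  qed (auto intro!: add_nonneg_nonneg sum_nonneg)
  finally show ?thesis by (simp add: real_sqrt_mult mult.commute mult.left_commute)
qed

end

text \<open>
  With \<open>N = 4 K\<close>, subadditivity bounds \<open>b N\<close> by \<open>b k + b (N - k)\<close> for each of the \<open>K\<close> values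
  \<open>K \<le> k < 2 K\<close>, so \<open>b N\<close> is at most a multiple of the mean of \<open>b\<close> over \<open>{K..<4 K}\<close>. These windows
  overlap only twice as \<open>N\<close> runs through the powers of two.
\<close>

lemma summable_dyadic_of_subadditive:
  fixes b :: "nat \<Rightarrow> real"
  assumes b0: "\<And>n. 0 \<le> b n" and sub: "\<And>n m. b (n + m) \<le> b n + b m"
    and sum: "summable (\<lambda>n. real (Suc n) powr (- (3 / 2)) * b (Suc n))"
  shows "summable (\<lambda>r. b (2 ^ r) / sqrt (2 ^ r))"
proof -
  define c where "c = (\<lambda>k::nat. real k powr (- (3 / 2)) * b k)"
  have c0: "0 \<le> c k" for k using b0 by (simp add: c_def)
  define d where "d = (\<lambda>r::nat. \<Sum>k\<in>{2 ^ r..<2 ^ Suc r}. c k)"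
  have d0: "0 \<le> d r" for r using c0 by (auto simp: d_def intro: sum_nonneg)
  have dsum: "(\<Sum>r<R. d r) = (\<Sum>k\<in>{1..<2 ^ R}. c k)" for R
  proof (induction R)
    case (Suc R)
    have "(\<Sum>k\<in>{1..<2 ^ Suc R}. c k) = (\<Sum>k\<in>{1..<2 ^ R}. c k) + (\<Sum>k\<in>{2 ^ R..<2 ^ Suc R}. c k)"
      by (rule sum.atLeastLessThan_concat[symmetric]) auto
    then show ?case using Suc by (simp add: d_def)
  qed simp
  have cs: "summable (\<lambda>n. c (Suc n))" using sum by (simp add: c_def)
  have "summable d"
  proof (rule summableI_nonneg_bounded[OF d0])
    fix R
    have "(\<Sum>k\<in>{1..<2 ^ R}. c k) = (\<Sum>k\<in>{0..<2 ^ R - 1}. c (Suc k))"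
      by (rule sum.reindex_bij_witness[of _ Suc "\<lambda>k. k - 1"]) auto
    also have "\<dots> \<le> (\<Sum>n. c (Suc n))" by (rule sum_le_suminf[OF cs]) (auto simp: c0)
    finally show "(\<Sum>r<R. d r) \<le> (\<Sum>n. c (Suc n))" unfolding dsum .
  qed
  moreover from this have "summable (\<lambda>r. d (Suc r))" by (subst summable_Suc_iff)
  ultimately have "summable (\<lambda>r. 4 * (d r + d (Suc r)))" by (intro summable_mult summable_add)
  moreover have "norm (b (2 ^ (r + 2)) / sqrt (2 ^ (r + 2))) \<le> 4 * (d r + d (Suc r))" for r
  proof -
    define K :: nat where "K = 2 ^ r"
    have K: "0 < K" by (simp add: K_def)
    have N: "(2::nat) ^ (r + 2) = 4 * K" by (simp add: K_def)
    have dd: "d r + d (Suc r) = (\<Sum>k\<in>{K..<4 * K}. c k)"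
      unfolding d_def K_def by (subst sum.atLeastLessThan_concat) auto
    have "real K * b (4 * K) = (\<Sum>k\<in>{K..<2 * K}. b (4 * K))" by simp
    also have "\<dots> \<le> (\<Sum>k\<in>{K..<2 * K}. b k + b (4 * K - k))"
    proof (rule sum_mono)
      fix k assume "k \<in> {K..<2 * K}"
      then show "b (4 * K) \<le> b k + b (4 * K - k)" using sub[of k "4 * K - k"] by simp
    qed
    also have "\<dots> = (\<Sum>k\<in>{K..<2 * K}. b k) + (\<Sum>k\<in>{2 * K<..3 * K}. b k)"
      unfolding sum.distrib
      by (intro arg_cong2[where f = "(+)"] refl sum.reindex_bij_witness[of _ "\<lambda>k. 4 * K - k" "\<lambda>k. 4 * K - k"]) auto
    also have "\<dots> = (\<Sum>k\<in>{K..<2 * K} \<union> {2 * K<..3 * K}. b k)"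
      by (rule sum.union_disjoint[symmetric]) auto
    also have "\<dots> \<le> (\<Sum>k\<in>{K..<4 * K}. b k)"
      using K b0 by (intro sum_mono2) auto
    also have "\<dots> \<le> (\<Sum>k\<in>{K..<4 * K}. real (4 * K) powr (3 / 2) * c k)"
    proof (rule sum_mono)
      fix k assume k: "k \<in> {K..<4 * K}"
      have "1 \<le> real (4 * K) powr (3 / 2) * real k powr (- (3 / 2))"
      proof -
        have "real k powr (3 / 2) \<le> real (4 * K) powr (3 / 2)" using k by (intro powr_mono2) auto
        then show ?thesis using k K by (simp add: powr_minus field_simps)
      qed
      from mult_right_mono[OF this b0[of k]]
      show "b k \<le> real (4 * K) powr (3 / 2) * c k" by (simp add: c_def mult.assoc)
    qed
    also have "\<dots> = real (4 * K) powr (3 / 2) * (d r + d (Suc r))"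
      unfolding dd sum_distrib_left ..
    also have "real (4 * K) powr (3 / 2) = real (4 * K) * sqrt (real (4 * K))"
    proof -
      have "real (4 * K) powr (1 + 1 / 2) = real (4 * K) powr 1 * real (4 * K) powr (1 / 2)"
        by (rule powr_add)
      then show ?thesis using K by (simp add: powr_half_sqrt)
    qed
    finally have "real K * b (4 * K) \<le> real K * (sqrt (real (4 * K)) * (4 * (d r + d (Suc r))))"
      by (simp only: of_nat_mult of_nat_numeral ac_simps)
    then have "b (4 * K) \<le> sqrt (real (4 * K)) * (4 * (d r + d (Suc r)))"
      using K by (simp only: mult_le_cancel_left_pos of_nat_0_less_iff)
    moreover have "sqrt (2 ^ (r + 2)) = sqrt (real (4 * K))" unfolding N[symmetric] by simp
    moreover have "norm (b (4 * K) / sqrt (real (4 * K))) = b (4 * K) / sqrt (real (4 * K))"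
      using b0 by simp
    moreover have "0 < sqrt (real (4 * K))" using K by simp
    ultimately show ?thesis unfolding N by (simp only: pos_divide_le_eq mult.commute)
  qed
  ultimately have "summable (\<lambda>r. b (2 ^ (r + 2)) / sqrt (2 ^ (r + 2)))"
    by (rule summable_comparison_test')
  then show ?thesis by (subst (asm) summable_iff_shift[of "\<lambda>r. b (2 ^ r) / sqrt (2 ^ r)"])
qed

section \<open>Martingale approximation\<close>

context prob_space
begin

lemma L2_norm_const: "L2_norm M (\<lambda>_. c) = \<bar>c\<bar>"
  by (simp add: L2_norm_def prob_space)

text \<open>
  The sums of a coboundary telescope to differences of two values of \<open>g\<close>. Splitting \<open>g\<close> into a bounded
  part and a small remainder \<open>r\<close>, the maximum of \<open>|r|\<close> along the orbit is at most the square root of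
  the sum of squares, which is of the order of \<open>\<surd>n\<close> times the norm of \<open>r\<close>.
\<close>

lemma orbit_max_coboundary:
  assumes T: "measure_preserving_map M T" and g: "g \<in> L2_space M"
  shows "(\<lambda>n. L2_norm M (orbit_max T (\<lambda>y. g (T y) - g y) n) / sqrt (real n)) \<longlonglongrightarrow> 0"
proof (rule LIMSEQ_I)
  fix e :: real assume e: "0 < e"
  have cL2: "(\<lambda>y. g (T y) - g y) \<in> L2_space M" by (rule L2_diff[OF L2_measure_preserving[OF T g] g])
  have [measurable]: "g \<in> borel_measurable M" using g by (rule L2_measurable)
  obtain k where k: "L2_norm M (\<lambda>y. g y - g y * indicator {y. \<bar>g y\<bar> \<le> real k} y) < e / 8"
    using order_tendstoD(2)[OF L2_truncation[OF g], of "e / 8"] e by (auto simp: eventually_sequentially)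
  define r where "r = (\<lambda>y. g y - g y * indicator {y. \<bar>g y\<bar> \<le> real k} y)"
  have rL2: "r \<in> L2_space M"
    by (rule L2_dominated[OF g]) (auto simp: r_def indicator_def)
  have gr: "\<bar>g y\<bar> \<le> real k + \<bar>r y\<bar>" for y by (auto simp: r_def indicator_def)
  define q where "q = (\<lambda>n y. sqrt (\<Sum>i<Suc n. (r ((T ^^ i) y))\<^sup>2))"
  have qL2: "q n \<in> L2_space M" and nq: "L2_norm M (q n) = sqrt (real (Suc n)) * L2_norm M r" for n
    unfolding q_def
    using L2_sqrt_sum_squares[of "Suc n" "\<lambda>i y. r ((T ^^ i) y)" "L2_norm M r",
        OF L2_funpow[OF T rL2] L2_norm_funpow[OF T rL2]] by simp_all
  have rq: "\<bar>r ((T ^^ i) y)\<bar> \<le> q n y" if "i \<le> n" for i n y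
  proof -
    have "(r ((T ^^ i) y))\<^sup>2 \<le> (\<Sum>i<Suc n. (r ((T ^^ i) y))\<^sup>2)"
      using that by (intro member_le_sum) auto
    then show ?thesis unfolding q_def by (intro real_le_rsqrt) simp
  qed
  have le: "orbit_max T (\<lambda>y. g (T y) - g y) n y \<le> 2 * real k + 2 * q n y" for n y
  proof (rule orbit_max_le)
    fix i assume "i \<le> n"
    then show "\<bar>orbit_sum T (\<lambda>y. g (T y) - g y) i y\<bar> \<le> 2 * real k + 2 * q n y"
      unfolding orbit_sum_coboundary
      using gr[of "(T ^^ i) y"] gr[of y] rq[of i n y] rq[of 0 n y] by simp
  qed
  have bound: "L2_norm M (orbit_max T (\<lambda>y. g (T y) - g y) n) \<le> 2 * real k + 4 * sqrt (real n) * (e / 8)"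
    if n: "1 \<le> n" for n
  proof -
    have cst: "(\<lambda>_. 2 * real k) \<in> L2_space M" by (simp add: L2_space_def)
    have "L2_norm M (orbit_max T (\<lambda>y. g (T y) - g y) n) \<le> L2_norm M (\<lambda>y. 2 * real k + 2 * q n y)"
      by (intro L2_norm_mono AE_I2 abs_mono_nonneg orbit_max_nonneg le L2_add cst L2_cmult qL2
          L2_measurable[OF L2_orbit_max[OF T cL2]])
    also have "\<dots> \<le> 2 * real k + 2 * L2_norm M (q n)"
      using L2_norm_triangle[OF cst L2_cmult[OF qL2[of n], of 2]] L2_norm_cmult[of M 2 "q n"]
      by (simp add: L2_norm_const)
    also have "2 * L2_norm M (q n) \<le> 2 * ((2 * sqrt (real n)) * (e / 8))"
      unfolding nq using k n
    proof (intro mult_left_mono mult_mono)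
      have "sqrt (real (Suc n)) \<le> sqrt (4 * real n)" using n by (intro real_sqrt_le_mono) simp
      then show "sqrt (real (Suc n)) \<le> 2 * sqrt (real n)" by (simp add: real_sqrt_mult)
    qed (auto simp: r_def)
    finally show ?thesis by simp
  qed
  obtain N :: nat where N: "4 * real k / e < real N" using reals_Archimedean2 by blast
  have "L2_norm M (orbit_max T (\<lambda>y. g (T y) - g y) n) / sqrt (real n) < e" if n: "n \<ge> N\<^sup>2 + 1" for n
  proof -
    have "real N < sqrt (real n)"
    proof (rule real_less_rsqrt)
      show "(real N)\<^sup>2 < real n" using n by (metis Suc_eq_plus1 Suc_le_lessD of_nat_less_iff of_nat_power)
    qed
    then have s: "4 * real k < e * sqrt (real n)" "0 < sqrt (real n)"
      using N e n by (auto simp: field_simps intro: less_trans)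
    have "L2_norm M (orbit_max T (\<lambda>y. g (T y) - g y) n) < e * sqrt (real n)"
      using bound[of n] n s by simp
    then show ?thesis using s by (simp add: pos_divide_less_eq)
  qed
  then show "\<exists>N. \<forall>n\<ge>N. norm (L2_norm M (orbit_max T (\<lambda>y. g (T y) - g y) n) / sqrt (real n) - 0) < e"
    by (intro exI[of _ "N\<^sup>2 + 1"]) simp
qed

lemma L2_norm_orbit_max_triangle:
  assumes T: "measure_preserving_map M T" and f: "f \<in> L2_space M" and g: "g \<in> L2_space M"
  shows "L2_norm M (orbit_max T (\<lambda>y. f y + g y) n) \<le> L2_norm M (orbit_max T f n) + L2_norm M (orbit_max T g n)"
proof -
  have "L2_norm M (orbit_max T (\<lambda>y. f y + g y) n) \<le> L2_norm M (\<lambda>y. orbit_max T f n y + orbit_max T g n y)"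
    by (intro L2_norm_mono AE_I2 abs_mono_nonneg orbit_max_nonneg orbit_max_add_le L2_add L2_orbit_max T f g
        L2_measurable[OF L2_orbit_max[OF T L2_add[OF f g]]])
  also have "\<dots> \<le> L2_norm M (orbit_max T f n) + L2_norm M (orbit_max T g n)"
    by (intro L2_norm_triangle L2_orbit_max T f g)
  finally show ?thesis .
qed

lemma L2_norm_orbit_sum_le_orbit_max:
  assumes T: "measure_preserving_map M T" and f: "f \<in> L2_space M"
  shows "L2_norm M (orbit_sum T f n) \<le> L2_norm M (orbit_max T f n)"
  by (intro L2_norm_mono L2_orbit_max[OF T f] L2_measurable[OF L2_orbit_sum[OF T f]] AE_I2)
     (use abs_orbit_sum_le_orbit_max[of n n T f] orbit_max_nonneg[of T f] in auto)

text \<open>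
  Here \<open>p k = P\<^sup>k h\<close>. With \<open>N\<close> a power of two and \<open>G\<close> the average of the first \<open>N\<close> partial sums of \<open>p\<close>, telescoping gives
  \<open>h = G - P G + e\<close>, where \<open>e\<close> is the average of \<open>p 1, \<dots>, p N\<close>. Then \<open>m = G - P G \<circ> T\<close> is a reversed
  martingale difference and \<open>h - m - e\<close> is a coboundary. In the maximal inequality for \<open>e\<close>, each term
  of the dyadic series tends to zero as \<open>N\<close> grows and is dominated by the corresponding term for
  \<open>h\<close>, so the whole bound tends to zero.
\<close>

lemma martingale_approximation_step:
  assumes T: "measure_preserving_map M T" and pL2: "\<And>k. p k \<in> L2_space M"
    and p: "\<And>n k. is_transfer M (T ^^ n) (p k) (p (k + n))"
    and sum: "summable (\<lambda>n. real (Suc n) powr (- (3 / 2)) * L2_norm M (\<lambda>y. \<Sum>k<Suc n. p k y))"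
    and \<epsilon>: "0 < \<epsilon>"
  obtains m where "m \<in> L2_space M" "is_transfer M T m (\<lambda>_. 0)"
    "\<forall>\<^sub>F n in sequentially. L2_norm M (orbit_max T (\<lambda>y. p 0 y - m y) n) \<le> \<epsilon> * sqrt (real n)"
proof -
  define b where "b = (\<lambda>n. L2_norm M (\<lambda>y. \<Sum>k<n. p k y))"
  have b0: "0 \<le> b n" for n by (simp add: b_def)
  have pint: "integrable M (p k)" for k using L2_integrable[OF pL2] .
  have shift: "L2_norm M (\<lambda>y. \<Sum>k<n. p (k + a) y) \<le> b n" for n a
    unfolding b_def
    by (rule is_transfer_L2(2)[OF measure_preserving_funpow[OF T] L2_sum
          is_transfer_sum[OF measure_preserving_funpow[OF T]]]) (rule pL2 pint p)+
  have sub: "b (n + m) \<le> b n + b m" for n m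
  proof -
    have "(\<Sum>k<n + m. p k y) = (\<Sum>k<n. p k y) + (\<Sum>k<m. p (k + n) y)" for y
      by (induction m) (auto simp: add.commute add.left_commute)
    then have "b (n + m) \<le> b n + L2_norm M (\<lambda>y. \<Sum>k<m. p (k + n) y)"
      unfolding b_def using L2_norm_triangle[OF L2_sum L2_sum, of "{..<n}" p M "{..<m}" "\<lambda>k. p (k + n)"] pL2
      by simp
    then show ?thesis using shift[of n m] by linarith
  qed
  have bsum: "summable (\<lambda>r. b (2 ^ r) / sqrt (2 ^ r))"
    using summable_dyadic_of_subadditive[of b, OF b0 sub] sum unfolding b_def by blast
  define N :: "nat \<Rightarrow> nat" where "N = (\<lambda>s. 2 ^ s)"
  have N0: "0 < N s" for s by (simp add: N_def)
  define e where "e = (\<lambda>s y. 1 / real (N s) * (\<Sum>k<N s. p (k + 1) y))"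
  have eL2: "e s \<in> L2_space M" for s unfolding e_def by (intro L2_cmult L2_sum pL2)
  have ne: "L2_norm M (e s) \<le> b (N s) / real (N s)" for s
    unfolding e_def L2_norm_cmult using shift[of 1 "N s"] by (simp add: divide_right_mono)
  have e_lim: "(\<lambda>s. L2_norm M (e s)) \<longlonglongrightarrow> 0"
  proof (rule tendsto_sandwich[of "\<lambda>_. 0" _ _ "\<lambda>s. b (2 ^ s) / sqrt (2 ^ s)"])
    have "b (N s) / real (N s) \<le> b (2 ^ s) / sqrt (2 ^ s)" for s
    proof -
      have "sqrt (2 ^ s) \<le> (2 ^ s :: real)"
        by (rule real_le_lsqrt) (auto simp: self_le_power)
      then show ?thesis unfolding N_def using b0 by (intro divide_left_mono) auto
    qed
    then show "\<forall>\<^sub>F s in sequentially. L2_norm M (e s) \<le> b (2 ^ s) / sqrt (2 ^ s)"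
      using ne by (intro always_eventually) (meson order_trans)
    show "(\<lambda>s. b (2 ^ s) / sqrt (2 ^ s)) \<longlonglongrightarrow> 0" by (rule summable_LIMSEQ_zero[OF bsum])
  qed auto
  define w where "w = (\<lambda>s r y. \<Sum>i\<in>{1..2 ^ r}. 1 / real (N s) * (\<Sum>k<N s. p (k + 1 + i) y))"
  have w: "is_transfer M (T ^^ (2 ^ r)) (orbit_sum T (e s) (2 ^ r)) (w s r)" for s r
    unfolding w_def
    by (rule is_transfer_orbit_sum[OF T L2_integrable[OF eL2]], unfold e_def)
       (intro is_transfer_cmult is_transfer_sum measure_preserving_funpow T pint p)
  \<comment> \<open>\<open>w1\<close> makes each term of the dyadic series small, \<open>w2\<close> dominates the series.\<close>
  have w1: "L2_norm M (w s r) \<le> 2 ^ r * L2_norm M (e s)" for s r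
    using is_transfer_L2(2)[OF measure_preserving_funpow[OF T] L2_orbit_sum[OF T eL2] w, of s r]
      L2_norm_orbit_sum_le[OF T eL2, of s "2 ^ r"] by simp
  have w2: "L2_norm M (w s r) \<le> b (2 ^ r)" for s r
  proof -
    have "w s r = (\<lambda>y. 1 / real (N s) * (\<Sum>k<N s. \<Sum>i<2 ^ r. p (i + (k + 2)) y))"
    proof
      fix y
      have "w s r y = (\<Sum>i<2 ^ r. 1 / real (N s) * (\<Sum>k<N s. p (i + (k + 2)) y))"
        unfolding w_def
        by (rule sum.reindex_bij_witness[of _ Suc "\<lambda>i. i - 1"]) (auto simp: algebra_simps)
      then show "w s r y = 1 / real (N s) * (\<Sum>k<N s. \<Sum>i<2 ^ r. p (i + (k + 2)) y)"
        unfolding sum_distrib_left by (subst sum.swap) simp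
    qed
    then have "L2_norm M (w s r) = 1 / real (N s) * L2_norm M (\<lambda>y. \<Sum>k<N s. \<Sum>i<2 ^ r. p (i + (k + 2)) y)"
      by (simp only: L2_norm_cmult) simp
    also have "\<dots> \<le> 1 / real (N s) * (\<Sum>k<N s. L2_norm M (\<lambda>y. \<Sum>i<2 ^ r. p (i + (k + 2)) y))"
      by (intro mult_left_mono L2_norm_sum L2_sum pL2) auto
    also have "\<dots> \<le> 1 / real (N s) * (\<Sum>k<N s. b (2 ^ r))"
      by (intro mult_left_mono sum_mono shift) auto
    also have "\<dots> = b (2 ^ r)" using N0[of s] by simp
    finally show ?thesis .
  qed
  have wsum: "summable (\<lambda>r. L2_norm M (w s r) / sqrt (2 ^ r))" for s
    by (rule summable_comparison_test'[OF bsum, of 0]) (use w2 in \<open>auto intro!: divide_right_mono\<close>)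
  have "(\<lambda>s. \<Sum>r. L2_norm M (w s r) / sqrt (2 ^ r)) \<longlonglongrightarrow> (\<Sum>r. 0)"
  proof (rule tannerys_theorem[THEN conjunct2, THEN conjunct2])
    show "((\<lambda>s. L2_norm M (w s r) / sqrt (2 ^ r)) \<longlonglongrightarrow> 0)" for r
    proof (rule tendsto_sandwich[of "\<lambda>_. 0" _ _ "\<lambda>s. 2 ^ r * L2_norm M (e s) / sqrt (2 ^ r)"])
      show "(\<lambda>s. 2 ^ r * L2_norm M (e s) / sqrt (2 ^ r)) \<longlonglongrightarrow> 0"
        using tendsto_mult_right_zero[OF e_lim, of "2 ^ r / sqrt (2 ^ r)"] by simp
    qed (use w1 in \<open>auto intro!: divide_right_mono always_eventually\<close>)
    show "\<forall>\<^sub>F (r, s) in sequentially \<times>\<^sub>F sequentially. norm (L2_norm M (w s r) / sqrt (2 ^ r)) \<le> b (2 ^ r) / sqrt (2 ^ r)"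
      using w2 by (intro always_eventually) (auto intro!: divide_right_mono)
    show "summable (\<lambda>r. b (2 ^ r) / sqrt (2 ^ r))" by (rule bsum)
  qed auto
  then have "(\<lambda>s. sqrt 2 * (5 * L2_norm M (e s) + 13 * (\<Sum>r. L2_norm M (w s r) / sqrt (2 ^ r))))
      \<longlonglongrightarrow> sqrt 2 * (5 * 0 + 13 * 0)"
    using e_lim by (intro tendsto_intros) auto
  from order_tendstoD(2)[OF this, of "\<epsilon> / 2"] \<epsilon>
  obtain s where s: "sqrt 2 * (5 * L2_norm M (e s) + 13 * (\<Sum>r. L2_norm M (w s r) / sqrt (2 ^ r))) < \<epsilon> / 2"
    by (auto simp: eventually_sequentially)
  have emax: "L2_norm M (orbit_max T (e s) n) \<le> sqrt (real n) * (\<epsilon> / 2)" for n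
    using L2_norm_orbit_max_le_suminf[OF T eL2 w wsum, of s n] s
    by (meson less_imp_le mult_left_mono order_trans real_sqrt_ge_zero of_nat_0_le_iff)
  define G where "G = (\<lambda>y. 1 / real (N s) * (\<Sum>k<N s. \<Sum>i<Suc k. p i y))"
  define G' where "G' = (\<lambda>y. 1 / real (N s) * (\<Sum>k<N s. \<Sum>i<Suc k. p (i + 1) y))"
  have GL2: "G \<in> L2_space M" "G' \<in> L2_space M" unfolding G_def G'_def by (intro L2_cmult L2_sum pL2)+
  have "is_transfer M (T ^^ 1) G G'" unfolding G_def G'_def
    by (intro is_transfer_cmult is_transfer_sum measure_preserving_funpow T
        Bochner_Integration.integrable_sum pint p)
  then have tG: "is_transfer M T G G'" by simp
  define m where "m = (\<lambda>y. G y - G' (T y))"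
  have mL2: "m \<in> L2_space M" unfolding m_def by (intro L2_diff GL2 L2_measure_preserving[OF T])
  have m0: "is_transfer M T m (\<lambda>_. 0)" unfolding m_def by (rule martingale_part[OF T L2_integrable[OF GL2(1)] tG])
  have tele: "p 0 y - e s y = G y - G' y" for y
  proof -
    have "(\<Sum>i<Suc k. p i y) - (\<Sum>i<Suc k. p (i + 1) y) = p 0 y - p (k + 1) y" for k
      by (induction k) auto
    then have "G y - G' y = 1 / real (N s) * (\<Sum>k<N s. p 0 y - p (k + 1) y)"
      unfolding G_def G'_def by (simp only: right_diff_distrib[symmetric] sum_subtractf[symmetric])
    also have "\<dots> = p 0 y - e s y" unfolding e_def sum_subtractf using N0[of s] by (simp add: field_simps)
    finally show ?thesis by simp
  qed
  define c where "c = (\<lambda>y. G' (T y) - G' y)"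
  have cL2: "c \<in> L2_space M" unfolding c_def by (intro L2_diff GL2 L2_measure_preserving[OF T])
  have split: "(\<lambda>y. p 0 y - m y) = (\<lambda>y. e s y + c y)"
    using tele by (auto simp: m_def c_def fun_eq_iff algebra_simps)
  have "\<forall>\<^sub>F n in sequentially. L2_norm M (orbit_max T c n) / sqrt (real n) < \<epsilon> / 2"
    using order_tendstoD(2)[OF orbit_max_coboundary[OF T GL2(2)], of "\<epsilon> / 2"] \<epsilon> unfolding c_def by simp
  then have "\<forall>\<^sub>F n in sequentially. L2_norm M (orbit_max T (\<lambda>y. p 0 y - m y) n) \<le> \<epsilon> * sqrt (real n)"
    using eventually_gt_at_top[of 0]
  proof eventually_elim
    case (elim n)
    then have "L2_norm M (orbit_max T c n) \<le> \<epsilon> / 2 * sqrt (real n)" by (simp add: pos_divide_less_eq)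
    then show ?case
      unfolding split using L2_norm_orbit_max_triangle[OF T eL2[of s] cL2, of n] emax[of n]
      by (simp add: algebra_simps)
  qed
  with mL2 m0 show ?thesis by (rule that)
qed

text \<open>
  By orthogonality the distance of two approximating martingale differences is the norm of the
  difference of their orbit sums divided by \<open>\<surd>n\<close>, for any positive \<open>n\<close>. Letting \<open>n\<close> grow shows that they form
  a Cauchy sequence.
\<close>

lemma martingale_approximation:
  assumes T: "measure_preserving_map M T" and h: "h \<in> L2_space M"
    and approx: "\<And>\<epsilon>. 0 < \<epsilon> \<Longrightarrow> \<exists>m. m \<in> L2_space M \<and> is_transfer M T m (\<lambda>_. 0) \<and>
      (\<forall>\<^sub>F n in sequentially. L2_norm M (orbit_max T (\<lambda>y. h y - m y) n) \<le> \<epsilon> * sqrt (real n))"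
  obtains h' where "h' \<in> L2_space M" "is_transfer M T h' (\<lambda>_. 0)"
    "(\<lambda>n. L2_norm M (orbit_max T (\<lambda>y. h y - h' y) n) / sqrt (real n)) \<longlonglongrightarrow> 0"
proof -
  have "\<forall>s::nat. \<exists>m. m \<in> L2_space M \<and> is_transfer M T m (\<lambda>_. 0) \<and>
      (\<forall>\<^sub>F n in sequentially. L2_norm M (orbit_max T (\<lambda>y. h y - m y) n) \<le> inverse (real (Suc s)) * sqrt (real n))"
    by (intro allI approx) simp
  then obtain m where mL2: "\<And>s. m s \<in> L2_space M" and m0: "\<And>s. is_transfer M T (m s) (\<lambda>_. 0)"
    and ev: "\<And>s. \<forall>\<^sub>F n in sequentially.
      L2_norm M (orbit_max T (\<lambda>y. h y - m s y) n) \<le> inverse (real (Suc s)) * sqrt (real n)"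
    by metis
  have hm: "(\<lambda>y. h y - m s y) \<in> L2_space M" for s by (rule L2_diff[OF h mL2])
  have mm: "(\<lambda>y. m s y - m t y) \<in> L2_space M" for s t by (rule L2_diff[OF mL2 mL2])
  have dist: "L2_norm M (\<lambda>y. m s y - m t y) \<le> inverse (real (Suc s)) + inverse (real (Suc t))" for s t
  proof -
    have "\<forall>\<^sub>F n in sequentially. 0 < n \<and>
      L2_norm M (orbit_max T (\<lambda>y. h y - m s y) n) \<le> inverse (real (Suc s)) * sqrt (real n) \<and>
      L2_norm M (orbit_max T (\<lambda>y. h y - m t y) n) \<le> inverse (real (Suc t)) * sqrt (real n)"
      by (intro eventually_conj ev eventually_gt_at_top)
    then obtain n where n: "0 < n"
      "L2_norm M (orbit_max T (\<lambda>y. h y - m s y) n) \<le> inverse (real (Suc s)) * sqrt (real n)"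
      "L2_norm M (orbit_max T (\<lambda>y. h y - m t y) n) \<le> inverse (real (Suc t)) * sqrt (real n)"
      by (auto simp: eventually_sequentially)
    have d0: "is_transfer M T (\<lambda>y. m s y - m t y) (\<lambda>_. 0)"
      using is_transfer_diff[OF T L2_integrable[OF mL2] L2_integrable[OF mL2] m0 m0, of s t] by simp
    have "sqrt (real n) * L2_norm M (\<lambda>y. m s y - m t y) = L2_norm M (orbit_sum T (\<lambda>y. m s y - m t y) n)"
      by (rule L2_norm_martingale_sum[OF T mm d0, symmetric])
    also have "\<dots> = L2_norm M (\<lambda>y. orbit_sum T (\<lambda>y. h y - m t y) n y - orbit_sum T (\<lambda>y. h y - m s y) n y)"
      by (intro arg_cong[where f = "L2_norm M"]) (auto simp: orbit_sum_diff)
    also have "\<dots> \<le> L2_norm M (orbit_sum T (\<lambda>y. h y - m t y) n) + L2_norm M (orbit_sum T (\<lambda>y. h y - m s y) n)"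
      by (intro L2_norm_triangle_diff L2_orbit_sum T hm)
    also have "\<dots> \<le> inverse (real (Suc t)) * sqrt (real n) + inverse (real (Suc s)) * sqrt (real n)"
      using L2_norm_orbit_sum_le_orbit_max[OF T hm, of s n] L2_norm_orbit_sum_le_orbit_max[OF T hm, of t n] n
      by linarith
    finally have "sqrt (real n) * L2_norm M (\<lambda>y. m s y - m t y)
        \<le> sqrt (real n) * (inverse (real (Suc s)) + inverse (real (Suc t)))"
      by (simp only: algebra_simps)
    then show ?thesis using n(1) by (simp only: mult_le_cancel_left_pos real_sqrt_gt_0_iff of_nat_0_less_iff)
  qed
  have "\<exists>K. \<forall>i\<ge>K. \<forall>j\<ge>K. L2_norm M (\<lambda>y. m i y - m j y) < \<epsilon>" if \<epsilon>: "0 < \<epsilon>" for \<epsilon>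
  proof -
    obtain K where K: "inverse (real (Suc K)) < \<epsilon> / 2" using reals_Archimedean[of "\<epsilon> / 2"] \<epsilon> by auto
    have "inverse (real (Suc i)) < \<epsilon> / 2" if "i \<ge> K" for i
      using K that by (smt (verit) inverse_le_iff_le of_nat_0_less_iff of_nat_le_iff Suc_le_mono zero_less_Suc)
    then show ?thesis using dist by (intro exI[of _ K]) (smt (verit) field_sum_of_halves)
  qed
  from L2_complete[OF mL2 this] obtain h' where h': "h' \<in> L2_space M"
    and lim: "(\<lambda>s. L2_norm M (\<lambda>y. m s y - h' y)) \<longlonglongrightarrow> 0" by blast
  have mh: "(\<lambda>y. m s y - h' y) \<in> L2_space M" for s by (rule L2_diff[OF mL2 h'])
  have h'0: "is_transfer M T h' (\<lambda>_. 0)"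
  proof (rule is_transferI)
    fix g :: "'a \<Rightarrow> real" and C assume g: "g \<in> borel_measurable M" "AE y in M. \<bar>g y\<bar> \<le> C"
    have gT: "(\<lambda>y. g (T y)) \<in> L2_space M" by (rule L2_measure_preserving[OF T L2_bounded[OF g]])
    have "\<bar>\<integral>y. h' y * g (T y) \<partial>M\<bar> \<le> L2_norm M (\<lambda>y. m s y - h' y) * L2_norm M (\<lambda>y. g (T y))" for s
    proof -
      have "(\<integral>y. (m s y - h' y) * g (T y) \<partial>M) = (\<integral>y. m s y * g (T y) \<partial>M) - (\<integral>y. h' y * g (T y) \<partial>M)"
        using L2_mult_integrable[OF mL2[of s] gT] L2_mult_integrable[OF h' gT] by (simp add: left_diff_distrib)
      then show ?thesis using Cauchy_Schwarz_L2[OF mh gT, of s] is_transferD[OF m0[of s] g] by simp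
    qed
    moreover have "(\<lambda>s. L2_norm M (\<lambda>y. m s y - h' y) * L2_norm M (\<lambda>y. g (T y))) \<longlonglongrightarrow> 0"
      by (rule tendsto_mult_left_zero[OF lim])
    ultimately have "\<bar>\<integral>y. h' y * g (T y) \<partial>M\<bar> \<le> 0" by (intro LIMSEQ_le_const) auto
    then show "(\<integral>y. 0 * g y \<partial>M) = (\<integral>y. h' y * g (T y) \<partial>M)" by simp
  qed simp
  have "(\<lambda>n. L2_norm M (orbit_max T (\<lambda>y. h y - h' y) n) / sqrt (real n)) \<longlonglongrightarrow> 0"
  proof (rule LIMSEQ_I)
    fix \<epsilon> :: real assume \<epsilon>: "0 < \<epsilon>"
    have "(\<lambda>s. inverse (real (Suc s)) + 5 * L2_norm M (\<lambda>y. m s y - h' y)) \<longlonglongrightarrow> 0 + 5 * 0"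
      by (intro tendsto_intros LIMSEQ_inverse_real_of_nat lim)
    from order_tendstoD(2)[OF this, of \<epsilon>] \<epsilon>
    obtain s where s: "inverse (real (Suc s)) + 5 * L2_norm M (\<lambda>y. m s y - h' y) < \<epsilon>"
      by (auto simp: eventually_sequentially)
    have d0: "is_transfer M T (\<lambda>y. m s y - h' y) (\<lambda>_. 0)"
      using is_transfer_diff[OF T L2_integrable[OF mL2] L2_integrable[OF h'] m0 h'0, of s] by simp
    have "\<forall>\<^sub>F n in sequentially. norm (L2_norm M (orbit_max T (\<lambda>y. h y - h' y) n) / sqrt (real n) - 0) < \<epsilon>"
      using ev[of s] eventually_gt_at_top[of 0]
    proof eventually_elim
      case (elim n)
      have "(\<lambda>y. h y - h' y) = (\<lambda>y. (h y - m s y) + (m s y - h' y))" by simp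
      then have "L2_norm M (orbit_max T (\<lambda>y. h y - h' y) n)
         \<le> inverse (real (Suc s)) * sqrt (real n) + 5 * sqrt (real n) * L2_norm M (\<lambda>y. m s y - h' y)"
        using L2_norm_orbit_max_triangle[OF T hm mh, of s s n] L2_norm_orbit_max_martingale[OF T mh d0, of n] elim
        by simp
      also have "\<dots> = (inverse (real (Suc s)) + 5 * L2_norm M (\<lambda>y. m s y - h' y)) * sqrt (real n)"
        by (simp add: algebra_simps)
      also have "\<dots> < \<epsilon> * sqrt (real n)" using s elim by (intro mult_strict_right_mono) auto
      finally show ?case using elim by (simp add: pos_divide_less_eq)
    qed
    then show "\<exists>N. \<forall>n\<ge>N. norm (L2_norm M (orbit_max T (\<lambda>y. h y - h' y) n) / sqrt (real n) - 0) < \<epsilon>"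
      by (simp only: eventually_sequentially)
  qed
  with h' h'0 show ?thesis by (rule that)
qed

lemma iterated_transfer:
  assumes T: "measure_preserving_map M T" and h: "h \<in> L2_space M"
  shows "(transfer_operator M T ^^ k) h \<in> L2_space M"
    "is_transfer M (T ^^ n) ((transfer_operator M T ^^ k) h) ((transfer_operator M T ^^ (k + n)) h)"
proof -
  let ?P = "transfer_operator M T"
  have L2: "(?P ^^ k) h \<in> L2_space M \<and> is_transfer M T ((?P ^^ k) h) ((?P ^^ Suc k) h)" for k
  proof (induction k)
    case 0
    then show ?case using is_transfer_transfer_operator[OF prob_space_axioms T L2_integrable[OF h]] h by simp
  next
    case (Suc k)
    then have "(?P ^^ Suc k) h \<in> L2_space M" using is_transfer_L2(1)[OF T] by blast
    then show ?case
      using is_transfer_transfer_operator[OF prob_space_axioms T L2_integrable] by simp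
  qed
  then show "(?P ^^ k) h \<in> L2_space M" by blast
  show "is_transfer M (T ^^ n) ((?P ^^ k) h) ((?P ^^ (k + n)) h)"
  proof (induction n)
    case 0
    show ?case using is_transfer_id[OF L2_integrable, of "(?P ^^ k) h"] L2[of k] by (simp add: id_def)
  next
    case (Suc n)
    from is_transfer_comp[OF T this, of "(?P ^^ (k + Suc n)) h"] L2[of "k + n"]
    show ?case by (simp add: comp_def)
  qed
qed

end

section \<open>The ergodic theorem\<close>

lemma space_invariant_algebra: "space (invariant_algebra M T) = space M"
  by (simp add: invariant_algebra_def space_measure_of_conv)

lemma subalgebra_invariant:
  "T \<in> measurable M M \<Longrightarrow> subalgebra M (invariant_algebra M T)"
  unfolding subalgebra_def by (auto simp: sets_invariant_algebra space_invariant_algebra)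

lemma invariant_algebra_measurable_invariant:
  fixes f :: "'a \<Rightarrow> real"
  assumes T: "T \<in> measurable M M" and f: "f \<in> borel_measurable (invariant_algebra M T)" and y: "y \<in> space M"
  shows "f (T y) = f y"
proof -
  have "f -` {f y} \<inter> space M \<in> sets (invariant_algebra M T)"
    using measurable_sets[OF f, of "{f y}"] by (simp add: space_invariant_algebra)
  then have "T -` (f -` {f y} \<inter> space M) \<inter> space M = f -` {f y} \<inter> space M"
    by (simp add: sets_invariant_algebra[OF T])
  with y show ?thesis by blast
qed

text \<open>
  The maximum of the orbit sums over at most \<open>n\<close> steps, including the empty sum, in the recursive form
  used by Garsia.
\<close>

primrec positive_max :: "('a \<Rightarrow> 'a) \<Rightarrow> ('a \<Rightarrow> real) \<Rightarrow> nat \<Rightarrow> 'a \<Rightarrow> real" where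
  "positive_max T f 0 y = 0"
| "positive_max T f (Suc n) y = max 0 (f y + positive_max T f n (T y))"

lemma positive_max_nonneg: "0 \<le> positive_max T f n y"
  by (cases n) auto

lemma positive_max_mono: "positive_max T f n y \<le> positive_max T f (Suc n) y"
proof (induction n arbitrary: y)
  case (Suc n)
  from Suc[of "T y"] show ?case by simp
qed simp

lemma orbit_sum_le_positive_max: "k \<le> n \<Longrightarrow> orbit_sum T f k y \<le> positive_max T f n y"
proof (induction n arbitrary: k y)
  case (Suc n)
  show ?case
  proof (cases k)
    case 0
    then show ?thesis by simp
  next
    case (Suc i)
    then have "orbit_sum T f i (T y) \<le> positive_max T f n (T y)" using Suc.prems by (intro Suc.IH) simp
    then show ?thesis unfolding Suc orbit_sum_Suc_shift by simp
  qed
qed simp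

context prob_space
begin

lemma sigma_finite_subalgebra_invariant:
  assumes "T \<in> measurable M M" shows "sigma_finite_subalgebra M (invariant_algebra M T)"
  using finite_measure_subalgebra_is_sigma_finite[of M "invariant_algebra M T"] subalgebra_invariant[OF assms]
  by (simp add: finite_measure_subalgebra_def finite_measure_subalgebra_axioms_def finite_measure_axioms)

lemma integrable_positive_max:
  assumes T: "measure_preserving_map M T" and f: "integrable M f"
  shows "integrable M (positive_max T f n)"
proof (induction n)
  case (Suc n)
  have "integrable M (\<lambda>y. max 0 (f y + positive_max T f n (T y)))"
    using f integrable_measure_preserving[OF T Suc] by (intro integrable_max) auto
  then show ?case by (subst positive_max.simps(2)[abs_def])
qed simp

text \<open>
  Garsia's proof: where the maximum \<open>F\<close> is positive, \<open>F - F \<circ> T \<le> f\<close>; elsewhere \<open>F - F \<circ> T \<le> 0\<close>; and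
  \<open>F - F \<circ> T\<close> has integral zero.
\<close>

lemma maximal_ergodic:
  assumes T: "measure_preserving_map M T" and f: "integrable M f"
  shows "0 \<le> (\<integral>y. f y * indicator {y. 0 < positive_max T f n y} y \<partial>M)"
proof (cases n)
  case (Suc k)
  note int = integrable_positive_max[OF T f]
  have [measurable]: "positive_max T f n \<in> borel_measurable M" using int by auto
  have pm: "{y \<in> space M. 0 < positive_max T f n y} \<in> sets M" by measurable
  have "(\<integral>y. positive_max T f n y - positive_max T f n (T y) \<partial>M)
      \<le> (\<integral>y. f y * indicator {y. 0 < positive_max T f n y} y \<partial>M)"
  proof (rule integral_mono)
    show "integrable M (\<lambda>y. positive_max T f n y - positive_max T f n (T y))"
      using int integrable_measure_preserving[OF T int] by auto
    have "integrable M (\<lambda>y. f y * indicator {y \<in> space M. 0 < positive_max T f n y} y)"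
      using pm f by (rule integrable_real_mult_indicator)
    then show "integrable M (\<lambda>y. f y * indicator {y. 0 < positive_max T f n y} y)"
      by (subst Bochner_Integration.integrable_cong[OF refl,
            where g = "\<lambda>y. f y * indicator {y \<in> space M. 0 < positive_max T f n y} y"])
         (auto simp: indicator_def)
    fix y
    have "positive_max T f k (T y) \<le> positive_max T f n (T y)" unfolding Suc by (rule positive_max_mono)
    then show "positive_max T f n y - positive_max T f n (T y) \<le> f y * indicator {y. 0 < positive_max T f n y} y"
      using positive_max_nonneg[of T f n "T y"] by (auto simp: Suc indicator_def max_def)
  qed
  moreover have "(\<integral>y. positive_max T f n y - positive_max T f n (T y) \<partial>M) = 0"
    using int integrable_measure_preserving[OF T int] integral_measure_preserving[OF T, of "positive_max T f n"]
    by simp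
  ultimately show ?thesis by simp
qed simp

text \<open>
  The set where the averages infinitely often exceed the conditional expectation by more than \<open>\<epsilon>\<close> is
  invariant; applying the maximal ergodic lemma on it to \<open>g - E(g | I) - \<epsilon>\<close> shows that it is null.
  The margin \<open>1 / (k + 1)\<close> in the definition of the set absorbs the boundary term by which the sums
  along \<open>y\<close> and \<open>T y\<close> differ, so that the set is invariant without exceptional points.
\<close>

lemma ergodic_upper_bound:
  assumes T: "measure_preserving_map M T" and g: "integrable M g" and \<epsilon>: "0 < \<epsilon>"
  defines "e \<equiv> real_cond_exp M (invariant_algebra M T) g"
  shows "AE y in M. \<forall>k::nat. \<exists>N. \<forall>n\<ge>N. orbit_sum T g n y < real n * (e y + \<epsilon> + 1 / real (Suc k))"
proof -
  note Tm [measurable] = measurable_measure_preserving[OF T]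
  interpret I: sigma_finite_subalgebra M "invariant_algebra M T"
    by (rule sigma_finite_subalgebra_invariant[OF Tm])
  have [measurable]: "g \<in> borel_measurable M" using g by auto
  have [measurable]: "orbit_sum T g n \<in> borel_measurable M" for n
    using measurable_orbit_sum[OF T, of g n] by simp
  have eI: "e \<in> borel_measurable (invariant_algebra M T)" unfolding e_def by simp
  have [measurable]: "e \<in> borel_measurable M" unfolding e_def by simp
  have eint: "integrable M e" unfolding e_def using I.real_cond_exp_int(1)[OF g] .
  have einv: "e (T y) = e y" if "y \<in> space M" for y
    by (rule invariant_algebra_measurable_invariant[OF Tm eI that])
  define Q where "Q = (\<lambda>y. \<exists>k::nat. \<forall>N. \<exists>n\<ge>N. real n * (e y + \<epsilon> + 1 / real (Suc k)) \<le> orbit_sum T g n y)"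
  define A where "A = {y \<in> space M. Q y}"
  have AM [measurable]: "A \<in> sets M" unfolding A_def Q_def by measurable
  have QT: "Q (T y) \<longleftrightarrow> Q y" if y: "y \<in> space M" for y
  proof
    assume "Q (T y)"
    then obtain k :: nat where k: "\<And>N. \<exists>n\<ge>N. real n * (e y + \<epsilon> + 1 / real (Suc k)) \<le> orbit_sum T g n (T y)"
      unfolding Q_def einv[OF y] by blast
    have "\<exists>n\<ge>N. real n * (e y + \<epsilon> + 1 / real (Suc (2 * k + 1))) \<le> orbit_sum T g n y" for N
    proof -
      define d where "d = 1 / real (Suc (2 * k + 1))"
      have d: "0 < d" "1 / real (Suc k) = 2 * d" by (auto simp: d_def field_simps)
      obtain L :: nat where L: "(\<bar>g y\<bar> + \<bar>e y + \<epsilon>\<bar>) / d + 1 \<le> real L" using real_arch_simple by blast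
      obtain n where n: "n \<ge> max N L" "real n * (e y + \<epsilon> + 2 * d) \<le> orbit_sum T g n (T y)"
        using k[of "max N L"] unfolding d by blast
      have "(\<bar>g y\<bar> + \<bar>e y + \<epsilon>\<bar>) / d \<le> real n - 1" using L n(1) by linarith
      then have "\<bar>g y\<bar> + \<bar>e y + \<epsilon>\<bar> \<le> (real n - 1) * d" using d by (simp add: pos_divide_le_eq)
      then have "real (Suc n) * (e y + \<epsilon> + d) \<le> orbit_sum T g (Suc n) y"
        using n(2) unfolding orbit_sum_Suc_shift by (simp add: algebra_simps)
      then show ?thesis unfolding d_def using n(1) by (intro exI[of _ "Suc n"]) auto
    qed
    then show "Q y" unfolding Q_def by blast
  next
    assume "Q y"
    then obtain k :: nat where k: "\<And>N. \<exists>n\<ge>N. real n * (e y + \<epsilon> + 1 / real (Suc k)) \<le> orbit_sum T g n y"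
      unfolding Q_def by blast
    have "\<exists>n\<ge>N. real n * (e y + \<epsilon> + 1 / real (Suc (2 * k + 1))) \<le> orbit_sum T g n (T y)" for N
    proof -
      define d where "d = 1 / real (Suc (2 * k + 1))"
      have d: "0 < d" "1 / real (Suc k) = 2 * d" by (auto simp: d_def field_simps)
      obtain L :: nat where L: "(\<bar>g y\<bar> + \<bar>e y + \<epsilon>\<bar>) / d + 1 \<le> real L" using real_arch_simple by blast
      obtain n where n: "n \<ge> Suc (max N L)" "real n * (e y + \<epsilon> + 2 * d) \<le> orbit_sum T g n y"
        using k[of "Suc (max N L)"] unfolding d by blast
      then obtain i where i: "n = Suc i" "i \<ge> N" "i \<ge> L" by (cases n) auto
      have "(\<bar>g y\<bar> + \<bar>e y + \<epsilon>\<bar>) / d \<le> real i" using L i by linarith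
      then have "\<bar>g y\<bar> + \<bar>e y + \<epsilon>\<bar> \<le> real i * d" using d by (simp add: pos_divide_le_eq)
      then have "real i * (e y + \<epsilon> + d) \<le> orbit_sum T g i (T y)"
        using n(2) d(1) unfolding i orbit_sum_Suc_shift by (simp add: algebra_simps)
      then show ?thesis unfolding d_def using i by (intro exI[of _ i]) auto
    qed
    then show "Q (T y)" unfolding Q_def einv[OF y] by blast
  qed
  have Tsp: "T y \<in> space M" if "y \<in> space M" for y using measurable_space[OF Tm that] .
  have AI: "A \<in> sets (invariant_algebra M T)"
    unfolding sets_invariant_algebra[OF Tm] using AM QT Tsp by (auto simp: A_def)
  define f where "f = (\<lambda>y. (g y - e y - \<epsilon>) * indicator A y)"
  have fint: "integrable M f"
    unfolding f_def by (intro integrable_real_mult_indicator AM Bochner_Integration.integrable_diff g eint) simp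
  have orbit: "(T ^^ j) y \<in> space M \<and> e ((T ^^ j) y) = e y \<and> Q ((T ^^ j) y) = Q y" if "y \<in> space M" for j y
    using that by (induction j) (auto simp: einv QT Tsp)
  have fA: "orbit_sum T f n y = (orbit_sum T g n y - real n * (e y + \<epsilon>)) * indicator A y" if "y \<in> space M" for n y
  proof -
    have "orbit_sum T f n y = (\<Sum>j<n. (g ((T ^^ j) y) - (e y + \<epsilon>)) * indicator A y)"
      unfolding orbit_sum_def f_def using orbit[OF that]
      by (intro sum.cong) (auto simp: A_def indicator_def that)
    then show ?thesis by (simp add: orbit_sum_def sum_distrib_right[symmetric] sum_subtractf)
  qed
  have lim: "(\<lambda>n. f y * indicator {y. 0 < positive_max T f n y} y) \<longlonglongrightarrow> f y" if y: "y \<in> space M" for y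
  proof (cases "y \<in> A")
    case True
    then obtain k :: nat where "\<exists>n\<ge>Suc 0. real n * (e y + \<epsilon> + 1 / real (Suc k)) \<le> orbit_sum T g n y"
      unfolding A_def Q_def by blast
    then obtain n where n: "1 \<le> n" "real n * (e y + \<epsilon> + 1 / real (Suc k)) \<le> orbit_sum T g n y" by auto
    have "0 < real n * (1 / real (Suc k))" using n(1) by simp
    then have "0 < orbit_sum T f n y" using n(2) True unfolding fA[OF y] by (simp add: algebra_simps)
    then have "\<forall>\<^sub>F i in sequentially. 0 < positive_max T f i y"
      using orbit_sum_le_positive_max[of n _ T f y] by (intro eventually_sequentiallyI[of n]) (auto intro: less_le_trans)
    then have "\<forall>\<^sub>F i in sequentially. f y * indicator {y. 0 < positive_max T f i y} y = f y"
      by eventually_elim simp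
    then show ?thesis by (rule tendsto_eventually)
  qed (simp add: f_def)
  have "(\<lambda>n. \<integral>y. f y * indicator {y. 0 < positive_max T f n y} y \<partial>M) \<longlonglongrightarrow> (\<integral>y. f y \<partial>M)"
  proof (rule integral_dominated_convergence[where w = "\<lambda>y. \<bar>f y\<bar>"])
    show "(\<lambda>y. f y * indicator {y. 0 < positive_max T f n y} y) \<in> borel_measurable M" for n
    proof -
      have [measurable]: "f \<in> borel_measurable M" "positive_max T f n \<in> borel_measurable M"
        using fint integrable_positive_max[OF T fint, of n] by auto
      show ?thesis by measurable
    qed
  qed (use fint lim in \<open>auto simp: indicator_def\<close>)
  then have "0 \<le> (\<integral>y. f y \<partial>M)"
    using maximal_ergodic[OF T fint] by (intro LIMSEQ_le_const) auto
  moreover have "(\<integral>y. f y \<partial>M) = - \<epsilon> * prob A"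
  proof -
    have "f = (\<lambda>y. g y * indicator A y - e y * indicator A y - \<epsilon> * indicator A y)"
      by (auto simp: f_def fun_eq_iff algebra_simps)
    moreover have "(\<integral>y. g y * indicator A y \<partial>M) = (\<integral>y. e y * indicator A y \<partial>M)"
      using I.real_cond_exp_intA[OF g AI] unfolding e_def set_lebesgue_integral_def by (simp add: mult.commute)
    moreover have "integrable M (\<lambda>y. g y * indicator A y)" "integrable M (\<lambda>y. e y * indicator A y)"
      by (intro integrable_real_mult_indicator AM g eint)+
    moreover have "integrable M (indicator A :: 'a \<Rightarrow> real)" "(\<integral>y. indicator A y \<partial>M) = prob A"
      using AM sets.sets_into_space[OF AM]
      by (auto intro!: integrable_real_indicator simp: emeasure_eq_measure Int_absorb2)
    ultimately show ?thesis by simp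
  qed
  ultimately have "prob A \<le> 0" using \<epsilon> by (simp add: mult_le_0_iff)
  then have "prob A = 0" by (simp add: measure_le_0_iff)
  then have "A \<in> null_sets M" using AM by (simp add: emeasure_eq_measure null_sets_def)
  from AE_not_in[OF this] show ?thesis
    using AE_space
  proof eventually_elim
    case (elim y)
    then have "\<not> Q y" by (simp add: A_def)
    then show ?case unfolding Q_def by (simp only: not_ex not_all not_le) (meson not_le)
  qed
qed

theorem ergodic_theorem:
  assumes T: "measure_preserving_map M T" and g: "integrable M g"
  shows "AE y in M. (\<lambda>n. orbit_sum T g n y / real n) \<longlonglongrightarrow> real_cond_exp M (invariant_algebra M T) g y"
proof -
  note Tm = measurable_measure_preserving[OF T]
  interpret I: sigma_finite_subalgebra M "invariant_algebra M T"
    by (rule sigma_finite_subalgebra_invariant[OF Tm])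
  define e where "e = real_cond_exp M (invariant_algebra M T) g"
  have g': "integrable M (\<lambda>y. - g y)" using g by simp
  have neg: "AE y in M. real_cond_exp M (invariant_algebra M T) (\<lambda>y. - g y) y = - e y"
    using I.real_cond_exp_cmult[OF g, of "-1"] by (simp add: e_def)
  have "AE y in M. \<forall>i k::nat. \<exists>N. \<forall>n\<ge>N.
      orbit_sum T g n y < real n * (e y + 1 / real (Suc i) + 1 / real (Suc k))"
    unfolding AE_all_countable e_def
    by (intro allI) (use ergodic_upper_bound[OF T g, of "1 / real (Suc _)"] in \<open>simp add: AE_all_countable\<close>)
  moreover have "AE y in M. \<forall>i k::nat. \<exists>N. \<forall>n\<ge>N. orbit_sum T (\<lambda>y. - g y) n y
      < real n * (real_cond_exp M (invariant_algebra M T) (\<lambda>y. - g y) y + 1 / real (Suc i) + 1 / real (Suc k))"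
    unfolding AE_all_countable
    by (intro allI) (use ergodic_upper_bound[OF T g', of "1 / real (Suc _)"] in \<open>simp add: AE_all_countable\<close>)
  ultimately have "AE y in M. (\<lambda>n. orbit_sum T g n y / real n) \<longlonglongrightarrow> e y"
    using neg
  proof eventually_elim
    case (elim y)
    show ?case
    proof (rule LIMSEQ_I)
      fix r :: real assume r: "0 < r"
      obtain i :: nat where i: "1 / real (Suc i) < r / 2" using nat_approx_posE[of "r / 2"] r by auto
      obtain N1 where N1: "\<And>n. n \<ge> N1 \<Longrightarrow> orbit_sum T g n y < real n * (e y + 1 / real (Suc i) + 1 / real (Suc i))"
        using elim(1) by blast
      obtain N2 where N2: "\<And>n. n \<ge> N2 \<Longrightarrow>
          orbit_sum T (\<lambda>y. - g y) n y < real n * (- e y + 1 / real (Suc i) + 1 / real (Suc i))"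
        using elim(2) unfolding elim(3) by blast
      have "norm (orbit_sum T g n y / real n - e y) < r" if n: "n \<ge> max 1 (max N1 N2)" for n
      proof -
        have "real n * (e y + 1 / real (Suc i) + 1 / real (Suc i)) \<le> real n * (e y + r)"
          "real n * (- e y + 1 / real (Suc i) + 1 / real (Suc i)) \<le> real n * (- e y + r)"
          using i by (intro mult_left_mono; simp)+
        moreover have "orbit_sum T g n y < real n * (e y + 1 / real (Suc i) + 1 / real (Suc i))"
          using n by (intro N1) simp
        moreover have "- orbit_sum T g n y < real n * (- e y + 1 / real (Suc i) + 1 / real (Suc i))"
          using N2[of n] n by (simp only: orbit_sum_uminus)
        ultimately have "orbit_sum T g n y < real n * (e y + r)" "- orbit_sum T g n y < real n * (- e y + r)"
          by (meson less_le_trans)+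
        then show ?thesis using n by (simp add: abs_less_iff field_simps)
      qed
      then show "\<exists>N. \<forall>n\<ge>N. norm (orbit_sum T g n y / real n - e y) < r" by blast
    qed
  qed
  then show ?thesis unfolding e_def .
qed

end

section \<open>Characteristic functions of martingale sums\<close>

lemma norm_one_plus_ii_ge: "1 \<le> norm (1 + \<i> * complex_of_real x)"
proof -
  have "norm (1 + \<i> * complex_of_real x) = sqrt (1 + x\<^sup>2)" by (simp add: norm_complex_def)
  then show ?thesis by simp
qed

text \<open>
  Both terms have modulus at most one, which later allows to compare products factor by factor. The
  error is of third order because \<open>(1 + \<i> x) (1 - x\<^sup>2 / 2)\<close> agrees with \<open>exp (\<i> x)\<close> to second order.
\<close>

lemma iexp_div_one_plus_approx:
  assumes x: "\<bar>x\<bar> \<le> 1"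
  shows "norm (exp (\<i> * complex_of_real x) / (1 + \<i> * complex_of_real x) - complex_of_real (exp (- x\<^sup>2 / 2)))
    \<le> \<bar>x\<bar> ^ 3"
proof -
  define z where "z = 1 + \<i> * complex_of_real x"
  define a where "a = exp (\<i> * complex_of_real x)"
  define g where "g = exp (- x\<^sup>2 / 2)"
  have z: "1 \<le> norm z" "z \<noteq> 0" using norm_one_plus_ii_ge[of x] unfolding z_def[symmetric] by auto
  have nz: "norm z \<le> 2"
    unfolding z_def using norm_triangle_ineq[of 1 "\<i> * complex_of_real x"] x by (simp add: norm_mult)
  have A: "norm (a - (1 + \<i> * x - x\<^sup>2 / 2)) \<le> \<bar>x\<bar> ^ 3 / 6"
  proof -
    have "(\<Sum>k\<le>2. (\<i> * complex_of_real x) ^ k / fact k) = 1 + \<i> * x - x\<^sup>2 / 2"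
    proof -
      have "(\<Sum>k\<le>2. f k) = f 0 + f 1 + f 2" for f :: "nat \<Rightarrow> complex" by (simp add: numeral_2_eq_2)
      then show ?thesis by (simp add: power_mult_distrib)
    qed
    then show ?thesis using iexp_approx1[of x 2] by (simp add: a_def eval_nat_numeral)
  qed
  have B: "\<bar>g - (1 - x\<^sup>2 / 2)\<bar> \<le> x ^ 4 / 8"
  proof -
    define u where "u = x\<^sup>2 / 2"
    have u: "0 \<le> u" by (simp add: u_def)
    have "1 - u \<le> exp (- u)" using exp_ge_add_one_self[of "- u"] by simp
    moreover have "exp (- u) \<le> 1 - u + u\<^sup>2 / 2"
    proof -
      obtain t where t: "\<bar>t\<bar> \<le> \<bar>- u\<bar>"
        "exp (- u) = (\<Sum>m<3. (- u) ^ m / fact m) + exp t / fact 3 * (- u) ^ 3"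
        using Maclaurin_exp_le[of "- u" 3] by blast
      have "(\<Sum>m<3. (- u) ^ m / fact m) = 1 - u + u\<^sup>2 / 2"
        by (simp add: eval_nat_numeral)
      moreover have "exp t / fact 3 * (- u) ^ 3 \<le> 0" using u by (simp add: mult_nonneg_nonpos)
      ultimately show ?thesis using t(2) by simp
    qed
    ultimately have "\<bar>exp (- u) - (1 - u)\<bar> \<le> u\<^sup>2 / 2" by simp
    then show ?thesis by (simp add: u_def g_def power_divide eval_nat_numeral)
  qed
  have "norm (a / z - g) = norm (a - g * z) / norm z"
    using z by (simp add: norm_divide[symmetric] diff_divide_distrib)
  also have "\<dots> \<le> norm (a - g * z)"
    using z(1) by (simp add: divide_le_eq mult_le_cancel_left1)
  also have "a - g * z = (a - (1 + \<i> * x - x\<^sup>2 / 2)) - complex_of_real (g - (1 - x\<^sup>2 / 2)) * z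
      + \<i> * complex_of_real (x ^ 3 / 2)"
    by (simp add: z_def algebra_simps eval_nat_numeral)
  also have "norm \<dots> \<le> \<bar>x\<bar> ^ 3 / 6 + x ^ 4 / 8 * 2 + \<bar>x\<bar> ^ 3 / 2"
  proof -
    have C: "norm (complex_of_real (g - (1 - x\<^sup>2 / 2)) * z) \<le> x ^ 4 / 8 * 2"
      unfolding norm_mult norm_of_real using B nz by (intro mult_mono) auto
    have D: "norm (\<i> * complex_of_real (x ^ 3 / 2)) = \<bar>x\<bar> ^ 3 / 2"
      by (simp add: norm_mult norm_power norm_divide)
    have tri: "norm (p - q + r) \<le> norm p + norm q + norm r" for p q r :: complex
      using norm_triangle_ineq[of "p - q" r] norm_triangle_ineq4[of p q] by linarith
    show ?thesis by (rule order_trans[OF tri]) (use A C D in linarith)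
  qed
  also have "\<dots> \<le> \<bar>x\<bar> ^ 3"
  proof -
    have "x ^ 4 = \<bar>x\<bar> ^ 3 * \<bar>x\<bar>" by (simp add: eval_nat_numeral abs_mult[symmetric])
    also have "\<dots> \<le> \<bar>x\<bar> ^ 3 * 1" using x by (intro mult_left_mono) auto
    finally have "x ^ 4 \<le> \<bar>x\<bar> ^ 3" by simp
    moreover have "0 \<le> \<bar>x\<bar> ^ 3" by simp
    ultimately show ?thesis by linarith
  qed
  finally show ?thesis unfolding a_def z_def g_def .
qed

context prob_space
begin

lemma martingale_difference_complex:
  fixes G :: "'a \<Rightarrow> complex"
  assumes T: "measure_preserving_map M T" and m: "integrable M m" and u: "is_transfer M T m (\<lambda>_. 0)"
    and G [measurable]: "G \<in> borel_measurable M" and C: "\<And>y. norm (G y) \<le> C"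
  shows "(\<integral>y. complex_of_real (m y) * G (T y) \<partial>M) = 0"
    "integrable M (\<lambda>y. complex_of_real (m y) * G (T y))"
proof -
  note [measurable] = measurable_measure_preserving[OF T]
  have [measurable]: "m \<in> borel_measurable M" using m by auto
  show int: "integrable M (\<lambda>y. complex_of_real (m y) * G (T y))"
  proof (rule Bochner_Integration.integrable_bound)
    show "integrable M (\<lambda>y. C * m y)" using m by simp
    show "AE y in M. norm (complex_of_real (m y) * G (T y)) \<le> norm (C * m y)"
    proof (rule AE_I2)
      fix y
      have "\<bar>m y\<bar> * norm (G (T y)) \<le> \<bar>m y\<bar> * \<bar>C\<bar>" using C[of "T y"] by (intro mult_left_mono) auto
      then show "norm (complex_of_real (m y) * G (T y)) \<le> norm (C * m y)"
        by (simp add: norm_mult abs_mult mult.commute)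
    qed
  qed measurable
  have "(\<integral>y. m y * Re (G (T y)) \<partial>M) = 0"
    using is_transferD[OF u, of "\<lambda>y. Re (G y)" C] C abs_Re_le_cmod order_trans by (simp) blast
  moreover have "(\<integral>y. m y * Im (G (T y)) \<partial>M) = 0"
    using is_transferD[OF u, of "\<lambda>y. Im (G y)" C] C abs_Im_le_cmod order_trans by (simp) blast
  ultimately show "(\<integral>y. complex_of_real (m y) * G (T y) \<partial>M) = 0"
    using integral_Re[OF int] integral_Im[OF int] by (simp add: complex_eq_iff)
qed

text \<open>
  An invariant weight \<open>\<phi>\<close> behaves like a constant under the conditional expectations involved, so
  that the random limit of the variances can be carried through the martingale computation.
\<close>

lemma integral_prod_one_plus:
  fixes a :: "nat \<Rightarrow> real"
  assumes T: "measure_preserving_map M T" and m [measurable]: "m \<in> borel_measurable M"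
    and K: "\<And>y. \<bar>m y\<bar> \<le> K" and u: "is_transfer M T m (\<lambda>_. 0)"
    and \<phi> [measurable]: "\<phi> \<in> borel_measurable M" and inv: "\<And>y. y \<in> space M \<Longrightarrow> \<phi> (T y) = \<phi> y"
    and b\<phi>: "\<And>y. \<bar>\<phi> y\<bar> \<le> 1"
  shows "(\<integral>y. (\<Prod>j<n. 1 + \<i> * complex_of_real (a j * m ((T ^^ j) y))) * complex_of_real (\<phi> y) \<partial>M)
    = (\<integral>y. complex_of_real (\<phi> y) \<partial>M)"
proof (induction n arbitrary: a)
  case (Suc n)
  note [measurable] = measurable_measure_preserving[OF T] measurable_funpow_preserving[OF T]
  have mint: "integrable M m" using K by (intro integrable_bounded) auto
  have K0: "0 \<le> K" using K[of undefined] by simp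
  define G where "G = (\<lambda>y. (\<Prod>j<n. 1 + \<i> * complex_of_real (a (Suc j) * m ((T ^^ j) y))) * complex_of_real (\<phi> y))"
  have Gm [measurable]: "G \<in> borel_measurable M" unfolding G_def by measurable
  have bG: "norm (G y) \<le> (\<Prod>j<n. 1 + \<bar>a (Suc j)\<bar> * K) * 1" for y
  proof -
    have "norm (1 + \<i> * complex_of_real (a (Suc j) * m ((T ^^ j) y))) \<le> 1 + \<bar>a (Suc j)\<bar> * K" for j
    proof (rule order_trans[OF norm_triangle_ineq])
      have "\<bar>a (Suc j)\<bar> * \<bar>m ((T ^^ j) y)\<bar> \<le> \<bar>a (Suc j)\<bar> * K" using K by (intro mult_left_mono) auto
      then show "norm (1::complex) + norm (\<i> * complex_of_real (a (Suc j) * m ((T ^^ j) y))) \<le> 1 + \<bar>a (Suc j)\<bar> * K"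
        by (simp add: norm_mult abs_mult)
    qed
    then show ?thesis
      unfolding G_def norm_mult prod_norm[symmetric] using b\<phi>
      by (intro mult_mono prod_mono prod_nonneg) (auto simp: K0)
  qed
  have Gint: "integrable M G"
    using bG by (intro integrable_const_bound[where B = "(\<Prod>j<n. 1 + \<bar>a (Suc j)\<bar> * K) * 1"]) auto
  have "(\<integral>y. (\<Prod>j<Suc n. 1 + \<i> * complex_of_real (a j * m ((T ^^ j) y))) * complex_of_real (\<phi> y) \<partial>M)
      = (\<integral>y. G (T y) + \<i> * complex_of_real (a 0) * (complex_of_real (m y) * G (T y)) \<partial>M)"
  proof (rule Bochner_Integration.integral_cong[OF refl])
    fix y assume y: "y \<in> space M"
    show "(\<Prod>j<Suc n. 1 + \<i> * complex_of_real (a j * m ((T ^^ j) y))) * complex_of_real (\<phi> y)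
      = G (T y) + \<i> * complex_of_real (a 0) * (complex_of_real (m y) * G (T y))"
      unfolding G_def inv[OF y]
      by (subst prod.lessThan_Suc_shift) (simp add: funpow_swap1 algebra_simps)
  qed
  also have "\<dots> = (\<integral>y. G (T y) \<partial>M) + \<i> * complex_of_real (a 0) * (\<integral>y. complex_of_real (m y) * G (T y) \<partial>M)"
    using integrable_measure_preserving[OF T Gint] martingale_difference_complex(2)[OF T mint u Gm bG] by simp
  also have "\<dots> = (\<integral>y. G y \<partial>M)"
    using integral_measure_preserving[OF T, of G] martingale_difference_complex(1)[OF T mint u Gm bG] by simp
  also have "\<dots> = (\<integral>y. complex_of_real (\<phi> y) \<partial>M)" unfolding G_def by (rule Suc)
  finally show ?case .
qed simp

text \<open>
  McLeish's argument: the product \<open>\<Prod> (1 + \<i> x\<^sub>j)\<close> is bounded, has mean one even against the invariant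
  weight \<open>exp (- s / 2)\<close>, and its quotient with \<open>exp (\<i> \<Sum> x\<^sub>j)\<close> tends to that weight.
\<close>

lemma martingale_char_tendsto:
  fixes \<theta> :: "nat \<Rightarrow> nat \<Rightarrow> real"
  assumes T: "measure_preserving_map M T" and m [measurable]: "m \<in> borel_measurable M"
    and K: "\<And>y. \<bar>m y\<bar> \<le> K" and u: "is_transfer M T m (\<lambda>_. 0)"
    and B: "\<And>n j. \<bar>\<theta> n j\<bar> \<le> B"
    and s [measurable]: "s \<in> borel_measurable M" and inv: "\<And>y. y \<in> space M \<Longrightarrow> s (T y) = s y"
    and lim: "AE y in M. (\<lambda>n. (\<Sum>j<n. (\<theta> n j * m ((T ^^ j) y))\<^sup>2) / real n) \<longlonglongrightarrow> s y"
  shows "(\<lambda>n. \<integral>y. exp (\<i> * complex_of_real ((\<Sum>j<n. \<theta> n j * m ((T ^^ j) y)) / sqrt (real n))) \<partial>M)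
    \<longlonglongrightarrow> (\<integral>y. complex_of_real (exp (- s y / 2)) \<partial>M)"
proof -
  note [measurable] = measurable_funpow_preserving[OF T]
  have B0: "0 \<le> B" using B[of 0 0] by simp
  define x where "x = (\<lambda>n j y. \<theta> n j * m ((T ^^ j) y) / sqrt (real n))"
  have [measurable]: "x n j \<in> borel_measurable M" for n j unfolding x_def by measurable
  have bx: "\<bar>x n j y\<bar> \<le> B * K / sqrt (real n)" for n j y
  proof -
    have "\<bar>\<theta> n j\<bar> * \<bar>m ((T ^^ j) y)\<bar> \<le> B * K" using B K by (intro mult_mono) (auto simp: B0)
    then show ?thesis by (simp add: x_def abs_divide abs_mult divide_right_mono)
  qed
  define P where "P = (\<lambda>n y. \<Prod>j<n. 1 + \<i> * complex_of_real (x n j y))"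
  define V where "V = (\<lambda>n y. exp (\<i> * complex_of_real (\<Sum>j<n. x n j y)))"
  define \<phi> where "\<phi> = (\<lambda>y. exp (- max 0 (s y) / 2))"
  have [measurable]: "P n \<in> borel_measurable M" "V n \<in> borel_measurable M" "\<phi> \<in> borel_measurable M" for n
    unfolding P_def V_def \<phi>_def by measurable
  have b\<phi>: "\<bar>\<phi> y\<bar> \<le> 1" for y by (simp add: \<phi>_def)
  have s0: "AE y in M. 0 \<le> s y"
    using lim by eventually_elim (rule LIMSEQ_le_const, assumption, auto intro!: divide_nonneg_nonneg sum_nonneg)
  have P1: "1 \<le> norm (P n y)" for n y
    unfolding P_def prod_norm[symmetric] by (rule prod_ge_1) (rule norm_one_plus_ii_ge)
  have P2: "norm (P n y) \<le> exp ((B * K)\<^sup>2 / 2)" for n y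
  proof -
    have "norm (1 + \<i> * complex_of_real (x n j y)) \<le> exp ((B * K)\<^sup>2 / 2 / real n)" for j
    proof -
      have "norm (1 + \<i> * complex_of_real (x n j y)) = sqrt (1 + (x n j y)\<^sup>2)" by (simp add: norm_complex_def)
      also have "\<dots> \<le> sqrt (exp ((x n j y)\<^sup>2))" by (intro real_sqrt_le_mono) (rule exp_ge_add_one_self)
      also have "\<dots> = exp ((x n j y)\<^sup>2 / 2)"
        by (rule real_sqrt_unique) (auto simp: power2_eq_square mult_exp_exp)
      also have "\<dots> \<le> exp ((B * K)\<^sup>2 / 2 / real n)"
      proof -
        have "(x n j y)\<^sup>2 \<le> (B * K / sqrt (real n))\<^sup>2"
          using power_mono[OF bx, of n j y 2] by simp
        then show ?thesis by (simp add: power_divide)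
      qed
      finally show ?thesis .
    qed
    then have "norm (P n y) \<le> (\<Prod>j<n. exp ((B * K)\<^sup>2 / 2 / real n))"
      unfolding P_def prod_norm[symmetric] by (intro prod_mono) auto
    also have "\<dots> = exp (real n * ((B * K)\<^sup>2 / 2 / real n))"
      unfolding exp_of_nat_mult by (simp only: prod_constant card_lessThan)
    also have "\<dots> \<le> exp ((B * K)\<^sup>2 / 2)" by (cases "n = 0") auto
    finally show ?thesis .
  qed
  have V1: "norm (V n y) = 1" for n y unfolding V_def by (rule norm_exp_i_times)
  have EP: "(\<integral>y. P n y * complex_of_real (\<phi> y) \<partial>M) = (\<integral>y. complex_of_real (\<phi> y) \<partial>M)" for n
    unfolding P_def x_def
    using integral_prod_one_plus[OF T m K u, where \<phi> = \<phi> and n = n and a = "\<lambda>j. \<theta> n j / sqrt (real n)"] inv b\<phi>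
    by (simp add: \<phi>_def)
  have quot: "AE y in M. (\<lambda>n. V n y / P n y) \<longlonglongrightarrow> complex_of_real (\<phi> y)"
    using lim s0
  proof eventually_elim
    case (elim y)
    define g where "g = (\<lambda>n. \<Prod>j<n. complex_of_real (exp (- (x n j y)\<^sup>2 / 2)))"
    have g: "g n = complex_of_real (exp (- ((\<Sum>j<n. (\<theta> n j * m ((T ^^ j) y))\<^sup>2) / real n) / 2))" for n
      unfolding g_def of_real_prod[symmetric] exp_sum[OF finite_lessThan, symmetric] x_def power_divide
      by (simp add: sum_divide_distrib sum_negf)
    have glim: "g \<longlonglongrightarrow> complex_of_real (\<phi> y)"
    proof -
      have "(\<lambda>n. complex_of_real (exp (- q n / 2))) \<longlonglongrightarrow> complex_of_real (exp (- s y / 2))"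
        if "q \<longlonglongrightarrow> s y" for q :: "nat \<Rightarrow> real"
        using that by (intro tendsto_intros) auto
      from this[OF elim(1)] show ?thesis unfolding g \<phi>_def using elim(2) by simp
    qed
    have diff: "norm (V n y / P n y - g n) \<le> (B * K) ^ 3 / sqrt (real n)"
      if n: "0 < n" "B * K \<le> sqrt (real n)" for n
    proof -
      have s: "0 < sqrt (real n)" using n by simp
      have x1: "\<bar>x n j y\<bar> \<le> 1" for j
        using bx[of n j y] n s by (smt (verit) divide_le_eq_1_pos)
      have "V n y / P n y = (\<Prod>j<n. exp (\<i> * complex_of_real (x n j y)) / (1 + \<i> * complex_of_real (x n j y)))"
        unfolding V_def P_def prod_dividef of_real_sum sum_distrib_left exp_sum[OF finite_lessThan] ..
      then have "norm (V n y / P n y - g n) \<le> (\<Sum>j<n. norm (exp (\<i> * complex_of_real (x n j y)) /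
          (1 + \<i> * complex_of_real (x n j y)) - complex_of_real (exp (- (x n j y)\<^sup>2 / 2))))"
        unfolding g_def
        by (simp only:) (rule norm_prod_diff; simp add: norm_divide norm_one_plus_ii_ge divide_le_eq_1
            order_trans[OF zero_le_one norm_one_plus_ii_ge])
      also have "\<dots> \<le> (\<Sum>j<n. (B * K / sqrt (real n)) ^ 3)"
        by (intro sum_mono order_trans[OF iexp_div_one_plus_approx[OF x1]] power_mono bx) auto
      also have "\<dots> = real n * ((B * K) ^ 3 / (sqrt (real n)) ^ 3)" by (simp add: power_divide)
      also have "(sqrt (real n)) ^ 3 = real n * sqrt (real n)" by (simp add: eval_nat_numeral)
      also have "real n * ((B * K) ^ 3 / (real n * sqrt (real n))) = (B * K) ^ 3 / sqrt (real n)"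
        using n by simp
      finally show ?thesis .
    qed
    have sq: "filterlim (\<lambda>n. sqrt (real n)) at_top sequentially"
      by (rule filterlim_compose[OF sqrt_at_top filterlim_real_sequentially])
    have "(\<lambda>n. V n y / P n y - g n) \<longlonglongrightarrow> 0"
    proof (rule Lim_null_comparison)
      show "\<forall>\<^sub>F n in sequentially. norm (V n y / P n y - g n) \<le> (B * K) ^ 3 / sqrt (real n)"
        using eventually_gt_at_top[of 0] filterlim_at_top[THEN iffD1, OF sq, rule_format, of "B * K"]
        by eventually_elim (rule diff)
      show "(\<lambda>n. (B * K) ^ 3 / sqrt (real n)) \<longlonglongrightarrow> 0"
        by (rule tendsto_divide_0[OF tendsto_const filterlim_at_top_imp_at_infinity[OF sq]])
    qed
    from tendsto_add[OF this glim] show ?case by simp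
  qed
  have intV: "integrable M (V n)" for n by (rule integrable_const_bound[where B = 1]) (auto simp: V1)
  have intP: "integrable M (\<lambda>y. P n y * complex_of_real (\<phi> y))" for n
    by (rule integrable_const_bound[where B = "exp ((B * K)\<^sup>2 / 2) * 1"])
       (auto simp: norm_mult simp del: mult_1_right intro!: mult_mono P2 b\<phi>)
  have "(\<lambda>n. \<integral>y. norm (V n y / P n y - complex_of_real (\<phi> y)) \<partial>M) \<longlonglongrightarrow> (\<integral>y. 0 \<partial>M)"
  proof (rule integral_dominated_convergence[where w = "\<lambda>_. 2"])
    show "AE y in M. (\<lambda>n. norm (V n y / P n y - complex_of_real (\<phi> y))) \<longlonglongrightarrow> 0"
      using quot by eventually_elim (rule tendsto_norm_zero, rule LIM_zero)
    show "AE y in M. norm (norm (V n y / P n y - complex_of_real (\<phi> y))) \<le> 2" for n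
    proof (rule AE_I2)
      fix y
      have "norm (V n y / P n y) \<le> 1" using P1[of n y] by (simp add: norm_divide V1 divide_le_eq_1)
      then show "norm (norm (V n y / P n y - complex_of_real (\<phi> y))) \<le> 2"
        using norm_triangle_ineq4[of "V n y / P n y" "complex_of_real (\<phi> y)"] b\<phi>[of y] by simp
    qed
  qed auto
  then have "(\<lambda>n. exp ((B * K)\<^sup>2 / 2) * (\<integral>y. norm (V n y / P n y - complex_of_real (\<phi> y)) \<partial>M)) \<longlonglongrightarrow> 0"
    by (auto intro: tendsto_mult_right_zero)
  moreover have "norm ((\<integral>y. V n y \<partial>M) - (\<integral>y. complex_of_real (\<phi> y) \<partial>M))
      \<le> exp ((B * K)\<^sup>2 / 2) * (\<integral>y. norm (V n y / P n y - complex_of_real (\<phi> y)) \<partial>M)" for n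
  proof -
    have P0: "P n y \<noteq> 0" for y using P1[of n y] by auto
    have bd: "norm (V n y / P n y - complex_of_real (\<phi> y)) \<le> 2" for y
    proof -
      have "norm (V n y / P n y) \<le> 1" using P1[of n y] by (simp add: norm_divide V1 divide_le_eq_1)
      then show ?thesis
        using norm_triangle_ineq4[of "V n y / P n y" "complex_of_real (\<phi> y)"] b\<phi>[of y] by simp
    qed
    have intd: "integrable M (\<lambda>y. norm (V n y / P n y - complex_of_real (\<phi> y)))"
      using bd by (intro integrable_const_bound[where B = 2]) auto
    have "(\<integral>y. V n y \<partial>M) - (\<integral>y. complex_of_real (\<phi> y) \<partial>M) = (\<integral>y. V n y - P n y * complex_of_real (\<phi> y) \<partial>M)"
      using intV intP EP by simp
    also have "norm \<dots> \<le> (\<integral>y. norm (V n y - P n y * complex_of_real (\<phi> y)) \<partial>M)"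
      by (rule integral_norm_bound)
    also have "\<dots> \<le> (\<integral>y. exp ((B * K)\<^sup>2 / 2) * norm (V n y / P n y - complex_of_real (\<phi> y)) \<partial>M)"
    proof (rule integral_mono)
      fix y
      have "V n y - P n y * complex_of_real (\<phi> y) = P n y * (V n y / P n y - complex_of_real (\<phi> y))"
        using P0[of y] by (simp add: right_diff_distrib)
      then show "norm (V n y - P n y * complex_of_real (\<phi> y))
          \<le> exp ((B * K)\<^sup>2 / 2) * norm (V n y / P n y - complex_of_real (\<phi> y))"
        unfolding norm_mult[symmetric] by (simp only: norm_mult) (intro mult_right_mono P2, simp)
    qed (use intV intP intd in auto)
    finally show ?thesis by simp
  qed
  ultimately have "(\<lambda>n. (\<integral>y. V n y \<partial>M) - (\<integral>y. complex_of_real (\<phi> y) \<partial>M)) \<longlonglongrightarrow> 0"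
    by (rule Lim_null_comparison[OF always_eventually, OF allI, rotated])
  then have "(\<lambda>n. \<integral>y. V n y \<partial>M) \<longlonglongrightarrow> (\<integral>y. complex_of_real (\<phi> y) \<partial>M)"
    by (simp add: LIM_zero_iff)
  moreover have "(\<integral>y. complex_of_real (\<phi> y) \<partial>M) = (\<integral>y. complex_of_real (exp (- s y / 2)) \<partial>M)"
  proof (rule integral_cong_AE)
    show "AE y in M. complex_of_real (\<phi> y) = complex_of_real (exp (- s y / 2))"
      using s0 by eventually_elim (simp add: \<phi>_def)
  qed measurable
  moreover have "V n y = exp (\<i> * complex_of_real ((\<Sum>j<n. \<theta> n j * m ((T ^^ j) y)) / sqrt (real n)))" for n y
    unfolding V_def x_def by (simp add: sum_divide_distrib)
  ultimately show ?thesis by simp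
qed

end

section \<open>From characteristic functions to bounded continuous functions\<close>

inductive_set trig_polys :: "nat \<Rightarrow> ((nat \<Rightarrow> real) \<Rightarrow> complex) set" for k where
  monomial: "(\<lambda>x. c * exp (\<i> * complex_of_real (\<Sum>j<k. a j * x j))) \<in> trig_polys k"
| add: "p \<in> trig_polys k \<Longrightarrow> q \<in> trig_polys k \<Longrightarrow> (\<lambda>x. p x + q x) \<in> trig_polys k"

text \<open>
  Closure under products is what the Stone-Weierstrass theorem asks for; it is the reason for
  working with exponentials.
\<close>

lemma trig_polys_mult:
  assumes "p \<in> trig_polys k" "q \<in> trig_polys k"
  shows "(\<lambda>x. p x * q x) \<in> trig_polys k"
  using assms
proof (induction arbitrary: q)
  case (monomial c a)
  from monomial.prems show ?case
  proof induction
    case (monomial c' a')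
    have "(\<lambda>x. c * exp (\<i> * complex_of_real (\<Sum>j<k. a j * x j)) * (c' * exp (\<i> * complex_of_real (\<Sum>j<k. a' j * x j))))
       = (\<lambda>x. (c * c') * exp (\<i> * complex_of_real (\<Sum>j<k. (a j + a' j) * x j)))"
      by (simp add: fun_eq_iff distrib_right distrib_left sum.distrib exp_add)
    then show ?case by (simp only: trig_polys.monomial)
  qed (simp only: distrib_left trig_polys.add)
qed (simp only: distrib_right trig_polys.add)

lemma trig_polys_const: "(\<lambda>_. c) \<in> trig_polys k"
  using trig_polys.monomial[of c "\<lambda>_. 0" k] by simp

lemma trig_polys_sin:
  assumes j: "j < k" shows "(\<lambda>x. complex_of_real (sin (x j / r))) \<in> trig_polys k"
proof -
  have s: "(\<Sum>i<k. (if i = j then c else 0) * x i) = c * x j" for c and x :: "nat \<Rightarrow> real"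
    using j by (subst sum.remove[of _ j]) auto
  have "complex_of_real (sin (x j / r))
      = (- \<i> / 2) * exp (\<i> * complex_of_real (\<Sum>i<k. (if i = j then 1 / r else 0) * x i))
      + (\<i> / 2) * exp (\<i> * complex_of_real (\<Sum>i<k. (if i = j then - 1 / r else 0) * x i))" for x :: "nat \<Rightarrow> real"
    unfolding s by (simp add: sin_of_real[symmetric] sin_exp_eq field_simps)
  then show ?thesis by (simp only: trig_polys.intros)
qed

text \<open>
  Composition with \<open>arcsin \<circ> sin\<close> folds the space periodically onto a cube, on which it is the identity.
  The folded function is a continuous function of \<open>sin (x\<^sub>j / r)\<close> on a compact cube, so the
  approximation by trigonometric polynomials is uniform on the whole space.
\<close>

lemma folded_approximation:
  fixes g :: "(nat \<Rightarrow> real) \<Rightarrow> real"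
  assumes g: "continuous_on UNIV g" and e: "0 < e"
  obtains q where "q \<in> trig_polys k"
    "\<And>x. (\<And>j. j \<ge> k \<Longrightarrow> x j = 0) \<Longrightarrow>
      norm (complex_of_real (g (\<lambda>j. r * arcsin (sin (x j / r)))) - q x) < e"
proof -
  define S :: "nat \<Rightarrow> real set" where "S = (\<lambda>j. if j < k then {- 1..1} else {0})"
  define C where "C = {u. \<forall>j. u j \<in> S j}"
  have "compact (PiE UNIV S)"
    using compactin_PiE[of "\<lambda>_. euclidean" UNIV S] by (auto simp: euclidean_product_topology S_def)
  moreover have "PiE UNIV S = C" by (auto simp: C_def PiE_def)
  ultimately have C: "compact C" by simp
  have range: "-1 \<le> u j" "u j \<le> 1" if "u \<in> C" for u j
    using that by (auto simp: C_def S_def split: if_splits dest!: spec[of _ j])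
  define F where "F = (\<lambda>u. g (\<lambda>j. r * arcsin (u j)))"
  have contc: "continuous_on C (\<lambda>u. u j)" for j :: nat
    by (rule continuous_on_subset[OF continuous_on_product_coordinates]) simp
  have "continuous_on C (\<lambda>u j. r * arcsin (u j))"
    by (intro continuous_on_coordinatewise_then_product continuous_intros contc) (auto simp: range)
  then have F: "continuous_on C F"
    unfolding F_def by (intro continuous_on_compose2[OF g]) auto
  define s where "s = (\<lambda>(x :: nat \<Rightarrow> real) j. if j < k then sin (x j / r) else 0)"
  define R where "R = {G. continuous_on C G \<and> (\<lambda>x. complex_of_real (G (s x))) \<in> trig_polys k}"
  interpret function_ring_on R C
  proof
    fix u v assume uv: "u \<in> C" "v \<in> C" "u \<noteq> v"
    then obtain j where j: "u j \<noteq> v j" by auto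
    then have "j < k" using uv by (auto simp: C_def S_def split: if_splits dest!: spec[of _ j])
    then have "(\<lambda>u. u j) \<in> R"
      unfolding R_def mem_Collect_eq s_def using contc trig_polys_sin[of j k r] by simp
    with j show "\<exists>f\<in>R. f u \<noteq> f v" by (intro bexI[of _ "\<lambda>u. u j"])
  next
    fix f g assume fg: "f \<in> R" "g \<in> R"
    then show "(\<lambda>x. f x + g x) \<in> R"
      unfolding R_def mem_Collect_eq of_real_add by (intro conjI continuous_on_add trig_polys.add) auto
    from fg show "(\<lambda>x. f x * g x) \<in> R"
      unfolding R_def mem_Collect_eq of_real_mult by (intro conjI continuous_on_mult trig_polys_mult) auto
  qed (auto simp: R_def C trig_polys_const)
  obtain G where G: "G \<in> R" "\<And>u. u \<in> C \<Longrightarrow> \<bar>F u - G u\<bar> < e"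
    using Stone_Weierstrass_basic[OF F e] by blast
  show ?thesis
  proof (rule that)
    show "(\<lambda>x. complex_of_real (G (s x))) \<in> trig_polys k" using G(1) by (simp add: R_def)
    fix x :: "nat \<Rightarrow> real" assume x: "\<And>j. j \<ge> k \<Longrightarrow> x j = 0"
    have "s x = (\<lambda>j. sin (x j / r))" using x by (auto simp: s_def fun_eq_iff)
    moreover have "s x \<in> C" by (auto simp: C_def S_def s_def)
    ultimately have "\<bar>g (\<lambda>j. r * arcsin (sin (x j / r))) - G (s x)\<bar> < e"
      using G(2)[of "s x"] by (simp add: F_def)
    then show "norm (complex_of_real (g (\<lambda>j. r * arcsin (sin (x j / r)))) - complex_of_real (G (s x))) < e"
      by (metis norm_of_real of_real_diff)
  qed
qed

lemma fold_eq:
  assumes "0 < r" "\<bar>x\<bar> \<le> r" shows "r * arcsin (sin (x / r)) = x"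
proof -
  have "\<bar>x / r\<bar> \<le> 1" using assms by simp
  then have "- (pi / 2) \<le> x / r" "x / r \<le> pi / 2" using pi_gt3 unfolding abs_le_iff by linarith+
  then have "arcsin (sin (x / r)) = x / r" by (rule arcsin_sin)
  then show ?thesis using assms by simp
qed

text \<open>
  Bounded first moments make the error of folding small uniformly in \<open>n\<close>: if some coordinate exceeds
  \<open>r\<close>, the sum of the absolute values divided by \<open>r\<close> is at least one. After folding, the function is
  uniformly close to a trigonometric polynomial, for which convergence is the hypothesis.
\<close>

lemma char_tendsto_imp_continuous_tendsto:
  fixes X :: "nat \<Rightarrow> 'a \<Rightarrow> nat \<Rightarrow> real" and Z :: "'b \<Rightarrow> nat \<Rightarrow> real"
    and g :: "(nat \<Rightarrow> real) \<Rightarrow> real"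
  assumes M: "prob_space M" and Q: "prob_space Q"
    and X: "\<And>n j. (\<lambda>y. X n y j) \<in> borel_measurable M" and Z: "\<And>j. (\<lambda>\<omega>. Z \<omega> j) \<in> borel_measurable Q"
    and X0: "\<And>n y j. j \<ge> k \<Longrightarrow> X n y j = 0" and Z0: "\<And>\<omega> j. j \<ge> k \<Longrightarrow> Z \<omega> j = 0"
    and tight: "\<And>n j. integrable M (\<lambda>y. X n y j)" "\<And>n j. (\<integral>y. \<bar>X n y j\<bar> \<partial>M) \<le> c"
    and conv: "\<And>a. (\<lambda>n. \<integral>y. exp (\<i> * complex_of_real (\<Sum>j<k. a j * X n y j)) \<partial>M)
      \<longlonglongrightarrow> (\<integral>\<omega>. exp (\<i> * complex_of_real (\<Sum>j<k. a j * Z \<omega> j)) \<partial>Q)"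
    and g: "continuous_on UNIV g" and B: "\<And>x. \<bar>g x\<bar> \<le> B"
  shows "(\<lambda>n. \<integral>y. g (X n y) \<partial>M) \<longlonglongrightarrow> (\<integral>\<omega>. g (Z \<omega>) \<partial>Q)"
proof -
  interpret M: prob_space M by fact
  interpret Q: prob_space Q by fact
  have [measurable]: "X n \<in> borel_measurable M" for n by (rule measurable_coordinatewise_then_product[OF X])
  have [measurable]: "Z \<in> borel_measurable Q" by (rule measurable_coordinatewise_then_product[OF Z])
  have [measurable]: "g \<in> borel_measurable borel" by (rule borel_measurable_continuous_onI[OF g])
  have B0: "0 \<le> B" by (rule order_trans[OF abs_ge_zero B])
  have trig: "(\<forall>n. integrable M (\<lambda>y. q (X n y))) \<and> integrable Q (\<lambda>\<omega>. q (Z \<omega>)) \<and>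
      (\<lambda>n. \<integral>y. q (X n y) \<partial>M) \<longlonglongrightarrow> (\<integral>\<omega>. q (Z \<omega>) \<partial>Q)" if "q \<in> trig_polys k" for q
    using that
  proof induction
    case (monomial c a)
    have "integrable M (\<lambda>y. exp (\<i> * complex_of_real (\<Sum>j<k. a j * X n y j)))" for n
      by (rule M.integrable_const_bound[where B = 1]) (use X in \<open>auto simp: norm_exp_i_times simp del: of_real_sum\<close>)
    moreover have "integrable Q (\<lambda>\<omega>. exp (\<i> * complex_of_real (\<Sum>j<k. a j * Z \<omega> j)))"
      by (rule Q.integrable_const_bound[where B = 1]) (use Z in \<open>auto simp: norm_exp_i_times simp del: of_real_sum\<close>)
    ultimately show ?case using tendsto_mult_left[OF conv[of a], of c] by simp
  next
    case (add p q)
    then show ?case by (auto intro: tendsto_add)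
  qed
  define fold where "fold = (\<lambda>r (x :: nat \<Rightarrow> real) j. r * arcsin (sin (x j / r)))"
  have "continuous_on UNIV (fold r)" for r
    unfolding fold_def divide_inverse
    by (intro continuous_on_coordinatewise_then_product continuous_intros
        continuous_on_product_coordinates) auto
  then have [measurable]: "(\<lambda>x. g (fold r x)) \<in> borel_measurable borel" for r
    by (intro borel_measurable_continuous_onI continuous_on_compose2[OF g]) auto
  have fold: "fold r x = x" if "0 < r" "\<And>j. j < k \<Longrightarrow> \<bar>x j\<bar> \<le> r" "\<And>j. j \<ge> k \<Longrightarrow> x j = 0" for r x
  proof
    fix j show "fold r x j = x j"
      unfolding fold_def using that by (cases "j < k") (auto intro!: fold_eq)
  qed
  have intX: "integrable M (\<lambda>y. g (X n y))" "integrable M (\<lambda>y. g (fold r (X n y)))" for n r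
    using B by (intro M.integrable_const_bound[where B = B]; simp)+
  have intZ: "integrable Q (\<lambda>\<omega>. g (Z \<omega>))" "integrable Q (\<lambda>\<omega>. g (fold r (Z \<omega>)))" for r
    using B by (intro Q.integrable_const_bound[where B = B]; simp)+
  have Xfold: "\<bar>(\<integral>y. g (X n y) \<partial>M) - (\<integral>y. g (fold r (X n y)) \<partial>M)\<bar> \<le> 2 * B * (real k * c) / r" if r: "0 < r" for n r
  proof -
    have "\<bar>g (X n y) - g (fold r (X n y))\<bar> \<le> 2 * B * (\<Sum>j<k. \<bar>X n y j\<bar>) / r" for y
    proof (cases "\<forall>j<k. \<bar>X n y j\<bar> \<le> r")
      case True
      then have "fold r (X n y) = X n y" using r X0 by (intro fold) auto
      then show ?thesis using r B0 by (simp add: sum_nonneg)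
    next
      case False
      then obtain j where j: "j < k" "r < \<bar>X n y j\<bar>" by auto
      then have "r \<le> (\<Sum>j<k. \<bar>X n y j\<bar>)" using member_le_sum[of j "{..<k}" "\<lambda>j. \<bar>X n y j\<bar>"] by simp
      then have "2 * B * 1 \<le> 2 * B * ((\<Sum>j<k. \<bar>X n y j\<bar>) / r)" using r B0 by (intro mult_left_mono) auto
      then show ?thesis using B[of "X n y"] B[of "fold r (X n y)"] by simp
    qed
    then have "(\<integral>y. \<bar>g (X n y) - g (fold r (X n y))\<bar> \<partial>M) \<le> (\<integral>y. 2 * B * (\<Sum>j<k. \<bar>X n y j\<bar>) / r \<partial>M)"
      using intX tight(1) by (intro integral_mono) auto
    also have "\<dots> = 2 * B * (\<Sum>j<k. \<integral>y. \<bar>X n y j\<bar> \<partial>M) / r" using tight(1) by simp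
    also have "\<dots> \<le> 2 * B * (\<Sum>j<k. c) / r"
      using r B0 tight(2) by (intro divide_right_mono mult_left_mono sum_mono) auto
    finally show ?thesis
      using integral_abs_bound[of M "\<lambda>y. g (X n y) - g (fold r (X n y))"] intX by simp
  qed
  have Zfold: "(\<lambda>i. \<integral>\<omega>. g (fold (real (Suc i)) (Z \<omega>)) \<partial>Q) \<longlonglongrightarrow> (\<integral>\<omega>. g (Z \<omega>) \<partial>Q)"
  proof (rule integral_dominated_convergence[where w = "\<lambda>_. B"])
    show "AE \<omega> in Q. (\<lambda>i. g (fold (real (Suc i)) (Z \<omega>))) \<longlonglongrightarrow> g (Z \<omega>)"
    proof (rule AE_I2, rule tendsto_eventually)
      fix \<omega>
      obtain N :: nat where N: "(\<Sum>j<k. \<bar>Z \<omega> j\<bar>) \<le> real N" using real_arch_simple by blast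
      have "fold (real (Suc i)) (Z \<omega>) = Z \<omega>" if "i \<ge> N" for i
      proof (rule fold)
        fix j assume "j < k"
        then have "\<bar>Z \<omega> j\<bar> \<le> (\<Sum>j<k. \<bar>Z \<omega> j\<bar>)" by (intro member_le_sum) auto
        then show "\<bar>Z \<omega> j\<bar> \<le> real (Suc i)" using N that by linarith
      qed (use Z0 in auto)
      then show "\<forall>\<^sub>F i in sequentially. g (fold (real (Suc i)) (Z \<omega>)) = g (Z \<omega>)"
        by (intro eventually_sequentiallyI[of N]) simp
    qed
  qed (use B in auto)
  show ?thesis
  proof (rule LIMSEQ_I)
    fix e :: real assume e: "0 < e"
    have "(\<lambda>i. 2 * B * (real k * c) / real (Suc i)) \<longlonglongrightarrow> 0"
      by (rule LIMSEQ_Suc[OF lim_const_over_n])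
    then have "\<forall>\<^sub>F i in sequentially. 2 * B * (real k * c) / real (Suc i) < e / 5"
      using e by (intro order_tendstoD) auto
    moreover have "\<forall>\<^sub>F i in sequentially. dist (\<integral>\<omega>. g (fold (real (Suc i)) (Z \<omega>)) \<partial>Q) (\<integral>\<omega>. g (Z \<omega>) \<partial>Q) < e / 5"
      using Zfold e by (intro tendstoD) auto
    ultimately obtain i where i: "2 * B * (real k * c) / real (Suc i) < e / 5"
      "\<bar>(\<integral>\<omega>. g (fold (real (Suc i)) (Z \<omega>)) \<partial>Q) - (\<integral>\<omega>. g (Z \<omega>) \<partial>Q)\<bar> < e / 5"
      using eventually_happens'[OF sequentially_bot eventually_conj] by (force simp: dist_real_def)
    define r where "r = real (Suc i)"
    have e5: "0 < e / 5" using e by simp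
    obtain q where q: "q \<in> trig_polys k"
      "\<And>x. (\<And>j. j \<ge> k \<Longrightarrow> x j = 0) \<Longrightarrow> norm (complex_of_real (g (fold r x)) - q x) < e / 5"
      using folded_approximation[OF g e5, of k r] unfolding fold_def by blast
    note t = trig[OF q(1)]
    have near: "norm (complex_of_real (\<integral>y. g (fold r (W y)) \<partial>P) - (\<integral>y. q (W y) \<partial>P)) \<le> e / 5"
      if P: "prob_space P" and W: "integrable P (\<lambda>y. g (fold r (W y)))" "integrable P (\<lambda>y. q (W y))"
        and W0: "\<And>y j. j \<ge> k \<Longrightarrow> W y j = 0" for P :: "'c measure" and W :: "'c \<Rightarrow> nat \<Rightarrow> real"
    proof -
      interpret P: prob_space P by fact
      have "complex_of_real (\<integral>y. g (fold r (W y)) \<partial>P) - (\<integral>y. q (W y) \<partial>P)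
        = (\<integral>y. complex_of_real (g (fold r (W y))) - q (W y) \<partial>P)"
        using W by simp
      also have "norm \<dots> \<le> (\<integral>y. norm (complex_of_real (g (fold r (W y))) - q (W y)) \<partial>P)"
        by (rule integral_norm_bound)
      also have "\<dots> \<le> (\<integral>y. e / 5 \<partial>P)"
        using W W0 by (intro integral_mono less_imp_le[OF q(2)]) auto
      finally show ?thesis by (simp add: P.prob_space)
    qed
    have "\<forall>\<^sub>F n in sequentially. dist (\<integral>y. q (X n y) \<partial>M) (\<integral>\<omega>. q (Z \<omega>) \<partial>Q) < e / 5"
      using t e by (intro tendstoD) auto
    then obtain N where N: "\<And>n. n \<ge> N \<Longrightarrow> norm ((\<integral>y. q (X n y) \<partial>M) - (\<integral>\<omega>. q (Z \<omega>) \<partial>Q)) < e / 5"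
      by (auto simp: eventually_sequentially dist_norm)
    have "norm ((\<integral>y. g (X n y) \<partial>M) - (\<integral>\<omega>. g (Z \<omega>) \<partial>Q)) < e" if n: "n \<ge> N" for n
    proof -
      have a: "\<bar>(\<integral>y. g (X n y) \<partial>M) - (\<integral>y. g (fold r (X n y)) \<partial>M)\<bar> < e / 5"
        using Xfold[of r n] i(1) by (simp add: r_def)
      have b: "norm (complex_of_real (\<integral>y. g (fold r (X n y)) \<partial>M) - (\<integral>y. q (X n y) \<partial>M)) \<le> e / 5"
        using t X0 intX by (intro near M) auto
      have c: "norm (complex_of_real (\<integral>\<omega>. g (fold r (Z \<omega>)) \<partial>Q) - (\<integral>\<omega>. q (Z \<omega>) \<partial>Q)) \<le> e / 5"
        using t Z0 intZ by (intro near Q) auto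
      have "norm (complex_of_real (\<integral>y. g (fold r (X n y)) \<partial>M) - complex_of_real (\<integral>\<omega>. g (fold r (Z \<omega>)) \<partial>Q)) < 3 * (e / 5)"
        using b c N[OF n] norm_triangle_ineq4 by (smt (verit) norm_minus_commute norm_diff_triangle_ineq norm_triangle_ineq diff_add_cancel)
      then have "\<bar>(\<integral>y. g (fold r (X n y)) \<partial>M) - (\<integral>\<omega>. g (fold r (Z \<omega>)) \<partial>Q)\<bar> < 3 * (e / 5)"
        by (metis norm_of_real of_real_diff)
      moreover have "\<bar>(\<integral>\<omega>. g (fold r (Z \<omega>)) \<partial>Q) - (\<integral>\<omega>. g (Z \<omega>) \<partial>Q)\<bar> < e / 5"
        using i(2) by (simp only: r_def)
      ultimately show ?thesis using a unfolding real_norm_def by linarith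
    qed
    then show "\<exists>N. \<forall>n\<ge>N. norm ((\<integral>y. g (X n y) \<partial>M) - (\<integral>\<omega>. g (Z \<omega>) \<partial>Q)) < e" by blast
  qed
qed

section \<open>Weak convergence on metric spaces\<close>

lemma measurable_borel_of_continuous:
  assumes "continuous_map X euclideanreal f" shows "f \<in> borel_measurable (borel_of X)"
proof (rule borel_measurableI)
  fix S :: "real set" assume "open S"
  then have "openin X {x \<in> topspace X. f x \<in> S}" using assms by (auto simp: continuous_map_def)
  moreover have "f -` S \<inter> space (borel_of X) = {x \<in> topspace X. f x \<in> S}"
    by (auto simp: borel_of_def space_measure_of_conv)
  ultimately show "f -` S \<inter> space (borel_of X) \<in> sets (borel_of X)"
    unfolding borel_of_def by (subst sets_measure_of) (auto dest: openin_subset[THEN subsetD])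
qed

lemma measurable_borel_ofI:
  assumes "\<And>y. y \<in> space M \<Longrightarrow> V y \<in> topspace X"
    and "\<And>U. openin X U \<Longrightarrow> V -` U \<inter> space M \<in> sets M"
  shows "V \<in> measurable M (borel_of X)"
  unfolding borel_of_def
  by (intro measurable_sigma_sets[OF sets_measure_of]) (use assms in \<open>auto dest: openin_subset[THEN subsetD]\<close>)

context Metric_space
begin

lemma continuous_map_Lipschitz:
  assumes L: "\<And>x y. x \<in> M \<Longrightarrow> y \<in> M \<Longrightarrow> \<bar>f x - f y\<bar> \<le> L * d x y"
  shows "continuous_map mtopology euclideanreal f"
  unfolding continuous_map_def
proof (intro conjI allI impI)
  fix U :: "real set" assume "openin euclideanreal U"
  then have U: "open U" by simp
  show "openin mtopology {x \<in> topspace mtopology. f x \<in> U}"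
    unfolding openin_mtopology
  proof (intro conjI allI impI)
    fix x assume x: "x \<in> {x \<in> topspace mtopology. f x \<in> U}"
    then obtain e where e: "0 < e" "ball (f x) e \<subseteq> U" using U openE by blast
    have "mball x (e / (\<bar>L\<bar> + 1)) \<subseteq> {x \<in> topspace mtopology. f x \<in> U}"
    proof
      fix z assume z: "z \<in> mball x (e / (\<bar>L\<bar> + 1))"
      then have xz: "x \<in> M" "z \<in> M" "d x z < e / (\<bar>L\<bar> + 1)" by auto
      have "\<bar>f x - f z\<bar> \<le> L * d x z" using L xz by blast
      also have "\<dots> \<le> (\<bar>L\<bar> + 1) * d x z" by (intro mult_right_mono) auto
      also have "\<dots> < e" using xz(3) by (simp add: pos_less_divide_eq mult.commute)
      finally have "f z \<in> ball (f x) e" by (simp add: dist_real_def)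
      then show "z \<in> {x \<in> topspace mtopology. f x \<in> U}" using e xz by auto
    qed
    then show "\<exists>r>0. mball x r \<subseteq> {x \<in> topspace mtopology. f x \<in> U}"
      using e by (intro exI[of _ "e / (\<bar>L\<bar> + 1)"]) auto
  qed auto
qed simp

text \<open>
  The infimal convolution of \<open>c\<close> with \<open>m \<sqdot> d\<close>, with the infimum restricted to \<open>A\<close>. It is Lipschitz with
  constant \<open>m\<close>; for \<open>c = 0\<close> and \<open>m = 1\<close> it is the distance to \<open>A\<close>.
\<close>

definition inf_conv :: "'a set \<Rightarrow> ('a \<Rightarrow> real) \<Rightarrow> real \<Rightarrow> 'a \<Rightarrow> real" where
  "inf_conv A c m x = (INF y\<in>A. c y + m * d x y)"

lemma inf_conv_bdd:
  assumes "\<And>y. y \<in> A \<Longrightarrow> 0 \<le> c y" "0 \<le> m"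
  shows "bdd_below ((\<lambda>y. c y + m * d x y) ` A)"
  using assms by (intro bdd_belowI[of _ 0]) auto

lemma inf_conv_le: 
  assumes "\<And>y. y \<in> A \<Longrightarrow> 0 \<le> c y" "0 \<le> m" "y \<in> A"
  shows "inf_conv A c m x \<le> c y + m * d x y"
  unfolding inf_conv_def using inf_conv_bdd[of A c, OF assms(1,2)] assms(3) by (rule cINF_lower)

lemma inf_conv_nonneg:
  assumes "A \<noteq> {}" "\<And>y. y \<in> A \<Longrightarrow> 0 \<le> c y" "0 \<le> m"
  shows "0 \<le> inf_conv A c m x"
  unfolding inf_conv_def using assms by (intro cINF_greatest) auto

lemma inf_conv_Lipschitz:
  assumes A: "A \<noteq> {}" "A \<subseteq> M" and c: "\<And>y. y \<in> A \<Longrightarrow> 0 \<le> c y" "0 \<le> m" and x: "x \<in> M" "x' \<in> M"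
  shows "\<bar>inf_conv A c m x - inf_conv A c m x'\<bar> \<le> m * d x x'"
proof -
  have *: "inf_conv A c m x \<le> inf_conv A c m x' + m * d x x'" if x: "x \<in> M" "x' \<in> M" for x x'
  proof -
    have "inf_conv A c m x - m * d x x' \<le> inf_conv A c m x'"
      unfolding inf_conv_def[of _ _ _ x']
    proof (rule cINF_greatest[OF A(1)])
      fix y assume y: "y \<in> A"
      have "inf_conv A c m x \<le> c y + m * d x y" using c y by (intro inf_conv_le) auto
      also have "m * d x y \<le> m * (d x x' + d x' y)"
        using c(2) triangle[of x x' y] x y A(2) by (intro mult_left_mono) auto
      finally show "inf_conv A c m x - m * d x x' \<le> c y + m * d x' y" by (simp add: algebra_simps)
    qed
    then show ?thesis by simp
  qed
  show ?thesis using *[OF x] *[OF x(2,1)] by (simp add: commute)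
qed

text \<open>
  An open set is where the distance to its complement is positive, and this distance, being
  continuous, is measurable along the limit as a pointwise limit of real functions.
\<close>

lemma measurable_mtopology_limit:
  assumes V: "\<And>k. V k \<in> measurable N (borel_of mtopology)"
    and VM: "\<And>k y. y \<in> space N \<Longrightarrow> V k y \<in> M" and Z: "\<And>y. y \<in> space N \<Longrightarrow> Z y \<in> M"
    and lim: "\<And>y. y \<in> space N \<Longrightarrow> (\<lambda>k. d (V k y) (Z y)) \<longlonglongrightarrow> 0"
  shows "Z \<in> measurable N (borel_of mtopology)"
proof (rule measurable_borel_ofI)
  fix U assume U: "openin mtopology U"
  then have UM: "U \<subseteq> M" by (simp add: openin_mtopology)
  show "Z -` U \<inter> space N \<in> sets N"
  proof (cases "U = M")
    case True
    then have "Z -` U \<inter> space N = space N" using Z by auto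
    then show ?thesis by simp
  next
    case False
    define A where "A = M - U"
    have A: "A \<noteq> {}" "A \<subseteq> M" using False UM by (auto simp: A_def)
    define f where "f = inf_conv A (\<lambda>_. 0) 1"
    have L: "\<bar>f x - f y\<bar> \<le> 1 * d x y" if "x \<in> M" "y \<in> M" for x y
      unfolding f_def using that A by (intro inf_conv_Lipschitz) auto
    have fV: "(\<lambda>y. f (V k y)) \<in> borel_measurable N" for k
      by (rule measurable_compose[OF V measurable_borel_of_continuous[OF continuous_map_Lipschitz[OF L]]])
    have "(\<lambda>y. f (Z y)) \<in> borel_measurable N"
    proof (rule borel_measurable_LIMSEQ_real[OF _ fV])
      fix y assume y: "y \<in> space N"
      have "(\<lambda>k. f (V k y) - f (Z y)) \<longlonglongrightarrow> 0"
        using L[OF VM[OF y] Z[OF y]] by (intro Lim_null_comparison[OF _ lim[OF y]] always_eventually) auto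
      then show "(\<lambda>k. f (V k y)) \<longlonglongrightarrow> f (Z y)" by (simp add: LIM_zero_iff)
    qed
    then have "{y \<in> space N. 0 < f (Z y)} \<in> sets N" by measurable
    moreover have "Z -` U \<inter> space N = {y \<in> space N. 0 < f (Z y)}"
    proof (intro set_eqI iffI)
      fix y assume y: "y \<in> Z -` U \<inter> space N"
      then obtain r where r: "0 < r" "mball (Z y) r \<subseteq> U" using U by (auto simp: openin_mtopology)
      have "r \<le> f (Z y)" unfolding f_def inf_conv_def
      proof (rule cINF_greatest[OF A(1)])
        fix z assume z: "z \<in> A"
        then have "z \<notin> mball (Z y) r" using r by (auto simp: A_def)
        then show "r \<le> 0 + 1 * d (Z y) z" using Z y z A(2) by auto
      qed
      then show "y \<in> {y \<in> space N. 0 < f (Z y)}" using r y by auto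
    next
      fix y assume y: "y \<in> {y \<in> space N. 0 < f (Z y)}"
      have "Z y \<in> U"
      proof (rule ccontr)
        assume "Z y \<notin> U"
        then have "Z y \<in> A" using Z y by (auto simp: A_def)
        then have "f (Z y) \<le> 0 + 1 * d (Z y) (Z y)" unfolding f_def by (intro inf_conv_le) auto
        then show False using y Z by auto
      qed
      then show "y \<in> Z -` U \<inter> space N" using y by auto
    qed
    ultimately show ?thesis by simp
  qed
qed (use Z in simp)

text \<open>
  A bounded continuous function is the increasing pointwise limit of its Lipschitz minorants
  \<open>inf_conv M f m\<close>. Convergence of the integrals of Lipschitz functions therefore gives a lower
  bound for the integrals of \<open>f\<close> in the limit, and the same bound for \<open>- f\<close> is the upper one.
\<close>

lemma Lipschitz_lower_bound:
  assumes N: "prob_space N" and Q: "prob_space Q" and ne: "M \<noteq> {}"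
    and V: "\<And>n. V n \<in> measurable N (borel_of mtopology)" and Z: "Z \<in> measurable Q (borel_of mtopology)"
    and lip: "\<And>f L B. 0 \<le> L \<Longrightarrow> (\<And>x. x \<in> M \<Longrightarrow> \<bar>f x\<bar> \<le> B) \<Longrightarrow>
      (\<And>x y. x \<in> M \<Longrightarrow> y \<in> M \<Longrightarrow> \<bar>f x - f y\<bar> \<le> L * d x y) \<Longrightarrow>
      (\<lambda>n. \<integral>y. f (V n y) \<partial>N) \<longlonglongrightarrow> (\<integral>\<omega>. f (Z \<omega>) \<partial>Q)"
    and f: "continuous_map mtopology euclideanreal f" and B: "\<And>x. x \<in> M \<Longrightarrow> 0 \<le> f x \<and> f x \<le> B" and e: "0 < e"
  shows "\<forall>\<^sub>F n in sequentially. (\<integral>\<omega>. f (Z \<omega>) \<partial>Q) - e < (\<integral>y. f (V n y) \<partial>N)"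
proof -
  interpret N: prob_space N by fact
  interpret Q: prob_space Q by fact
  have VM: "V n y \<in> M" if "y \<in> space N" for n y
    using measurable_space[OF V that, of n] by (simp add: borel_of_def space_measure_of_conv)
  have ZM: "Z \<omega> \<in> M" if "\<omega> \<in> space Q" for \<omega>
    using measurable_space[OF Z that] by (simp add: borel_of_def space_measure_of_conv)
  define F where "F = (\<lambda>m::nat. inf_conv M f (real m))"
  have F0: "0 \<le> F m x" for m x unfolding F_def using B ne by (intro inf_conv_nonneg) auto
  have Ff: "F m x \<le> f x" if "x \<in> M" for m x
    unfolding F_def using inf_conv_le[of M f "real m" x x] B that by simp
  have FL: "\<bar>F m x - F m y\<bar> \<le> real m * d x y" if "x \<in> M" "y \<in> M" for m x y
    unfolding F_def using B ne that by (intro inf_conv_Lipschitz) auto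
  have FB: "\<bar>F m x\<bar> \<le> B" if "x \<in> M" for m x
    using F0[of m x] Ff[OF that, of m] B[OF that] by linarith
  have Fc: "continuous_map mtopology euclideanreal (F m)" for m by (rule continuous_map_Lipschitz[OF FL])
  note mV = measurable_compose[OF V measurable_borel_of_continuous]
  note mZ = measurable_compose[OF Z measurable_borel_of_continuous]
  have F_lim: "(\<lambda>m. F m x) \<longlonglongrightarrow> f x" if x: "x \<in> M" for x
  proof (rule LIMSEQ_I)
    fix r :: real assume r: "0 < r"
    have "openin mtopology {y \<in> topspace mtopology. f y \<in> ball (f x) (r / 2)}"
      by (rule openin_continuous_map_preimage[OF f]) simp
    then obtain \<delta> where \<delta>: "0 < \<delta>" "mball x \<delta> \<subseteq> {y \<in> topspace mtopology. f y \<in> ball (f x) (r / 2)}"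
      using x r unfolding openin_mtopology by auto
    obtain K :: nat where K: "B / \<delta> \<le> real K" using real_arch_simple by blast
    have "norm (F m x - f x) < r" if m: "m \<ge> K" for m
    proof -
      have "f x - r / 2 \<le> F m x"
        unfolding F_def inf_conv_def
      proof (rule cINF_greatest[OF ne])
        fix y assume y: "y \<in> M"
        show "f x - r / 2 \<le> f y + real m * d x y"
        proof (cases "d x y < \<delta>")
          case True
          then have "f y \<in> ball (f x) (r / 2)" using \<delta> x y by auto
          then have "\<bar>f x - f y\<bar> < r / 2" by (simp add: dist_real_def)
          then have "f x - r / 2 < f y" by linarith
          moreover have "0 \<le> real m * d x y" by simp
          ultimately show ?thesis by linarith
        next
          case False
          have "B \<le> real K * \<delta>" using K \<delta> by (simp add: pos_divide_le_eq)
          also have "\<dots> \<le> real m * d x y" using m False \<delta> by (intro mult_mono) auto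
          finally show ?thesis using B[OF x] B[OF y] r by linarith
        qed
      qed
      then show ?thesis using Ff[OF x, of m] r by simp
    qed
    then show "\<exists>K. \<forall>m\<ge>K. norm (F m x - f x) < r" by blast
  qed
  have "(\<lambda>m. \<integral>\<omega>. F m (Z \<omega>) \<partial>Q) \<longlonglongrightarrow> (\<integral>\<omega>. f (Z \<omega>) \<partial>Q)"
  proof (rule integral_dominated_convergence[where w = "\<lambda>_. B"])
    show "AE \<omega> in Q. (\<lambda>m. F m (Z \<omega>)) \<longlonglongrightarrow> f (Z \<omega>)" using F_lim ZM by (intro AE_I2) auto
    show "AE \<omega> in Q. norm (F m (Z \<omega>)) \<le> B" for m using FB ZM by (intro AE_I2) auto
  qed (use mZ[OF f] mZ[OF Fc] in auto)
  from order_tendstoD(1)[OF this, of "(\<integral>\<omega>. f (Z \<omega>) \<partial>Q) - e / 2"] e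
  obtain m where m: "(\<integral>\<omega>. f (Z \<omega>) \<partial>Q) - e / 2 < (\<integral>\<omega>. F m (Z \<omega>) \<partial>Q)"
    by (auto simp: eventually_sequentially)
  have "(\<lambda>n. \<integral>y. F m (V n y) \<partial>N) \<longlonglongrightarrow> (\<integral>\<omega>. F m (Z \<omega>) \<partial>Q)"
    by (rule lip[OF _ FB FL]) auto
  from order_tendstoD(1)[OF this, of "(\<integral>\<omega>. F m (Z \<omega>) \<partial>Q) - e / 2"] e
  have "\<forall>\<^sub>F n in sequentially. (\<integral>\<omega>. F m (Z \<omega>) \<partial>Q) - e / 2 < (\<integral>y. F m (V n y) \<partial>N)" by simp
  then show ?thesis
  proof eventually_elim
    case (elim n)
    have "integrable N (\<lambda>y. F m (V n y))" "integrable N (\<lambda>y. f (V n y))"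
      using FB B VM by (intro N.integrable_const_bound[where B = B] AE_I2 mV Fc f; force)+
    then have "(\<integral>y. F m (V n y) \<partial>N) \<le> (\<integral>y. f (V n y) \<partial>N)"
      using Ff VM by (intro integral_mono) auto
    then show ?case using elim m by linarith
  qed
qed

lemma weak_conv_on_Lipschitz:
  assumes N: "prob_space N" and Q: "prob_space Q" and ne: "M \<noteq> {}"
    and V: "\<And>n. V n \<in> measurable N (borel_of mtopology)" and Z: "Z \<in> measurable Q (borel_of mtopology)"
    and lip: "\<And>f L B. 0 \<le> L \<Longrightarrow> (\<And>x. x \<in> M \<Longrightarrow> \<bar>f x\<bar> \<le> B) \<Longrightarrow>
      (\<And>x y. x \<in> M \<Longrightarrow> y \<in> M \<Longrightarrow> \<bar>f x - f y\<bar> \<le> L * d x y) \<Longrightarrow>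
      (\<lambda>n. \<integral>y. f (V n y) \<partial>N) \<longlonglongrightarrow> (\<integral>\<omega>. f (Z \<omega>) \<partial>Q)"
  shows "weak_conv_on mtopology (\<lambda>n. distr N (borel_of mtopology) (V n)) (distr Q (borel_of mtopology) Z)"
  unfolding weak_conv_on_def
proof (intro allI impI, elim conjE)
  fix f assume f: "continuous_map mtopology euclideanreal f" and "bounded (f ` topspace mtopology)"
  then obtain B where B: "\<And>x. x \<in> M \<Longrightarrow> \<bar>f x\<bar> \<le> B" by (auto simp: bounded_iff)
  interpret N: prob_space N by fact
  interpret Q: prob_space Q by fact
  have fm: "f \<in> borel_measurable (borel_of mtopology)" by (rule measurable_borel_of_continuous[OF f])
  have VM: "V n y \<in> M" if "y \<in> space N" for n y
    using measurable_space[OF V that, of n] by (simp add: borel_of_def space_measure_of_conv)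
  have ZM: "Z \<omega> \<in> M" if "\<omega> \<in> space Q" for \<omega>
    using measurable_space[OF Z that] by (simp add: borel_of_def space_measure_of_conv)
  have intV: "integrable N (\<lambda>y. f (V n y))" for n
    using B VM by (intro N.integrable_const_bound[where B = B] AE_I2 measurable_compose[OF V fm]) auto
  have intZ: "integrable Q (\<lambda>\<omega>. f (Z \<omega>))"
    using B ZM by (intro Q.integrable_const_bound[where B = B] AE_I2 measurable_compose[OF Z fm]) auto
  have "(\<lambda>n. \<integral>y. f (V n y) \<partial>N) \<longlonglongrightarrow> (\<integral>\<omega>. f (Z \<omega>) \<partial>Q)"
  proof (rule LIMSEQ_I)
    fix e :: real assume e: "0 < e"
    have low: "\<forall>\<^sub>F n in sequentially. (\<integral>\<omega>. g (Z \<omega>) \<partial>Q) - e < (\<integral>y. g (V n y) \<partial>N)"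
      if "continuous_map mtopology euclideanreal g" "\<And>x. x \<in> M \<Longrightarrow> 0 \<le> g x \<and> g x \<le> 2 * B" for g
    proof (rule Lipschitz_lower_bound[OF N Q ne V Z _ that(1) _ e])
      fix f L B assume "0 \<le> L" "\<And>x. x \<in> M \<Longrightarrow> \<bar>f x\<bar> \<le> B"
        "\<And>x y. x \<in> M \<Longrightarrow> y \<in> M \<Longrightarrow> \<bar>f x - f y\<bar> \<le> L * d x y"
      then show "(\<lambda>n. \<integral>y. f (V n y) \<partial>N) \<longlonglongrightarrow> (\<integral>\<omega>. f (Z \<omega>) \<partial>Q)" by (rule lip)
    qed (use that in auto)
    have "\<forall>\<^sub>F n in sequentially. (\<integral>\<omega>. f (Z \<omega>) + B \<partial>Q) - e < (\<integral>y. f (V n y) + B \<partial>N)"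
      "\<forall>\<^sub>F n in sequentially. (\<integral>\<omega>. B - f (Z \<omega>) \<partial>Q) - e < (\<integral>y. B - f (V n y) \<partial>N)"
      using B by (intro low continuous_intros f; force simp: abs_le_iff)+
    then have "\<forall>\<^sub>F n in sequentially. norm ((\<integral>y. f (V n y) \<partial>N) - (\<integral>\<omega>. f (Z \<omega>) \<partial>Q)) < e"
      by eventually_elim (use intV intZ in \<open>simp add: N.prob_space Q.prob_space abs_less_iff\<close>)
    then show "\<exists>K. \<forall>n\<ge>K. norm ((\<integral>y. f (V n y) \<partial>N) - (\<integral>\<omega>. f (Z \<omega>) \<partial>Q)) < e"
      by (simp only: eventually_sequentially)
  qed
  then show "(\<lambda>n. \<integral>x. f x \<partial>distr N (borel_of mtopology) (V n)) \<longlonglongrightarrow> (\<integral>x. f x \<partial>distr Q (borel_of mtopology) Z)"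
    using V Z fm by (simp add: integral_distr)
qed

end

section \<open>Step functions and continuous functions in the Skorohod space\<close>

interpretation Skorohod: Metric_space skorohod_space skorohod_dist
  by (rule Metric_space_skorohod)

definition step_path :: "nat \<Rightarrow> (nat \<Rightarrow> real) \<Rightarrow> real \<Rightarrow> real" where
  "step_path k v = (\<lambda>t\<in>{0..1}. v (nat \<lfloor>real k * t\<rfloor>))"

lemma step_path_in_skorohod: "step_path k v \<in> skorohod_space"
proof -
  have "(step_path k v \<longlongrightarrow> step_path k v t) (at t within {t<..1}) \<and>
      (\<exists>l. (step_path k v \<longlongrightarrow> l) (at t within {0..<t}))" if t: "t \<in> {0..1}" for t
  proof (cases "k = 0")
    case True
    then show ?thesis
      using t by (auto simp: step_path_def eventually_at_filter intro!: tendsto_eventually exI[of _ "v 0"])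
  next
    case False
    then have k: "0 < real k" by simp
    define d where "d = (of_int \<lfloor>real k * t\<rfloor> + 1 - real k * t) / real k"
    have "0 < d" unfolding d_def using k by (intro divide_pos_pos) linarith+
    moreover have "\<lfloor>real k * s\<rfloor> = \<lfloor>real k * t\<rfloor>" if s: "t < s" "s - t < d" for s
    proof -
      have "real k * (s - t) < of_int \<lfloor>real k * t\<rfloor> + 1 - real k * t"
        using s(2) k by (simp add: d_def pos_less_divide_eq mult.commute)
      moreover have "0 < real k * (s - t)" using s k by simp
      ultimately show ?thesis by (simp add: right_diff_distrib) linarith
    qed
    ultimately have "\<forall>\<^sub>F s in at t within {t<..1}. step_path k v s = step_path k v t"
      unfolding eventually_at using t by (intro exI[of _ d]) (auto simp: step_path_def dist_real_def)
    then have right: "(step_path k v \<longlongrightarrow> step_path k v t) (at t within {t<..1})" by (rule tendsto_eventually)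
    define d' where "d' = (real k * t - of_int (\<lceil>real k * t\<rceil> - 1)) / real k"
    \<comment> \<open>Approaching \<open>t\<close> from the left, the index settles at the largest integer below \<open>k t\<close>.\<close>
    have "0 < d'" unfolding d'_def using k by (intro divide_pos_pos) linarith+
    moreover have "\<lfloor>real k * s\<rfloor> = \<lceil>real k * t\<rceil> - 1" if s: "s < t" "t - s < d'" for s
    proof -
      have "real k * (t - s) < real k * t - of_int (\<lceil>real k * t\<rceil> - 1)"
        using s(2) k by (simp add: d'_def pos_less_divide_eq mult.commute)
      moreover have "0 < real k * (t - s)" using s k by simp
      ultimately show ?thesis by (simp add: right_diff_distrib) linarith
    qed
    ultimately have "\<forall>\<^sub>F s in at t within {0..<t}. step_path k v s = v (nat (\<lceil>real k * t\<rceil> - 1))"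
      unfolding eventually_at using t by (intro exI[of _ d']) (auto simp: step_path_def dist_real_def)
    then have "(step_path k v \<longlongrightarrow> v (nat (\<lceil>real k * t\<rceil> - 1))) (at t within {0..<t})" by (rule tendsto_eventually)
    with right show ?thesis by blast
  qed
  then show ?thesis by (auto simp: skorohod_space_def step_path_def)
qed

lemma continuous_in_skorohod:
  assumes w: "continuous_on {0..1} w" shows "restrict w {0..1} \<in> skorohod_space"
proof -
  have lim: "(restrict w {0..1} \<longlongrightarrow> w t) (at t within S)" if t: "t \<in> {0..1}" and S: "S \<subseteq> {0..1}" for t S
  proof -
    have "(w \<longlongrightarrow> w t) (at t within S)"
      using w t S tendsto_within_subset unfolding continuous_on_def by blast
    moreover have "\<forall>\<^sub>F s in at t within S. w s = restrict w {0..1} s"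
      unfolding eventually_at_filter by (intro always_eventually) (use S in auto)
    ultimately show ?thesis by (rule Lim_transform_eventually)
  qed
  have "(restrict w {0..1} \<longlongrightarrow> restrict w {0..1} t) (at t within {t<..1}) \<and>
      (\<exists>l. (restrict w {0..1} \<longlongrightarrow> l) (at t within {0..<t}))" if t: "t \<in> {0..1}" for t
    using lim[OF t, of "{t<..1}"] lim[OF t, of "{0..<t}"] t by (auto simp: subset_eq)
  then show ?thesis by (simp add: skorohod_space_def)
qed

lemma skorohod_dist_le_uniform:
  assumes "x \<in> skorohod_space" "y \<in> skorohod_space" "0 < e" "\<And>t. t \<in> {0..1} \<Longrightarrow> \<bar>x t - y t\<bar> \<le> e"
  shows "skorohod_dist x y \<le> e"
  using assms time_changes_id
  by (intro skorohod_dist_le) (auto simp: skorohod_within_def intro!: bexI[of _ "\<lambda>t. t"])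

lemma nat_floor_le:
  assumes "t \<in> {0..1}" shows "nat \<lfloor>real k * t\<rfloor> \<le> k"
proof -
  have "real k * t \<le> real k" using assms by (simp add: mult_left_le)
  then show ?thesis by linarith
qed

text \<open>
  On \<open>[0,1]\<close> a step path depends on \<open>k + 1\<close> coordinates only, and uniformly close paths are close in the
  Skorohod metric. This reduces measurability questions to those of real random variables.
\<close>

lemma continuous_map_step_path: "continuous_map euclidean skorohod_topology (step_path k)"
  unfolding continuous_map_def
proof (intro conjI allI impI)
  fix U assume U: "openin skorohod_topology U"
  have "open {v. step_path k v \<in> U}"
  proof (subst open_subopen, intro ballI)
    fix v assume "v \<in> {v. step_path k v \<in> U}"
    then have "step_path k v \<in> U" by simp
    then obtain r where r: "0 < r" "Skorohod.mball (step_path k v) r \<subseteq> U"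
      using U unfolding skorohod_topology_def Skorohod.openin_mtopology by blast
    define N where "N = {u. \<forall>i\<in>{..k}. u i \<in> ball (v i) (r / 2)}"
    have "open N" unfolding N_def using product_topology_basis'[of "{..k}" "\<lambda>i. ball (v i) (r / 2)" "\<lambda>i. i"] by simp
    moreover have "v \<in> N" using r by (simp add: N_def)
    moreover have "N \<subseteq> {v. step_path k v \<in> U}"
    proof
      fix u assume u: "u \<in> N"
      have "skorohod_dist (step_path k v) (step_path k u) \<le> r / 2"
      proof (rule skorohod_dist_le_uniform[OF step_path_in_skorohod step_path_in_skorohod])
        fix t :: real assume t: "t \<in> {0..1}"
        have "dist (v (nat \<lfloor>real k * t\<rfloor>)) (u (nat \<lfloor>real k * t\<rfloor>)) < r / 2"
          using u nat_floor_le[OF t, of k] by (auto simp: N_def)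
        then show "\<bar>step_path k v t - step_path k u t\<bar> \<le> r / 2" using t by (simp add: step_path_def dist_real_def)
      qed (use r in simp)
      then have "step_path k u \<in> Skorohod.mball (step_path k v) r" using r by (simp add: step_path_in_skorohod)
      then show "u \<in> {v. step_path k v \<in> U}" using r by auto
    qed
    ultimately show "\<exists>N. open N \<and> v \<in> N \<and> N \<subseteq> {v. step_path k v \<in> U}" by blast
  qed
  then show "openin euclidean {x \<in> topspace euclidean. step_path k x \<in> U}" by simp
qed (simp add: step_path_in_skorohod)

lemma measurable_step_path:
  assumes v: "\<And>j. v j \<in> borel_measurable M"
  shows "(\<lambda>y. step_path k (\<lambda>j. v j y)) \<in> measurable M (borel_of skorohod_topology)"
proof (rule measurable_borel_ofI)
  fix U assume U: "openin skorohod_topology U"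
  have "open {v. step_path k v \<in> U}"
    using openin_continuous_map_preimage[OF continuous_map_step_path U, of k] by simp
  moreover have "(\<lambda>y j. v j y) \<in> borel_measurable M" by (rule measurable_coordinatewise_then_product) (rule v)
  ultimately have "(\<lambda>y j. v j y) -` {v. step_path k v \<in> U} \<inter> space M \<in> sets M"
    by (intro measurable_sets) auto
  then show "(\<lambda>y. step_path k (\<lambda>j. v j y)) -` U \<inter> space M \<in> sets M" by (simp add: vimage_def)
qed (simp add: step_path_in_skorohod)

lemma step_path_tendsto_continuous:
  assumes w: "continuous_on {0..1} w"
  shows "(\<lambda>k. skorohod_dist (step_path (Suc k) (\<lambda>j. w (min 1 (real j / real (Suc k))))) (restrict w {0..1})) \<longlonglongrightarrow> 0"
proof (rule LIMSEQ_I)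
  fix e :: real assume e: "0 < e"
  have "uniformly_continuous_on {0..1} w" using w by (rule compact_uniformly_continuous) simp
  then obtain d where d: "0 < d"
    "\<And>s t. s \<in> {0..1} \<Longrightarrow> t \<in> {0..1} \<Longrightarrow> dist s t < d \<Longrightarrow> dist (w s) (w t) < e / 2"
    unfolding uniformly_continuous_on_def using e by (metis half_gt_zero)
  obtain K :: nat where K: "1 / d < real K" using reals_Archimedean2 by blast
  have "skorohod_dist (step_path (Suc k) (\<lambda>j. w (min 1 (real j / real (Suc k))))) (restrict w {0..1}) \<le> e / 2"
    if k: "k \<ge> K" for k
  proof (rule skorohod_dist_le_uniform[OF step_path_in_skorohod continuous_in_skorohod[OF w]])
    fix t :: real assume t: "t \<in> {0..1}"
    define j where "j = nat \<lfloor>real (Suc k) * t\<rfloor>"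
    have k0: "0 < real (Suc k)" by simp
    have j: "real j \<le> real (Suc k) * t" "real (Suc k) * t < real j + 1"
      unfolding j_def using t by (auto simp: of_nat_nat)
    have j1: "real j / real (Suc k) \<le> t" using j(1) k0 by (simp add: pos_divide_le_eq mult.commute)
    have "1 < d * real K" using K d by (simp add: pos_divide_less_eq mult.commute)
    also have "\<dots> \<le> d * real (Suc k)" using d k by (intro mult_left_mono) auto
    finally have "real (Suc k) * t - real j < d * real (Suc k)" using j(2) by linarith
    moreover have "(t - real j / c) * c = c * t - real j" if "0 < c" for c
      using that by (simp add: field_simps)
    ultimately have "(t - real j / real (Suc k)) * real (Suc k) < d * real (Suc k)" using k0 by simp
    then have "t - real j / real (Suc k) < d" by (simp only: mult_less_cancel_right_pos[OF k0])
    then have "dist (real j / real (Suc k)) t < d" using j1 by (simp add: dist_real_def del: of_nat_Suc)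
    moreover have s01: "real j / real (Suc k) \<le> 1" using order_trans[OF j1, of 1] t by auto
    moreover have "0 \<le> real j / real (Suc k)" by simp
    ultimately have "dist (w (real j / real (Suc k))) (w t) < e / 2"
      using d(2)[OF _ t] unfolding atLeastAtMost_iff by blast
    then have "dist (w (min 1 (real j / real (Suc k)))) (w t) < e / 2" by (simp only: min_absorb2[OF s01])
    then show "\<bar>step_path (Suc k) (\<lambda>j. w (min 1 (real j / real (Suc k)))) t - restrict w {0..1} t\<bar> \<le> e / 2"
      using t by (simp add: step_path_def dist_real_def j_def)
  qed (use e in simp)
  then show "\<exists>K. \<forall>k\<ge>K. norm (skorohod_dist (step_path (Suc k) (\<lambda>j. w (min 1 (real j / real (Suc k)))))
      (restrict w {0..1}) - 0) < e"
    using e by (intro exI[of _ K]) (force simp: abs_of_nonneg)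
qed

text \<open>
  A continuous path is the uniform limit of its step approximations, which are measurable.
\<close>

lemma measurable_continuous_process:
  assumes W: "\<And>t. t \<in> {0..1} \<Longrightarrow> W t \<in> borel_measurable Q"
    and cont: "\<And>\<omega>. \<omega> \<in> space Q \<Longrightarrow> continuous_on {0..1} (\<lambda>t. W t \<omega>)"
  shows "(\<lambda>\<omega>. \<lambda>t\<in>{0..1}. W t \<omega>) \<in> measurable Q (borel_of skorohod_topology)"
  unfolding skorohod_topology_def
proof (rule Skorohod.measurable_mtopology_limit
    [where V = "\<lambda>k \<omega>. step_path (Suc k) (\<lambda>j. W (min 1 (real j / real (Suc k))) \<omega>)"])
  show "(\<lambda>\<omega>. step_path (Suc k) (\<lambda>j. W (min 1 (real j / real (Suc k))) \<omega>))
      \<in> measurable Q (borel_of Skorohod.mtopology)" for k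
    unfolding skorohod_topology_def[symmetric] by (intro measurable_step_path W) auto
qed (use step_path_tendsto_continuous[OF cont] continuous_in_skorohod[OF cont] step_path_in_skorohod in auto)

section \<open>The limit process\<close>

context prob_space
begin

lemma normal_char:
  assumes X: "distributed M lborel X (normal_density 0 \<sigma>)" and \<sigma>: "0 < \<sigma>"
  shows "(\<integral>y. exp (\<i> * complex_of_real (t * X y)) \<partial>M) = complex_of_real (exp (- (t * \<sigma>)\<^sup>2 / 2))"
proof -
  have [measurable]: "X \<in> borel_measurable M" using distributed_measurable[OF X] by simp
  have "distributed M lborel (\<lambda>y. (X y - 0) / \<sigma>) std_normal_density"
    using normal_standard_normal_convert[OF \<sigma>, where X = X and \<mu> = 0] X by simp
  then have "distr M lborel (\<lambda>y. X y / \<sigma>) = std_normal_distribution"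
    using distributed_distr_eq_density by fastforce
  then have "(\<integral>x. exp (\<i> * complex_of_real (t * \<sigma> * x)) \<partial>distr M lborel (\<lambda>y. X y / \<sigma>))
      = complex_of_real (exp (- (t * \<sigma>)\<^sup>2 / 2))"
    using char_std_normal_distribution[THEN fun_cong, of "t * \<sigma>"] by (simp add: char_def exp_of_real)
  moreover have "(\<integral>x. exp (\<i> * complex_of_real (t * \<sigma> * x)) \<partial>distr M lborel (\<lambda>y. X y / \<sigma>))
      = (\<integral>y. exp (\<i> * complex_of_real (t * \<sigma> * (X y / \<sigma>))) \<partial>M)"
    by (rule integral_distr) measurable
  ultimately show ?thesis using \<sigma> by simp
qed

lemma char_indep_normal_sum:
  fixes a :: "nat \<Rightarrow> real"
  assumes ind: "indep_vars (\<lambda>_. borel) \<Delta> {..<k}"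
    and \<Delta>: "\<And>j. j < k \<Longrightarrow> distributed M lborel (\<Delta> j) (normal_density 0 \<sigma>)" and \<sigma>: "0 < \<sigma>"
  shows "(\<integral>y. exp (\<i> * complex_of_real (t * (\<Sum>j<k. a j * \<Delta> j y))) \<partial>M)
    = complex_of_real (exp (- (t\<^sup>2 * (\<sigma>\<^sup>2 * (\<Sum>j<k. (a j)\<^sup>2))) / 2))"
proof -
  have [measurable]: "\<Delta> j \<in> borel_measurable M" if "j < k" for j
    using distributed_measurable[OF \<Delta>[OF that]] by simp
  have "indep_vars (\<lambda>_. borel) (\<lambda>j. (\<lambda>x. a j * x) \<circ> \<Delta> j) {..<k}"
    by (rule indep_vars_compose[OF ind]) measurable
  then have ind': "indep_vars (\<lambda>_. borel) (\<lambda>j y. a j * \<Delta> j y) {..<k}" by (simp add: comp_def)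
  have "(\<integral>y. exp (\<i> * complex_of_real (t * (\<Sum>j<k. a j * \<Delta> j y))) \<partial>M)
      = char (distr M borel (\<lambda>y. \<Sum>j<k. a j * \<Delta> j y)) t"
    unfolding char_def by (subst integral_distr) auto
  also have "\<dots> = (\<Prod>j<k. char (distr M borel (\<lambda>y. a j * \<Delta> j y)) t)"
    by (rule char_distr_sum[OF ind'])
  also have "\<dots> = (\<Prod>j<k. complex_of_real (exp (- (t * a j * \<sigma>)\<^sup>2 / 2)))"
  proof (rule prod.cong[OF refl])
    fix j assume "j \<in> {..<k}"
    then have j: "j < k" by simp
    have [measurable]: "\<Delta> j \<in> borel_measurable M" using distributed_measurable[OF \<Delta>[OF j]] by simp
    have "char (distr M borel (\<lambda>y. a j * \<Delta> j y)) t = (\<integral>y. exp (\<i> * complex_of_real (t * (a j * \<Delta> j y))) \<partial>M)"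
      unfolding char_def by (subst integral_distr) auto
    then show "char (distr M borel (\<lambda>y. a j * \<Delta> j y)) t = complex_of_real (exp (- (t * a j * \<sigma>)\<^sup>2 / 2))"
      using normal_char[OF \<Delta>[OF j] \<sigma>, of "t * a j"] by (simp add: mult.assoc)
  qed
  also have "\<dots> = complex_of_real (exp (\<Sum>j<k. - (t * a j * \<sigma>)\<^sup>2 / 2))"
    unfolding of_real_prod[symmetric]
    by (intro arg_cong[where f = complex_of_real] exp_sum[symmetric] finite_lessThan)
  also have "(\<Sum>j<k. - (t * a j * \<sigma>)\<^sup>2 / 2) = - (t\<^sup>2 * (\<sigma>\<^sup>2 * (\<Sum>j<k. (a j)\<^sup>2))) / 2"
    by (simp add: sum_distrib_left sum_divide_distrib[symmetric] sum_negf power_mult_distrib mult_ac)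
  finally show ?thesis .
qed

text \<open>Conditionally on \<open>E\<close> the variable is Gaussian; independence makes this precise through Fubini.\<close>

lemma char_mixture:
  assumes ind: "indep_var borel E borel L"
    and char: "\<And>t. (\<integral>y. exp (\<i> * complex_of_real (t * L y)) \<partial>M) = complex_of_real (\<phi> t)"
    and \<phi> [measurable]: "\<phi> \<in> borel_measurable borel"
  shows "(\<integral>y. exp (\<i> * complex_of_real (sqrt (E y) * L y)) \<partial>M) = (\<integral>e. complex_of_real (\<phi> (sqrt e)) \<partial>distr M borel E)"
proof -
  have [measurable]: "E \<in> borel_measurable M" "L \<in> borel_measurable M"
    using indep_var_rv1[OF ind] indep_var_rv2[OF ind] by auto
  define G :: "real \<times> real \<Rightarrow> complex" where "G = (\<lambda>(e, l). exp (\<i> * complex_of_real (sqrt e * l)))"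
  have G [measurable]: "G \<in> borel_measurable (borel \<Otimes>\<^sub>M borel)" unfolding G_def by measurable
  interpret PE: prob_space "distr M borel E" by (rule prob_space_distr) simp
  interpret PL: prob_space "distr M borel L" by (rule prob_space_distr) simp
  interpret P: pair_prob_space "distr M borel E" "distr M borel L" ..
  have pair: "distr M (borel \<Otimes>\<^sub>M borel) (\<lambda>y. (E y, L y)) = distr M borel E \<Otimes>\<^sub>M distr M borel L"
    using ind by (simp add: indep_var_distribution_eq)
  have "(\<integral>y. exp (\<i> * complex_of_real (sqrt (E y) * L y)) \<partial>M) = (\<integral>x. G x \<partial>distr M (borel \<Otimes>\<^sub>M borel) (\<lambda>y. (E y, L y)))"
    by (subst integral_distr) (auto simp: G_def)
  also have "\<dots> = (\<integral>e. (\<integral>l. G (e, l) \<partial>distr M borel L) \<partial>distr M borel E)"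
    unfolding pair
  proof (rule P.integral_fst'[symmetric], rule P.P.integrable_const_bound[where B = 1])
    show "G \<in> borel_measurable (distr M borel E \<Otimes>\<^sub>M distr M borel L)" by measurable
    show "AE x in distr M borel E \<Otimes>\<^sub>M distr M borel L. norm (G x) \<le> 1"
      by (intro AE_I2) (auto simp: G_def norm_exp_i_times simp del: of_real_mult)
  qed
  also have "(\<lambda>e. \<integral>l. G (e, l) \<partial>distr M borel L) = (\<lambda>e. complex_of_real (\<phi> (sqrt e)))"
  proof
    fix e
    have "(\<integral>l. G (e, l) \<partial>distr M borel L) = (\<integral>y. exp (\<i> * complex_of_real (sqrt e * L y)) \<partial>M)"
      unfolding G_def by (subst integral_distr) auto
    then show "(\<integral>l. G (e, l) \<partial>distr M borel L) = complex_of_real (\<phi> (sqrt e))" using char by simp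
  qed
  finally show ?thesis .
qed

end

lemma indep_var_of_process:
  assumes Q: "prob_space Q" and ind: "indep_of_process Q E w" and E: "E \<in> borel_measurable Q"
    and w: "\<And>t. t \<in> {0..1} \<Longrightarrow> w t \<in> borel_measurable Q"
    and F: "F \<in> borel_measurable (Pi\<^sub>M {0..1} (\<lambda>_. borel))"
    and L: "\<And>\<omega>. \<omega> \<in> space Q \<Longrightarrow> L \<omega> = F (\<lambda>t\<in>{0..1}. w t \<omega>)"
  shows "prob_space.indep_var Q borel E borel (L :: 'b \<Rightarrow> real)"
proof -
  interpret Q: prob_space Q by fact
  define V where "V = vimage_algebra (space Q) (\<lambda>\<omega>. \<lambda>t\<in>{0..1}. w t \<omega>) (Pi\<^sub>M {0..1} (\<lambda>_. borel :: real measure))"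
  have path: "(\<lambda>\<omega>. \<lambda>t\<in>{0..1}. w t \<omega>) \<in> measurable Q (Pi\<^sub>M {0..1} (\<lambda>_. borel))"
    by (rule measurable_restrict) (rule w)
  have LQ: "L \<in> borel_measurable Q"
    by (subst measurable_cong[OF L]) (auto intro: measurable_compose[OF path F])
  have LV: "L \<in> borel_measurable V"
  proof (subst measurable_cong[OF L])
    show "(\<lambda>\<omega>. F (\<lambda>t\<in>{0..1}. w t \<omega>)) \<in> borel_measurable V"
      unfolding V_def by (rule measurable_compose[OF measurable_vimage_algebra1 F]) (auto simp: space_PiM)
  qed (simp add: V_def)
  have "sigma_sets (space Q) {L -` A \<inter> space Q |A. A \<in> sets borel} \<subseteq> sets V"
    using sets.sigma_sets_subset[of "{L -` A \<inter> space Q |A. A \<in> sets borel}" V] measurable_sets[OF LV]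
    by (force simp: V_def)
  then have "Q.indep_set (sets (vimage_algebra (space Q) E borel))
      (sigma_sets (space Q) {L -` A \<inter> space Q |A. A \<in> sets borel})"
    using ind unfolding indep_of_process_def V_def[symmetric] Q.indep_set_def
    by (elim Q.indep_sets_mono_sets) (auto split: bool.split)
  then show ?thesis unfolding Q.indep_var_eq sets_vimage_algebra using E LQ by simp
qed

lemma brownian_mixture_char:
  fixes a :: "nat \<Rightarrow> real"
  assumes w: "standard_brownian_motion Q w" and c: "independent_copy M \<eta> Q E w"
    and \<eta>: "\<eta> \<in> borel_measurable M" "AE y in M. 0 \<le> \<eta> y" and k: "0 < k"
  shows "(\<integral>\<omega>. exp (\<i> * complex_of_real (\<Sum>j<k. a j * (sqrt (E \<omega>) * (w (real (Suc j) / real k) \<omega> - w (real j / real k) \<omega>)))) \<partial>Q)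
    = (\<integral>y. complex_of_real (exp (- (\<eta> y * (\<Sum>j<k. (a j)\<^sup>2) / real k) / 2)) \<partial>M)"
proof -
  interpret Q: prob_space Q using w by (simp add: standard_brownian_motion_def)
  define \<tau> where "\<tau> = (\<lambda>j. real j / real k)"
  define \<Delta> where "\<Delta> = (\<lambda>j \<omega>. w (\<tau> (Suc j)) \<omega> - w (\<tau> j) \<omega>)"
  have \<tau>: "\<tau> j \<in> {0..1}" if "j \<le> k" for j using that k by (simp add: \<tau>_def)
  have wm: "w t \<in> borel_measurable Q" if "t \<in> {0..1}" for t
    using w that by (simp add: standard_brownian_motion_def)
  have ind: "Q.indep_vars (\<lambda>_. borel) \<Delta> {..<k}"
  proof -
    have "\<forall>n (\<tau> :: nat \<Rightarrow> real). 0 \<le> \<tau> 0 \<and> (\<forall>i<n. \<tau> i < \<tau> (Suc i)) \<and> \<tau> n \<le> 1 \<longrightarrow>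
        Q.indep_vars (\<lambda>_. borel) (\<lambda>i \<omega>. w (\<tau> (Suc i)) \<omega> - w (\<tau> i) \<omega>) {..<n}"
      using w by (simp add: standard_brownian_motion_def)
    from this[rule_format, of \<tau> k] show ?thesis
      unfolding \<Delta>_def using k by (simp add: \<tau>_def divide_strict_right_mono)
  qed
  have normal: "distributed Q lborel (\<Delta> j) (normal_density 0 (sqrt (1 / real k)))" if j: "j < k" for j
  proof -
    have "\<tau> (Suc j) - \<tau> j = 1 / real k" by (simp add: \<tau>_def diff_divide_distrib[symmetric])
    moreover have "\<tau> j < \<tau> (Suc j)" using k by (simp add: \<tau>_def divide_strict_right_mono)
    moreover have "0 \<le> \<tau> j" "\<tau> (Suc j) \<le> 1" using \<tau>[of j] \<tau>[of "Suc j"] j by auto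
    ultimately show ?thesis using w unfolding standard_brownian_motion_def \<Delta>_def by metis
  qed
  define L where "L = (\<lambda>\<omega>. \<Sum>j<k. a j * \<Delta> j \<omega>)"
  have E: "E \<in> borel_measurable Q" "distr Q borel E = distr M borel \<eta>" "indep_of_process Q E w"
    using c by (auto simp: independent_copy_def)
  have iEL: "Q.indep_var borel E borel L"
  proof (rule indep_var_of_process[OF Q.prob_space_axioms E(3,1) wm])
    have comp: "(\<lambda>x. x t) \<in> borel_measurable (Pi\<^sub>M {0..1} (\<lambda>_. borel :: real measure))" if "t \<in> {0..1}" for t
      using that by (rule measurable_component_singleton)
    show "(\<lambda>x. \<Sum>j<k. a j * (x (\<tau> (Suc j)) - x (\<tau> j))) \<in> borel_measurable (Pi\<^sub>M {0..1} (\<lambda>_. borel))"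
      by (intro borel_measurable_sum borel_measurable_times borel_measurable_diff borel_measurable_const comp \<tau>) auto
    show "L \<omega> = (\<Sum>j<k. a j * ((\<lambda>t\<in>{0..1}. w t \<omega>) (\<tau> (Suc j)) - (\<lambda>t\<in>{0..1}. w t \<omega>) (\<tau> j)))" for \<omega>
      unfolding L_def \<Delta>_def using \<tau> by (intro sum.cong) (auto simp: less_imp_le Suc_leI)
  qed
  define \<phi> where "\<phi> = (\<lambda>t. exp (- (t\<^sup>2 * ((sqrt (1 / real k))\<^sup>2 * (\<Sum>j<k. (a j)\<^sup>2))) / 2))"
  have [measurable]: "\<phi> \<in> borel_measurable borel" unfolding \<phi>_def by measurable
  have "(\<Sum>j<k. a j * (sqrt (E \<omega>) * (w (real (Suc j) / real k) \<omega> - w (real j / real k) \<omega>))) = sqrt (E \<omega>) * L \<omega>" for \<omega>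
    unfolding L_def \<Delta>_def \<tau>_def sum_distrib_left by (intro sum.cong) auto
  then have "(\<integral>\<omega>. exp (\<i> * complex_of_real (\<Sum>j<k. a j * (sqrt (E \<omega>) * (w (real (Suc j) / real k) \<omega> - w (real j / real k) \<omega>)))) \<partial>Q)
      = (\<integral>\<omega>. exp (\<i> * complex_of_real (sqrt (E \<omega>) * L \<omega>)) \<partial>Q)" by simp
  also have "\<dots> = (\<integral>e. complex_of_real (\<phi> (sqrt e)) \<partial>distr Q borel E)"
    using Q.char_indep_normal_sum[OF ind normal] k unfolding L_def[symmetric] \<phi>_def[symmetric]
    by (intro Q.char_mixture[OF iEL]) (auto simp: L_def \<phi>_def)
  also have "\<dots> = (\<integral>y. complex_of_real (\<phi> (sqrt (\<eta> y))) \<partial>M)"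
    unfolding E(2) using \<eta>(1) by (subst integral_distr) auto
  also have "\<dots> = (\<integral>y. complex_of_real (exp (- (\<eta> y * (\<Sum>j<k. (a j)\<^sup>2) / real k) / 2)) \<partial>M)"
  proof (rule integral_cong_AE)
    show "AE y in M. complex_of_real (\<phi> (sqrt (\<eta> y))) = complex_of_real (exp (- (\<eta> y * (\<Sum>j<k. (a j)\<^sup>2) / real k) / 2))"
      using \<eta>(2) by eventually_elim (simp add: \<phi>_def)
  qed (use \<eta>(1) in measurable)
  finally show ?thesis .
qed

section \<open>Bounded martingale differences suffice\<close>

context prob_space
begin

text \<open>
  Testing the relation against the indicator of the set where \<open>u\<close> exceeds \<open>K\<close> shows that the excess
  has nonpositive integral.
\<close>

lemma is_transfer_bounded_above:
  assumes T: "measure_preserving_map M T" and f: "f \<in> borel_measurable M" "\<And>y. \<bar>f y\<bar> \<le> K" and u: "is_transfer M T f u"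
  shows "AE y in M. u y \<le> K"
proof -
  note [measurable] = f(1) measurable_measure_preserving[OF T]
  have uint: "integrable M u" using u by (rule integrable_is_transfer)
  then have [measurable]: "u \<in> borel_measurable M" by auto
  define g where "g = (\<lambda>y. if K < u y then 1 else 0 :: real)"
  have [measurable]: "g \<in> borel_measurable M" unfolding g_def by measurable
  have g1: "\<bar>g y\<bar> \<le> 1" "0 \<le> g y" for y by (auto simp: g_def)
  have gint: "integrable M g" "integrable M (\<lambda>y. g (T y))"
    using g1 by (intro integrable_bounded[where B = 1]; auto)+
  have K0: "0 \<le> K" using f(2)[of undefined] by simp
  have fg: "integrable M (\<lambda>y. f y * g (T y))"
    using f(2) g1 K0 by (intro integrable_bounded[where B = "K * 1"]) (auto simp only: abs_mult intro!: mult_mono, measurable)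
  have ug: "integrable M (\<lambda>y. u y * g y)"
    by (rule integrable_mult_ess_bounded[OF uint, where C = 1]) (use g1 in auto)
  have pos: "0 \<le> (u y - K) * g y" for y by (simp add: g_def)
  have "(\<integral>y. (u y - K) * g y \<partial>M) = (\<integral>y. u y * g y \<partial>M) - K * (\<integral>y. g y \<partial>M)"
    unfolding left_diff_distrib using ug gint by simp
  also have "\<dots> = (\<integral>y. f y * g (T y) \<partial>M) - K * (\<integral>y. g (T y) \<partial>M)"
    using is_transferD[OF u, of g 1] g1 integral_measure_preserving[OF T, of g] by simp
  also have "\<dots> = (\<integral>y. (f y - K) * g (T y) \<partial>M)"
    unfolding left_diff_distrib using fg gint by simp
  also have "\<dots> \<le> 0"
  proof -
    have "(f y - K) * g (T y) \<le> 0" for y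
      using f(2)[of y] g1(2)[of "T y"] by (intro mult_nonpos_nonneg) auto
    moreover have "integrable M (\<lambda>y. (f y - K) * g (T y))" unfolding left_diff_distrib using fg gint by simp
    ultimately have "(\<integral>y. (f y - K) * g (T y) \<partial>M) \<le> (\<integral>y. 0 \<partial>M)" by (intro integral_mono) auto
    then show ?thesis by simp
  qed
  finally have "(\<integral>y. (u y - K) * g y \<partial>M) = 0"
    using pos by (intro antisym integral_nonneg_AE AE_I2)
  moreover have "integrable M (\<lambda>y. (u y - K) * g y)"
    unfolding left_diff_distrib using ug gint by simp
  ultimately have "AE y in M. (u y - K) * g y = 0"
    using pos by (subst (asm) integral_nonneg_eq_0_iff_AE) auto
  then show ?thesis by eventually_elim (auto simp: g_def split: if_splits)
qed

text \<open>
  Truncating \<open>h\<close> destroys the martingale property; subtracting the predictable part \<open>u \<circ> T\<close> of the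
  truncation \<open>t\<close> restores it. Since \<open>h\<close> transfers to zero, \<open>u\<close> is also the transfer of \<open>t - h\<close> and
  therefore small.
\<close>

lemma bounded_martingale_approximation:
  assumes T: "measure_preserving_map M T" and h: "h \<in> L2_space M" and h0: "is_transfer M T h (\<lambda>_. 0)" and d: "0 < \<delta>"
  obtains m K where "m \<in> borel_measurable M" "\<And>y. \<bar>m y\<bar> \<le> K" "is_transfer M T m (\<lambda>_. 0)"
    "L2_norm M (\<lambda>y. h y - m y) \<le> \<delta>"
proof -
  note Tm [measurable] = measurable_measure_preserving[OF T]
  note hm [measurable] = L2_measurable[OF h]
  obtain k where k: "L2_norm M (\<lambda>y. h y - h y * indicator {y. \<bar>h y\<bar> \<le> real k} y) < \<delta> / 2"
    using order_tendstoD(2)[OF L2_truncation[OF h], of "\<delta> / 2"] d by (auto simp: eventually_sequentially)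
  define t where "t = (\<lambda>y. h y * indicator {y. \<bar>h y\<bar> \<le> real k} y)"
  have tm [measurable]: "t \<in> borel_measurable M" unfolding t_def by measurable
  have tk: "\<bar>t y\<bar> \<le> real k" for y by (auto simp: t_def indicator_def)
  have tint: "integrable M t" using tk by (intro integrable_bounded) auto
  have tL2: "t \<in> L2_space M" using tk by (intro L2_bounded) auto
  obtain v where v: "is_transfer M T t v" using is_transfer_exists[OF prob_space_axioms T tint] by blast
  have [measurable]: "v \<in> borel_measurable M" using integrable_is_transfer[OF v] by auto
  have v': "is_transfer M T (\<lambda>y. - t y) (\<lambda>y. - v y)" using is_transfer_cmult[OF v, of "-1"] by simp
  have bd: "AE y in M. v y \<le> real k" "AE y in M. - v y \<le> real k"
    using is_transfer_bounded_above[OF T tm tk v] is_transfer_bounded_above[OF T _ _ v', of "real k"] tk by auto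
  \<comment> \<open>A version that is bounded everywhere, not only almost everywhere.\<close>
  define u where "u = (\<lambda>y. max (- real k) (min (real k) (v y)))"
  have um [measurable]: "u \<in> borel_measurable M" unfolding u_def by measurable
  have u: "is_transfer M T t u"
    by (rule is_transfer_cong_AE[OF v _ um]) (use bd in eventually_elim, auto simp: u_def)
  have uk: "\<bar>u y\<bar> \<le> real k" for y by (auto simp: u_def)
  have dL2: "(\<lambda>y. t y - h y) \<in> L2_space M" by (rule L2_diff[OF tL2 h])
  have ud: "is_transfer M T (\<lambda>y. t y - h y) u"
    using is_transfer_diff[OF T tint L2_integrable[OF h] u h0] by simp
  have nd: "L2_norm M (\<lambda>y. t y - h y) < \<delta> / 2"
    using k L2_norm_cmult[of M "-1" "\<lambda>y. h y - t y"] by (simp add: t_def)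
  note uL2 = is_transfer_L2[OF T dL2 ud]
  define m where "m = (\<lambda>y. t y - u (T y))"
  show ?thesis
  proof (rule that)
    show "m \<in> borel_measurable M" unfolding m_def by measurable
    show "\<bar>m y\<bar> \<le> 2 * real k" for y using tk[of y] uk[of "T y"] unfolding m_def by linarith
    show "is_transfer M T m (\<lambda>_. 0)" unfolding m_def by (rule martingale_part[OF T tint u])
    have "L2_norm M (\<lambda>y. h y - m y) = L2_norm M (\<lambda>y. u (T y) - (t y - h y))"
      by (simp add: m_def algebra_simps)
    also have "\<dots> \<le> L2_norm M (\<lambda>y. u (T y)) + L2_norm M (\<lambda>y. t y - h y)"
      by (rule L2_norm_triangle_diff[OF L2_measure_preserving[OF T uL2(1)] dL2])
    also have "\<dots> \<le> \<delta>" using uL2(2) nd L2_norm_measure_preserving[OF T um] by simp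
    finally show "L2_norm M (\<lambda>y. h y - m y) \<le> \<delta>" .
  qed
qed

end

section \<open>Finite-dimensional distributions\<close>

text \<open>
  The number of steps of the orbit up to time \<open>j / k\<close> for the process indexed by \<open>n\<close>.
\<close>

definition grid :: "nat \<Rightarrow> nat \<Rightarrow> nat \<Rightarrow> nat" where
  "grid n k j = nat \<lfloor>real n * (real j / real k)\<rfloor>"

lemma grid_0 [simp]: "grid n k 0 = 0"
  by (simp add: grid_def)

lemma grid_top: "0 < k \<Longrightarrow> grid n k k = n"
  by (simp add: grid_def)

lemma grid_mono: "i \<le> j \<Longrightarrow> grid n k i \<le> grid n k j"
  unfolding grid_def by (intro nat_mono floor_mono mult_left_mono divide_right_mono) auto

lemma grid_le: "0 < k \<Longrightarrow> j \<le> k \<Longrightarrow> grid n k j \<le> n"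
  using grid_mono[of j k n k] grid_top[of k n] by simp

lemma grid_bounds: "real (grid n k j) \<le> real n * (real j / real k)" "real n * (real j / real k) < real (grid n k j) + 1"
proof -
  have "0 \<le> real n * (real j / real k)" by simp
  then show "real (grid n k j) \<le> real n * (real j / real k)" "real n * (real j / real k) < real (grid n k j) + 1"
    unfolding grid_def by linarith+
qed

lemma grid_window:
  assumes k: "0 < k" and t: "t \<in> {0..1}"
  shows "grid n k (nat \<lfloor>real k * t\<rfloor>) \<le> nat \<lfloor>real n * t\<rfloor>"
    "nat \<lfloor>real n * t\<rfloor> \<le> grid n k (nat \<lfloor>real k * t\<rfloor>) + (n div k + 2)"
proof -
  define j where "j = nat \<lfloor>real k * t\<rfloor>"
  have kt: "0 \<le> real k * t" and nt: "0 \<le> real n * t" using t by auto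
  have j: "real j \<le> real k * t" "real k * t < real j + 1" unfolding j_def using kt by linarith+
  have j1: "real j / real k \<le> t" "t < (real j + 1) / real k"
    using j k by (auto simp: pos_divide_le_eq pos_less_divide_eq mult.commute)
  have "real n * (real j / real k) \<le> real n * t" using j1 by (intro mult_left_mono) auto
  then show "grid n k (nat \<lfloor>real k * t\<rfloor>) \<le> nat \<lfloor>real n * t\<rfloor>"
    unfolding j_def[symmetric] grid_def by (intro nat_mono floor_mono)
  have "real n * t \<le> real n * ((real j + 1) / real k)" using j1 by (intro mult_left_mono) auto
  also have "\<dots> = real n * (real j / real k) + real n / real k" by (simp add: add_divide_distrib algebra_simps)
  also have "real n / real k < real (n div k) + 1"
  proof -
    have "\<lfloor>real n / real k\<rfloor> = int (n div k)" by (simp add: floor_divide_of_nat_eq)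
    then show ?thesis by linarith
  qed
  finally have "real n * t < real (grid n k j) + 1 + (real (n div k) + 1)" using grid_bounds(2)[of n j k] by linarith
  moreover have "real (nat \<lfloor>real n * t\<rfloor>) \<le> real n * t" using nt by linarith
  ultimately have "real (nat \<lfloor>real n * t\<rfloor>) < real (grid n k j + (n div k + 2))" by simp
  then show "nat \<lfloor>real n * t\<rfloor> \<le> grid n k (nat \<lfloor>real k * t\<rfloor>) + (n div k + 2)"
    unfolding j_def[symmetric] by linarith
qed

lemma grid_tendsto: "(\<lambda>n. real (grid n k j) / real n) \<longlonglongrightarrow> real j / real k"
proof -
  have "(\<lambda>n. real (grid n k j) / real n - real j / real k) \<longlonglongrightarrow> 0"
  proof (rule Lim_null_comparison)
    show "\<forall>\<^sub>F n in sequentially. norm (real (grid n k j) / real n - real j / real k) \<le> 1 / real n"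
      using eventually_gt_at_top[of 0]
    proof eventually_elim
      case (elim n)
      have "real (grid n k j) / real n - real j / real k = (real (grid n k j) - real n * (real j / real k)) / real n"
        using elim by (simp add: field_simps)
      also have "\<bar>\<dots>\<bar> \<le> 1 / real n"
        unfolding abs_divide using grid_bounds[of n k j] grid_bounds(2)[of n j k] elim
        by (simp add: divide_right_mono abs_le_iff)
      finally show ?case by simp
    qed
    show "(\<lambda>n. 1 / real n) \<longlonglongrightarrow> 0" by (rule lim_1_over_n)
  qed
  then show ?thesis by (simp add: LIM_zero_iff)
qed

definition orbit_increment :: "('a \<Rightarrow> 'a) \<Rightarrow> ('a \<Rightarrow> real) \<Rightarrow> nat \<Rightarrow> nat \<Rightarrow> 'a \<Rightarrow> nat \<Rightarrow> real" where
  "orbit_increment T f n k y j =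
     (if j < k then (orbit_sum T f (grid n k (Suc j)) y - orbit_sum T f (grid n k j) y) / sqrt (real n) else 0)"

lemma sum_orbit_increment:
  "j \<le> k \<Longrightarrow> (\<Sum>i<j. orbit_increment T f n k y i) = orbit_sum T f (grid n k j) y / sqrt (real n)"
proof -
  assume "j \<le> k"
  then have "(\<Sum>i<j. orbit_increment T f n k y i)
      = (\<Sum>i<j. orbit_sum T f (grid n k (Suc i)) y / sqrt (real n) - orbit_sum T f (grid n k i) y / sqrt (real n))"
    by (intro sum.cong) (auto simp: orbit_increment_def diff_divide_distrib)
  also have "\<dots> = orbit_sum T f (grid n k j) y / sqrt (real n)" by (subst sum_lessThan_telescope) simp
  finally show ?thesis .
qed

lemma orbit_increment_diff:
  "orbit_increment T (\<lambda>y. f y - g y) n k y j = orbit_increment T f n k y j - orbit_increment T g n k y j"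
  by (simp add: orbit_increment_def orbit_sum_diff diff_divide_distrib)

lemma abs_orbit_increment_le: "\<bar>orbit_increment T f n k y j\<bar> \<le> 2 * orbit_max T f n y / sqrt (real n)"
proof (cases "j < k")
  case True
  then have "\<bar>orbit_sum T f (grid n k (Suc j)) y\<bar> \<le> orbit_max T f n y" "\<bar>orbit_sum T f (grid n k j) y\<bar> \<le> orbit_max T f n y"
    by (intro abs_orbit_sum_le_orbit_max grid_le; simp)+
  then have "\<bar>orbit_sum T f (grid n k (Suc j)) y - orbit_sum T f (grid n k j) y\<bar> \<le> 2 * orbit_max T f n y" by linarith
  then show ?thesis using True by (simp add: orbit_increment_def abs_divide divide_right_mono)
qed (simp add: orbit_increment_def orbit_max_nonneg)

text \<open>
  The coefficient of \<open>f \<circ> T\<^sup>i\<close> in a linear combination of increments: \<open>a j\<close> for the block \<open>j\<close> that contains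
  \<open>i\<close>. As the blocks are disjoint, squaring acts on the coefficients.
\<close>

definition grid_weight :: "(nat \<Rightarrow> real) \<Rightarrow> nat \<Rightarrow> nat \<Rightarrow> nat \<Rightarrow> real" where
  "grid_weight a k n i = (\<Sum>j<k. a j * of_bool (grid n k j \<le> i \<and> i < grid n k (Suc j)))"

lemma grid_block_sum:
  assumes k: "j < k"
  shows "orbit_sum T f (grid n k (Suc j)) y - orbit_sum T f (grid n k j) y
    = (\<Sum>i<n. of_bool (grid n k j \<le> i \<and> i < grid n k (Suc j)) * f ((T ^^ i) y))"
proof -
  have "orbit_sum T f (grid n k (Suc j)) y - orbit_sum T f (grid n k j) y
      = (\<Sum>i\<in>{grid n k j..<grid n k (Suc j)}. f ((T ^^ i) y))"
    unfolding orbit_sum_def lessThan_atLeast0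
    by (subst sum_diff_nat_ivl) (auto intro: grid_mono)
  also have "\<dots> = (\<Sum>i<n. if i \<in> {grid n k j..<grid n k (Suc j)} then f ((T ^^ i) y) else 0)"
    using grid_le[of k "Suc j" n] k by (subst sum.inter_restrict[symmetric]) (auto intro!: sum.cong)
  also have "\<dots> = (\<Sum>i<n. of_bool (grid n k j \<le> i \<and> i < grid n k (Suc j)) * f ((T ^^ i) y))"
    by (intro sum.cong) auto
  finally show ?thesis .
qed

lemma sum_grid_weight:
  "(\<Sum>j<k. a j * orbit_increment T f n k y j) = (\<Sum>i<n. grid_weight a k n i * f ((T ^^ i) y)) / sqrt (real n)"
proof -
  have "(\<Sum>j<k. a j * orbit_increment T f n k y j)
      = (\<Sum>j<k. \<Sum>i<n. a j * of_bool (grid n k j \<le> i \<and> i < grid n k (Suc j)) * f ((T ^^ i) y)) / sqrt (real n)"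
    unfolding sum_divide_distrib[of _ "{..<k}"]
  proof (rule sum.cong[OF refl])
    fix j assume "j \<in> {..<k}"
    then have j: "j < k" by simp
    show "a j * orbit_increment T f n k y j
        = (\<Sum>i<n. a j * of_bool (grid n k j \<le> i \<and> i < grid n k (Suc j)) * f ((T ^^ i) y)) / sqrt (real n)"
      unfolding orbit_increment_def grid_block_sum[OF j] using j
      by (simp only: if_True sum_distrib_left times_divide_eq_right mult.assoc)
  qed
  also have "(\<Sum>j<k. \<Sum>i<n. a j * of_bool (grid n k j \<le> i \<and> i < grid n k (Suc j)) * f ((T ^^ i) y))
      = (\<Sum>i<n. grid_weight a k n i * f ((T ^^ i) y))"
    unfolding grid_weight_def sum_distrib_right by (rule sum.swap)
  finally show ?thesis .
qed

lemma grid_weight_square: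
  "(grid_weight a k n i)\<^sup>2 = (\<Sum>j<k. (a j)\<^sup>2 * of_bool (grid n k j \<le> i \<and> i < grid n k (Suc j)))"
proof -
  define b where "b = (\<lambda>j. of_bool (grid n k j \<le> i \<and> i < grid n k (Suc j)) :: real)"
  have b0: "b j * b l = 0" if "j < l" for j l
    using grid_mono[of "Suc j" l n k] that by (auto simp: b_def)
  have b: "b j * b l = (if l = j then b j else 0)" for j l
    using b0[of j l] b0[of l j] by (cases j l rule: linorder_cases) (auto simp: b_def mult.commute)
  have "(\<Sum>l<k. a j * b j * (a l * b l)) = (a j)\<^sup>2 * b j" if "j < k" for j
  proof -
    have "(\<Sum>l<k. a j * b j * (a l * b l)) = (\<Sum>l<k. if l = j then (a j)\<^sup>2 * b j else 0)"
    proof (rule sum.cong[OF refl])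
      fix l
      have "a j * b j * (a l * b l) = a j * a l * (b j * b l)" by (simp only: ac_simps)
      also have "\<dots> = (if l = j then (a j)\<^sup>2 * b j else 0)"
        unfolding b by (simp add: power2_eq_square)
      finally show "a j * b j * (a l * b l) = (if l = j then (a j)\<^sup>2 * b j else 0)" .
    qed
    then show ?thesis using that by simp
  qed
  then have "(\<Sum>j<k. a j * b j) * (\<Sum>l<k. a l * b l) = (\<Sum>j<k. (a j)\<^sup>2 * b j)"
    unfolding sum_product by (intro sum.cong) auto
  then show ?thesis by (simp only: grid_weight_def b_def power2_eq_square)
qed

lemma abs_grid_weight_le: "\<bar>grid_weight a k n i\<bar> \<le> (\<Sum>j<k. \<bar>a j\<bar>)"
  unfolding grid_weight_def
  by (rule order_trans[OF sum_abs]) (intro sum_mono, simp add: abs_mult)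

lemma iexp_Lipschitz: "norm (exp (\<i> * complex_of_real x) - exp (\<i> * complex_of_real y)) \<le> \<bar>x - y\<bar>"
proof -
  have "exp (\<i> * complex_of_real x) - exp (\<i> * complex_of_real y)
      = exp (\<i> * complex_of_real y) * (exp (\<i> * complex_of_real (x - y)) - 1)"
    by (simp add: right_diff_distrib mult_exp_exp)
  then show ?thesis using iexp_approx1[of "x - y" 0] by (simp add: norm_mult norm_exp_i_times)
qed

lemma exp_minus_Lipschitz:
  assumes "0 \<le> x" "0 \<le> y" shows "\<bar>exp (- x) - exp (- y)\<bar> \<le> \<bar>x - y :: real\<bar>"
proof -
  have *: "exp (- x) - exp (- y) \<le> y - x" if "0 \<le> x" "x \<le> y" for x y :: real
  proof -
    have "exp (- x) - exp (- y) = exp (- x) * (1 - exp (- (y - x)))" by (simp add: right_diff_distrib mult_exp_exp)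
    also have "\<dots> \<le> 1 * (y - x)"
    proof (rule mult_mono)
      show "1 - exp (- (y - x)) \<le> y - x" using exp_ge_add_one_self[of "- (y - x)"] by linarith
    qed (use that in auto)
    finally show ?thesis by simp
  qed
  show ?thesis using *[of x y] *[of y x] assms by (cases "x \<le> y") auto
qed

context prob_space
begin

text \<open>
  The sum of the weighted squares splits into blocks of relative length \<open>1 / k\<close>, on each of which the
  ergodic theorem yields the proportion \<open>\<eta> / k\<close>.
\<close>

lemma bounded_martingale_fdd:
  assumes T: "measure_preserving_map M T" and m [measurable]: "m \<in> borel_measurable M"
    and K: "\<And>y. \<bar>m y\<bar> \<le> K" and u: "is_transfer M T m (\<lambda>_. 0)" and k: "0 < k"
  defines "\<eta> \<equiv> real_cond_exp M (invariant_algebra M T) (\<lambda>y. (m y)\<^sup>2)"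
  shows "(\<lambda>n. \<integral>y. exp (\<i> * complex_of_real (\<Sum>j<k. a j * orbit_increment T m n k y j)) \<partial>M)
    \<longlonglongrightarrow> (\<integral>y. complex_of_real (exp (- (\<eta> y * (\<Sum>j<k. (a j)\<^sup>2) / real k) / 2)) \<partial>M)"
  unfolding sum_grid_weight
proof (rule martingale_char_tendsto[OF T m K u abs_grid_weight_le])
  note Tm = measurable_measure_preserving[OF T]
  have mL2: "m \<in> L2_space M" using K by (intro L2_bounded) auto
  have \<eta>I: "\<eta> \<in> borel_measurable (invariant_algebra M T)" unfolding \<eta>_def by simp
  have [measurable]: "\<eta> \<in> borel_measurable M" unfolding \<eta>_def by simp
  show "(\<lambda>y. \<eta> y * (\<Sum>j<k. (a j)\<^sup>2) / real k) \<in> borel_measurable M" by measurable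
  show "\<eta> (T y) * (\<Sum>j<k. (a j)\<^sup>2) / real k = \<eta> y * (\<Sum>j<k. (a j)\<^sup>2) / real k" if "y \<in> space M" for y
    using invariant_algebra_measurable_invariant[OF Tm \<eta>I that] by simp
  show "AE y in M. (\<lambda>n. (\<Sum>i<n. (grid_weight a k n i * m ((T ^^ i) y))\<^sup>2) / real n)
      \<longlonglongrightarrow> \<eta> y * (\<Sum>j<k. (a j)\<^sup>2) / real k"
    using ergodic_theorem[OF T L2_square_integrable[OF mL2]]
  proof eventually_elim
    case (elim y)
    define S where "S = (\<lambda>n. orbit_sum T (\<lambda>y. (m y)\<^sup>2) n y)"
    have Slim: "(\<lambda>n. S n / real n) \<longlonglongrightarrow> \<eta> y" using elim by (simp add: S_def \<eta>_def)
    have block: "(\<lambda>n. S (grid n k j) / real n) \<longlonglongrightarrow> \<eta> y * (real j / real k)" for j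
    proof (cases "j = 0")
      case True
      then show ?thesis by (simp add: S_def)
    next
      case False
      have "filterlim (\<lambda>n. real (grid n k j)) at_top sequentially"
      proof (rule filterlim_at_top_mono)
        show "filterlim (\<lambda>n. - 1 + real j / real k * real n) at_top sequentially"
          using False k
          by (intro filterlim_tendsto_add_at_top[OF tendsto_const]
              filterlim_tendsto_pos_mult_at_top[OF tendsto_const _ filterlim_real_sequentially]) auto
        have "- 1 + real j / real k * real n \<le> real (grid n k j)" for n
          using grid_bounds(2)[of n j k] by (simp add: mult.commute)
        then show "\<forall>\<^sub>F n in sequentially. - 1 + real j / real k * real n \<le> real (grid n k j)"
          by (intro always_eventually allI)
      qed
      then have "filterlim (\<lambda>n. grid n k j) sequentially sequentially"
        by (simp add: filterlim_sequentially_iff_filterlim_real)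
      from filterlim_compose[OF Slim this]
      have "(\<lambda>n. S (grid n k j) / real (grid n k j) * (real (grid n k j) / real n)) \<longlonglongrightarrow> \<eta> y * (real j / real k)"
        by (rule tendsto_mult[OF _ grid_tendsto])
      moreover have "S (grid n k j) / real (grid n k j) * (real (grid n k j) / real n) = S (grid n k j) / real n" for n
        by (cases "grid n k j = 0") (simp_all add: S_def)
      ultimately show ?thesis by (simp only:)
    qed
    have "(\<Sum>i<n. (grid_weight a k n i * m ((T ^^ i) y))\<^sup>2) / real n
        = (\<Sum>j<k. (a j)\<^sup>2 * (S (grid n k (Suc j)) / real n - S (grid n k j) / real n))" for n
    proof -
      have "(\<Sum>i<n. (grid_weight a k n i * m ((T ^^ i) y))\<^sup>2)
          = (\<Sum>j<k. \<Sum>i<n. (a j)\<^sup>2 * of_bool (grid n k j \<le> i \<and> i < grid n k (Suc j)) * (m ((T ^^ i) y))\<^sup>2)"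
        unfolding power_mult_distrib grid_weight_square sum_distrib_right by (rule sum.swap)
      also have "\<dots> = (\<Sum>j<k. (a j)\<^sup>2 * (S (grid n k (Suc j)) - S (grid n k j)))"
        unfolding S_def by (intro sum.cong refl) (simp only: lessThan_iff grid_block_sum sum_distrib_left mult.assoc)
      finally show ?thesis
        by (simp only: sum_divide_distrib diff_divide_distrib[symmetric] times_divide_eq_right)
    qed
    moreover have "(\<lambda>n. \<Sum>j<k. (a j)\<^sup>2 * (S (grid n k (Suc j)) / real n - S (grid n k j) / real n))
        \<longlonglongrightarrow> (\<Sum>j<k. (a j)\<^sup>2 * (\<eta> y * (real (Suc j) / real k) - \<eta> y * (real j / real k)))"
      by (intro tendsto_sum tendsto_mult tendsto_diff tendsto_const block)
    moreover have "(\<Sum>j<k. (a j)\<^sup>2 * (\<eta> y * (real (Suc j) / real k) - \<eta> y * (real j / real k)))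
        = \<eta> y * (\<Sum>j<k. (a j)\<^sup>2) / real k"
      unfolding sum_distrib_left sum_divide_distrib by (intro sum.cong) (auto simp: field_simps)
    ultimately show ?case by simp
  qed
qed

lemma real_cond_exp_L1_contraction:
  assumes T: "measure_preserving_map M T" and f: "integrable M f" and g: "integrable M g"
  defines "I \<equiv> invariant_algebra M T"
  shows "(\<integral>y. \<bar>real_cond_exp M I f y - real_cond_exp M I g y\<bar> \<partial>M) \<le> (\<integral>y. \<bar>f y - g y\<bar> \<partial>M)"
proof -
  interpret I: sigma_finite_subalgebra M I
    unfolding I_def by (rule sigma_finite_subalgebra_invariant[OF measurable_measure_preserving[OF T]])
  have d: "integrable M (\<lambda>y. f y - g y)" "integrable M (\<lambda>y. \<bar>f y - g y\<bar>)" "integrable M (\<lambda>y. - \<bar>f y - g y\<bar>)"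
    using f g by auto
  have "AE y in M. \<bar>real_cond_exp M I f y - real_cond_exp M I g y\<bar> \<le> real_cond_exp M I (\<lambda>y. \<bar>f y - g y\<bar>) y"
  proof -
    have "AE y in M. real_cond_exp M I (\<lambda>y. f y - g y) y \<le> real_cond_exp M I (\<lambda>y. \<bar>f y - g y\<bar>) y"
      by (intro I.real_cond_exp_mono d) auto
    moreover have "AE y in M. real_cond_exp M I (\<lambda>y. - \<bar>f y - g y\<bar>) y \<le> real_cond_exp M I (\<lambda>y. f y - g y) y"
      by (intro I.real_cond_exp_mono d) auto
    moreover have "AE y in M. real_cond_exp M I (\<lambda>y. - \<bar>f y - g y\<bar>) y = - real_cond_exp M I (\<lambda>y. \<bar>f y - g y\<bar>) y"
      using I.real_cond_exp_cmult[OF d(2), of "-1"] by simp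
    ultimately show ?thesis
      using I.real_cond_exp_diff[OF f g] by eventually_elim linarith
  qed
  then have "(\<integral>y. \<bar>real_cond_exp M I f y - real_cond_exp M I g y\<bar> \<partial>M) \<le> (\<integral>y. real_cond_exp M I (\<lambda>y. \<bar>f y - g y\<bar>) y \<partial>M)"
    using I.real_cond_exp_int(1)[OF f] I.real_cond_exp_int(1)[OF g] I.real_cond_exp_int(1)[OF d(2)]
    by (intro integral_mono_AE) auto
  also have "\<dots> = (\<integral>y. \<bar>f y - g y\<bar> \<partial>M)" by (rule I.real_cond_exp_int(2)[OF d(2)])
  finally show ?thesis .
qed

text \<open>
  Both sides depend continuously on the martingale difference: the left one through the maximum of
  the orbit sums, the right one because conditional expectation contracts \<open>L\<^sup>1\<close>. Bounded martingale
  differences therefore suffice.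
\<close>

lemma finite_dimensional_char_tendsto:
  assumes T: "measure_preserving_map M T" and h: "h \<in> L2_space M" and h': "h' \<in> L2_space M" and k: "0 < k"
    and approx: "\<And>\<delta>. 0 < \<delta> \<Longrightarrow> \<exists>m K. m \<in> borel_measurable M \<and> (\<forall>y. \<bar>m y\<bar> \<le> K) \<and> is_transfer M T m (\<lambda>_. 0) \<and>
      L2_norm M (\<lambda>y. h' y - m y) \<le> \<delta> \<and>
      (\<forall>\<^sub>F n in sequentially. L2_norm M (orbit_max T (\<lambda>y. h y - m y) n) \<le> \<delta> * sqrt (real n))"
  defines "\<eta> \<equiv> real_cond_exp M (invariant_algebra M T) (\<lambda>y. (h' y)\<^sup>2)"
  shows "(\<lambda>n. \<integral>y. exp (\<i> * complex_of_real (\<Sum>j<k. a j * orbit_increment T h n k y j)) \<partial>M)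
    \<longlonglongrightarrow> (\<integral>y. complex_of_real (exp (- (\<eta> y * (\<Sum>j<k. (a j)\<^sup>2) / real k) / 2)) \<partial>M)"
proof (rule LIMSEQ_I)
  fix e :: real assume e: "0 < e"
  interpret I: sigma_finite_subalgebra M "invariant_algebra M T"
    by (rule sigma_finite_subalgebra_invariant[OF measurable_measure_preserving[OF T]])
  define A where "A = (\<Sum>j<k. \<bar>a j\<bar>)"
  define s where "s = (\<Sum>j<k. (a j)\<^sup>2) / real k"
  have A0: "0 \<le> A" and s0: "0 \<le> s" by (auto simp: A_def s_def sum_nonneg)
  \<comment> \<open>Collects the errors \<open>step1\<close> and \<open>step2\<close> of replacing \<open>h\<close> and \<open>h'\<close> by the bounded \<open>m\<close>.\<close>
  define C where "C = 2 * A + s / 2 * (2 * L2_norm M h' + 1) + 1"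
  have C1: "1 \<le> C" using A0 s0 by (simp add: C_def)
  define \<delta> where "\<delta> = min 1 (e / (2 * C))"
  have \<delta>: "0 < \<delta>" "\<delta> \<le> 1" "C * \<delta> \<le> e / 2"
  proof -
    show "0 < \<delta>" "\<delta> \<le> 1" using e C1 by (auto simp: \<delta>_def)
    have "C * \<delta> \<le> C * (e / (2 * C))" using C1 by (intro mult_left_mono) (auto simp: \<delta>_def)
    then show "C * \<delta> \<le> e / 2" using C1 by simp
  qed
  obtain m K where m [measurable]: "m \<in> borel_measurable M" and K: "\<And>y. \<bar>m y\<bar> \<le> K"
    and u: "is_transfer M T m (\<lambda>_. 0)" and nm: "L2_norm M (\<lambda>y. h' y - m y) \<le> \<delta>"
    and ev: "\<forall>\<^sub>F n in sequentially. L2_norm M (orbit_max T (\<lambda>y. h y - m y) n) \<le> \<delta> * sqrt (real n)"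
    using approx[OF \<delta>(1)] by blast
  have mL2: "m \<in> L2_space M" using K by (intro L2_bounded) auto
  have hmL2: "(\<lambda>y. h y - m y) \<in> L2_space M" by (rule L2_diff[OF h mL2])
  define \<zeta> where "\<zeta> = real_cond_exp M (invariant_algebra M T) (\<lambda>y. (m y)\<^sup>2)"
  define U where "U = (\<lambda>f n y. \<Sum>j<k. a j * orbit_increment T f n k y j)"
  have Um: "U f n \<in> borel_measurable M" if "f \<in> L2_space M" for f n
    unfolding U_def orbit_increment_def
    using L2_measurable[OF L2_orbit_sum[OF T that]] by (intro borel_measurable_sum) auto
  have Eint: "integrable M (\<lambda>y. exp (\<i> * complex_of_real (U f n y)))" if "f \<in> L2_space M" for f n
    using Um[OF that, of n]
    by (intro integrable_const_bound[where B = 1]) (auto simp: norm_exp_i_times)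
  have step1: "norm ((\<integral>y. exp (\<i> * complex_of_real (U h n y)) \<partial>M) - (\<integral>y. exp (\<i> * complex_of_real (U m n y)) \<partial>M)) \<le> 2 * A * \<delta>"
    if n: "0 < n" "L2_norm M (orbit_max T (\<lambda>y. h y - m y) n) \<le> \<delta> * sqrt (real n)" for n
  proof -
    define R where "R = orbit_max T (\<lambda>y. h y - m y) n"
    have RL2: "R \<in> L2_space M" unfolding R_def by (rule L2_orbit_max[OF T hmL2])
    have "\<bar>U h n y - U m n y\<bar> \<le> A * (2 * R y / sqrt (real n))" for y
    proof -
      have "U h n y - U m n y = (\<Sum>j<k. a j * orbit_increment T (\<lambda>y. h y - m y) n k y j)"
        unfolding U_def orbit_increment_diff right_diff_distrib sum_subtractf ..
      also have "\<bar>\<dots>\<bar> \<le> (\<Sum>j<k. \<bar>a j\<bar> * (2 * R y / sqrt (real n)))"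
        by (rule order_trans[OF sum_abs], unfold abs_mult R_def)
           (intro sum_mono mult_left_mono abs_orbit_increment_le, auto)
      finally show ?thesis unfolding A_def by (simp only: sum_distrib_right)
    qed
    then have le: "norm (exp (\<i> * complex_of_real (U h n y)) - exp (\<i> * complex_of_real (U m n y))) \<le> A * (2 * R y / sqrt (real n))" for y
      by (rule order_trans[OF iexp_Lipschitz])
    have "norm ((\<integral>y. exp (\<i> * complex_of_real (U h n y)) \<partial>M) - (\<integral>y. exp (\<i> * complex_of_real (U m n y)) \<partial>M))
       = norm (\<integral>y. exp (\<i> * complex_of_real (U h n y)) - exp (\<i> * complex_of_real (U m n y)) \<partial>M)"
      using Eint[OF h] Eint[OF mL2] by simp
    also have "\<dots> \<le> (\<integral>y. norm (exp (\<i> * complex_of_real (U h n y)) - exp (\<i> * complex_of_real (U m n y))) \<partial>M)"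
      by (rule integral_norm_bound)
    also have "\<dots> \<le> (\<integral>y. A * (2 * R y / sqrt (real n)) \<partial>M)"
      using Eint[OF h] Eint[OF mL2] L2_integrable[OF RL2] le by (intro integral_mono) auto
    also have "\<dots> = A * (2 * (\<integral>y. R y \<partial>M) / sqrt (real n))" by simp
    also have "\<dots> \<le> A * (2 * (\<delta> * sqrt (real n)) / sqrt (real n))"
    proof -
      have "(\<integral>y. R y \<partial>M) \<le> (\<integral>y. \<bar>R y\<bar> \<partial>M)" by (intro integral_mono) (auto intro: L2_integrable[OF RL2])
      then have "(\<integral>y. R y \<partial>M) \<le> \<delta> * sqrt (real n)"
        using integral_abs_le_L2_norm[OF RL2] n(2) unfolding R_def by linarith
      then show ?thesis using A0 by (intro mult_left_mono divide_right_mono) auto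
    qed
    finally show ?thesis using n(1) by simp
  qed
  have step2: "norm ((\<integral>y. complex_of_real (exp (- (\<zeta> y * s) / 2)) \<partial>M) - (\<integral>y. complex_of_real (exp (- (\<eta> y * s) / 2)) \<partial>M))
      \<le> s / 2 * (\<delta> * (2 * L2_norm M h' + 1))"
  proof -
    note m2 = L2_square_integrable[OF mL2] and h2 = L2_square_integrable[OF h']
    have [measurable]: "\<zeta> \<in> borel_measurable M" "\<eta> \<in> borel_measurable M" unfolding \<zeta>_def \<eta>_def by simp_all
    have zint: "integrable M \<zeta>" "integrable M \<eta>"
      unfolding \<zeta>_def \<eta>_def using I.real_cond_exp_int(1)[OF m2] I.real_cond_exp_int(1)[OF h2] by auto
    have pos: "AE y in M. 0 \<le> \<zeta> y" "AE y in M. 0 \<le> \<eta> y"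
      unfolding \<zeta>_def \<eta>_def using m2 h2 by (intro I.real_cond_exp_pos; auto)+
    have eint: "integrable M (\<lambda>y. exp (- (\<zeta> y * s) / 2))" "integrable M (\<lambda>y. exp (- (\<eta> y * s) / 2))"
      using pos s0 by (intro integrable_const_bound[where B = 1]; auto)+
    have "norm ((\<integral>y. complex_of_real (exp (- (\<zeta> y * s) / 2)) \<partial>M) - (\<integral>y. complex_of_real (exp (- (\<eta> y * s) / 2)) \<partial>M))
       = \<bar>\<integral>y. exp (- (\<zeta> y * s) / 2) - exp (- (\<eta> y * s) / 2) \<partial>M\<bar>"
      using eint by (simp add: of_real_diff[symmetric] del: of_real_diff)
    also have "\<dots> \<le> (\<integral>y. \<bar>exp (- (\<zeta> y * s) / 2) - exp (- (\<eta> y * s) / 2)\<bar> \<partial>M)" by (rule integral_abs_bound)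
    also have "\<dots> \<le> (\<integral>y. s / 2 * \<bar>\<zeta> y - \<eta> y\<bar> \<partial>M)"
    proof (rule integral_mono_AE)
      show "AE y in M. \<bar>exp (- (\<zeta> y * s) / 2) - exp (- (\<eta> y * s) / 2)\<bar> \<le> s / 2 * \<bar>\<zeta> y - \<eta> y\<bar>"
        using pos
      proof eventually_elim
        case (elim y)
        have "\<bar>exp (- (\<zeta> y * s / 2)) - exp (- (\<eta> y * s / 2))\<bar> \<le> \<bar>\<zeta> y * s / 2 - \<eta> y * s / 2\<bar>"
          using elim s0 by (intro exp_minus_Lipschitz) auto
        also have "\<zeta> y * s / 2 - \<eta> y * s / 2 = s / 2 * (\<zeta> y - \<eta> y)" by (simp add: field_simps)
        also have "\<bar>\<dots>\<bar> = s / 2 * \<bar>\<zeta> y - \<eta> y\<bar>" using s0 by (simp add: abs_mult)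
        finally show ?case by simp
      qed
    qed (use eint zint in auto)
    also have "\<dots> = s / 2 * (\<integral>y. \<bar>\<zeta> y - \<eta> y\<bar> \<partial>M)" by simp
    also have "\<dots> \<le> s / 2 * (\<delta> * (2 * L2_norm M h' + 1))"
    proof (rule mult_left_mono)
      note d1 = L2_abs[OF L2_diff[OF h' mL2]] and d2 = L2_abs[OF L2_add[OF h' mL2]]
      have "(\<integral>y. \<bar>\<zeta> y - \<eta> y\<bar> \<partial>M) \<le> (\<integral>y. \<bar>(m y)\<^sup>2 - (h' y)\<^sup>2\<bar> \<partial>M)"
        unfolding \<zeta>_def \<eta>_def by (rule real_cond_exp_L1_contraction[OF T m2 h2])
      also have "\<dots> = (\<integral>y. \<bar>h' y - m y\<bar> * \<bar>h' y + m y\<bar> \<partial>M)"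
        by (intro Bochner_Integration.integral_cong)
           (auto simp: abs_mult[symmetric] power2_eq_square algebra_simps abs_minus_commute)
      also have "\<dots> \<le> L2_norm M (\<lambda>y. h' y - m y) * L2_norm M (\<lambda>y. h' y + m y)"
        using Cauchy_Schwarz_L2[OF d1 d2] by (simp add: L2_norm_def abs_le_iff)
      also have "\<dots> \<le> \<delta> * (2 * L2_norm M h' + 1)"
      proof (intro mult_mono nm)
        have "L2_norm M (\<lambda>y. h' y + m y) = L2_norm M (\<lambda>y. 2 * h' y - (h' y - m y))" by (simp add: algebra_simps)
        also have "\<dots> \<le> L2_norm M (\<lambda>y. 2 * h' y) + L2_norm M (\<lambda>y. h' y - m y)"
          by (intro L2_norm_triangle_diff L2_cmult h' L2_diff mL2)
        finally show "L2_norm M (\<lambda>y. h' y + m y) \<le> 2 * L2_norm M h' + 1"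
          using nm \<delta>(2) L2_norm_cmult[of M 2 h'] by simp
      qed (use \<delta> in auto)
      finally show "(\<integral>y. \<bar>\<zeta> y - \<eta> y\<bar> \<partial>M) \<le> \<delta> * (2 * L2_norm M h' + 1)" .
    qed (use s0 in simp)
    finally show ?thesis .
  qed
  have "(\<lambda>n. \<integral>y. exp (\<i> * complex_of_real (U m n y)) \<partial>M) \<longlonglongrightarrow> (\<integral>y. complex_of_real (exp (- (\<zeta> y * s) / 2)) \<partial>M)"
    using bounded_martingale_fdd[OF T m K u k, of a] unfolding U_def \<zeta>_def s_def by simp
  from tendstoD[OF this, of "e / 2"] e
  have "\<forall>\<^sub>F n in sequentially. norm ((\<integral>y. exp (\<i> * complex_of_real (U m n y)) \<partial>M)
      - (\<integral>y. complex_of_real (exp (- (\<zeta> y * s) / 2)) \<partial>M)) < e / 2" by (simp add: dist_norm)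
  then have "\<forall>\<^sub>F n in sequentially. norm ((\<integral>y. exp (\<i> * complex_of_real (U h n y)) \<partial>M)
      - (\<integral>y. complex_of_real (exp (- (\<eta> y * s) / 2)) \<partial>M)) < e"
    using ev eventually_gt_at_top[of 0]
  proof eventually_elim
    case (elim n)
    have tri: "norm (p - r) < e" if "norm (p - q) \<le> x" "norm (q - q') < e / 2" "norm (q' - r) \<le> y" "x + y \<le> e / 2"
      for p q q' r :: complex and x y
      using that norm_triangle_ineq[of "p - q" "q - q'"] norm_triangle_ineq[of "p - q'" "q' - r"] by simp
    have "2 * A * \<delta> + s / 2 * (\<delta> * (2 * L2_norm M h' + 1)) \<le> C * \<delta>"
      using \<delta>(1) by (simp add: C_def algebra_simps)
    then show ?case using tri[OF step1[OF elim(3,2)] elim(1) step2] \<delta>(3) by linarith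
  qed
  then show "\<exists>N. \<forall>n\<ge>N. norm ((\<integral>y. exp (\<i> * complex_of_real (\<Sum>j<k. a j * orbit_increment T h n k y j)) \<partial>M)
      - (\<integral>y. complex_of_real (exp (- (\<eta> y * (\<Sum>j<k. (a j)\<^sup>2) / real k) / 2)) \<partial>M)) < e"
    unfolding U_def s_def by (simp only: eventually_sequentially times_divide_eq_right)
qed

end

section \<open>Tightness\<close>

lemma partial_sum_process_eq_step_path:
  "partial_sum_process T h n y = step_path n (\<lambda>j. orbit_sum T h j y / sqrt (real n))"
  by (simp add: partial_sum_process_def step_path_def orbit_sum_def)

definition grid_path :: "nat \<Rightarrow> (nat \<Rightarrow> real) \<Rightarrow> real \<Rightarrow> real" where
  "grid_path k x = step_path k (\<lambda>j. \<Sum>i<j. x i)"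

lemma step_path_cong:
  assumes "\<And>j. j \<le> k \<Longrightarrow> v j = u j" shows "step_path k v = step_path k u"
  unfolding step_path_def by (intro restrict_ext assms nat_floor_le)

lemma grid_path_orbit_increment:
  "grid_path k (orbit_increment T h n k y) = step_path k (\<lambda>j. orbit_sum T h (grid n k j) y / sqrt (real n))"
  unfolding grid_path_def by (rule step_path_cong) (rule sum_orbit_increment)

text \<open>
  Between two grid points the process moves by an orbit sum of \<open>m\<close> over at most \<open>n div k + 2\<close> steps,
  up to two orbit sums of the remainder \<open>h - m\<close>.
\<close>

lemma step_path_oscillation:
  assumes k: "0 < k" and n: "0 < n"
    and O: "\<And>j. j \<le> k \<Longrightarrow> orbit_max T m (n div k + 2) ((T ^^ grid n k j) y) \<le> \<epsilon> / 2 * sqrt (real n)"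
    and R: "2 * orbit_max T (\<lambda>y. h y - m y) n y \<le> \<epsilon> / 2 * sqrt (real n)" and \<epsilon>: "0 < \<epsilon>"
  shows "skorohod_dist (partial_sum_process T h n y) (grid_path k (orbit_increment T h n k y)) \<le> \<epsilon>"
  unfolding partial_sum_process_eq_step_path grid_path_orbit_increment
proof (rule skorohod_dist_le_uniform[OF step_path_in_skorohod step_path_in_skorohod \<epsilon>])
  fix t :: real assume t: "t \<in> {0..1}"
  define j where "j = nat \<lfloor>real k * t\<rfloor>"
  define l where "l = nat \<lfloor>real n * t\<rfloor>"
  define N where "N = grid n k j"
  have j: "j \<le> k" unfolding j_def by (rule nat_floor_le[OF t])
  have l: "l \<le> n" unfolding l_def by (rule nat_floor_le[OF t])
  have N: "N \<le> l" "l \<le> N + (n div k + 2)"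
    unfolding N_def j_def l_def by (rule grid_window[OF k t])+
  have split: "orbit_sum T h i y = orbit_sum T m i y + orbit_sum T (\<lambda>y. h y - m y) i y" for i
    by (simp add: orbit_sum_diff)
  have "orbit_sum T m l y - orbit_sum T m N y = orbit_sum T m (l - N) ((T ^^ N) y)"
    using orbit_sum_add_index[of T m N "l - N" y] N(1) by simp
  also have "\<bar>\<dots>\<bar> \<le> orbit_max T m (n div k + 2) ((T ^^ N) y)"
    using N(2) by (intro abs_orbit_sum_le_orbit_max) simp
  also have "\<dots> \<le> \<epsilon> / 2 * sqrt (real n)" unfolding N_def by (rule O[OF j])
  finally have "\<bar>orbit_sum T m l y - orbit_sum T m N y\<bar> \<le> \<epsilon> / 2 * sqrt (real n)" .
  moreover have "\<bar>orbit_sum T (\<lambda>y. h y - m y) l y\<bar> \<le> orbit_max T (\<lambda>y. h y - m y) n y"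
    "\<bar>orbit_sum T (\<lambda>y. h y - m y) N y\<bar> \<le> orbit_max T (\<lambda>y. h y - m y) n y"
    using l N by (intro abs_orbit_sum_le_orbit_max; simp)+
  ultimately have "\<bar>orbit_sum T h l y - orbit_sum T h N y\<bar> \<le> \<epsilon> * sqrt (real n)"
    using R unfolding split by linarith
  then have "\<bar>orbit_sum T h l y - orbit_sum T h N y\<bar> / sqrt (real n) \<le> \<epsilon>"
    using n by (simp add: pos_divide_le_eq)
  then have "\<bar>orbit_sum T h l y / sqrt (real n) - orbit_sum T h N y / sqrt (real n)\<bar> \<le> \<epsilon>"
    by (simp only: diff_divide_distrib[symmetric] abs_divide) simp
  then show "\<bar>step_path n (\<lambda>j. orbit_sum T h j y / sqrt (real n)) t
      - step_path k (\<lambda>j. orbit_sum T h (grid n k j) y / sqrt (real n)) t\<bar> \<le> \<epsilon>"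
    using t by (simp add: step_path_def l_def N_def j_def)
qed

lemma one_le_power_of_less:
  fixes c x :: real
  assumes "0 < c" "c < x" shows "1 \<le> (x / c) ^ p"
  using assms by (intro one_le_power) simp

text \<open>
  Up to \<open>L \<epsilon>\<close>, a discrepancy between a test function of the process and of its discretization
  requires that the martingale oscillates within a window, or that the remainder is large; both
  events are bounded by moments.
\<close>

lemma Lipschitz_discretization:
  assumes k: "0 < k" and n: "0 < n" and \<epsilon>: "0 < \<epsilon>" and L: "0 \<le> L"
    and fB: "\<And>x. x \<in> skorohod_space \<Longrightarrow> \<bar>f x\<bar> \<le> B"
    and fL: "\<And>x y. x \<in> skorohod_space \<Longrightarrow> y \<in> skorohod_space \<Longrightarrow> \<bar>f x - f y\<bar> \<le> L * skorohod_dist x y"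
  defines "c \<equiv> \<epsilon> / 2 * sqrt (real n)"
  shows "\<bar>f (partial_sum_process T h n y) - f (grid_path k (orbit_increment T h n k y))\<bar>
    \<le> L * \<epsilon> + 2 * B * ((\<Sum>j\<le>k. (orbit_max T m (n div k + 2) ((T ^^ grid n k j) y) / c) ^ 4)
      + (2 * orbit_max T (\<lambda>y. h y - m y) n y / c)\<^sup>2)"
proof -
  have c0: "0 < c" using \<epsilon> n by (simp add: c_def)
  have D: "partial_sum_process T h n y \<in> skorohod_space" "grid_path k (orbit_increment T h n k y) \<in> skorohod_space"
    by (simp_all add: partial_sum_process_eq_step_path grid_path_def step_path_in_skorohod)
  have B0: "0 \<le> B" using fB[OF D(1)] by linarith
  define S where "S = (\<Sum>j\<le>k. (orbit_max T m (n div k + 2) ((T ^^ grid n k j) y) / c) ^ 4)"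
  define R where "R = (2 * orbit_max T (\<lambda>y. h y - m y) n y / c)\<^sup>2"
  have S0: "0 \<le> S" and R0: "0 \<le> R" by (auto simp: S_def R_def intro!: sum_nonneg)
  show ?thesis
  proof (cases "(\<forall>j\<le>k. orbit_max T m (n div k + 2) ((T ^^ grid n k j) y) \<le> c)
      \<and> 2 * orbit_max T (\<lambda>y. h y - m y) n y \<le> c")
    case True
    then have "skorohod_dist (partial_sum_process T h n y) (grid_path k (orbit_increment T h n k y)) \<le> \<epsilon>"
      unfolding c_def by (intro step_path_oscillation[OF k n _ _ \<epsilon>]) auto
    then have "\<bar>f (partial_sum_process T h n y) - f (grid_path k (orbit_increment T h n k y))\<bar> \<le> L * \<epsilon>"
      using fL[OF D] L by (meson mult_left_mono order_trans)
    moreover have "0 \<le> 2 * B * (S + R)" using B0 S0 R0 by simp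
    ultimately show ?thesis unfolding S_def R_def by linarith
  next
    case False
    have "1 \<le> S + R"
    proof (cases "2 * orbit_max T (\<lambda>y. h y - m y) n y \<le> c")
      case True
      with False have "\<not> (\<forall>j\<le>k. orbit_max T m (n div k + 2) ((T ^^ grid n k j) y) \<le> c)" by blast
      then obtain j where j: "j \<le> k" "c < orbit_max T m (n div k + 2) ((T ^^ grid n k j) y)"
        by (meson not_le)
      have "1 \<le> (orbit_max T m (n div k + 2) ((T ^^ grid n k j) y) / c) ^ 4"
        by (rule one_le_power_of_less[OF c0 j(2)])
      also have "\<dots> \<le> S" unfolding S_def using j(1) by (intro member_le_sum) auto
      finally show ?thesis using R0 by simp
    next
      case False
      then have "1 \<le> R" unfolding R_def by (intro one_le_power_of_less[OF c0]) simp
      then show ?thesis using S0 by simp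
    qed
    then have "2 * B * 1 \<le> 2 * B * (S + R)" using B0 by (intro mult_left_mono) auto
    moreover have "\<bar>f (partial_sum_process T h n y) - f (grid_path k (orbit_increment T h n k y))\<bar> \<le> 2 * B"
      using fB[OF D(1)] fB[OF D(2)] by linarith
    moreover have "0 \<le> L * \<epsilon>" using L \<epsilon> by simp
    ultimately show ?thesis unfolding S_def R_def by linarith
  qed
qed

lemma measurable_partial_sum_process:
  assumes "measure_preserving_map M T" "h \<in> borel_measurable M"
  shows "partial_sum_process T h n \<in> measurable M (borel_of skorohod_topology)"
  unfolding partial_sum_process_eq_step_path[abs_def]
  using measurable_orbit_sum[OF assms] by (intro measurable_step_path) auto

lemma continuous_grid_path:
  assumes f: "continuous_map skorohod_topology euclideanreal f"
  shows "continuous_on UNIV (\<lambda>x. f (grid_path k x))"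
proof -
  have "continuous_on UNIV (\<lambda>(x :: nat \<Rightarrow> real) j. \<Sum>i<j. x i)"
    by (intro continuous_on_coordinatewise_then_product continuous_on_sum continuous_on_product_coordinates)
  then have "continuous_map euclidean skorohod_topology (step_path k \<circ> (\<lambda>(x :: nat \<Rightarrow> real) j. \<Sum>i<j. x i))"
    using continuous_map_step_path by (intro continuous_map_compose[of euclidean euclidean]) auto
  from continuous_map_compose[OF this f] show ?thesis by (simp add: comp_def grid_path_def)
qed

context prob_space
begin

text \<open>
  The \<open>k + 1\<close> windows contribute fourth moments of order \<open>(n / k)\<^sup>2\<close> against the scale \<open>n\<^sup>2\<close>, hence an
  error of order \<open>1 / k\<close> in total; the remainder contributes its mean square.
\<close>

lemma discretization_error:
  assumes T: "measure_preserving_map M T" and h: "h \<in> L2_space M"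
    and m [measurable]: "m \<in> borel_measurable M" and K: "\<And>y. \<bar>m y\<bar> \<le> K" and u: "is_transfer M T m (\<lambda>_. 0)"
    and R: "L2_norm M (orbit_max T (\<lambda>y. h y - m y) n) \<le> \<delta> * sqrt (real n)"
    and k: "0 < k" and n: "2 * k \<le> n" and \<epsilon>: "0 < \<epsilon>" and L: "0 \<le> L"
    and fB: "\<And>x. x \<in> skorohod_space \<Longrightarrow> \<bar>f x\<bar> \<le> B"
    and fL: "\<And>x y. x \<in> skorohod_space \<Longrightarrow> y \<in> skorohod_space \<Longrightarrow> \<bar>f x - f y\<bar> \<le> L * skorohod_dist x y"
  shows "\<bar>(\<integral>y. f (partial_sum_process T h n y) \<partial>M) - (\<integral>y. f (grid_path k (orbit_increment T h n k y)) \<partial>M)\<bar>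
    \<le> L * \<epsilon> + 2 * B * (3840000 * K ^ 4 / (\<epsilon> ^ 4 * real k) + 16 * \<delta>\<^sup>2 / \<epsilon>\<^sup>2)"
proof -
  have n0: "0 < n" using k n by simp
  define c where "c = \<epsilon> / 2 * sqrt (real n)"
  have fc: "continuous_map skorohod_topology euclideanreal f"
    unfolding skorohod_topology_def by (rule Skorohod.continuous_map_Lipschitz[OF fL])
  have D: "partial_sum_process T h n y \<in> skorohod_space" "grid_path k x \<in> skorohod_space" for y x
    by (simp_all add: partial_sum_process_eq_step_path grid_path_def step_path_in_skorohod)
  have B0: "0 \<le> B" using fB[OF D(1)[of undefined]] by linarith
  have K0: "0 \<le> K" using K[of undefined] by simp
  have mL2: "m \<in> L2_space M" using K by (intro L2_bounded) auto
  have hmL2: "(\<lambda>y. h y - m y) \<in> L2_space M" by (rule L2_diff[OF h mL2])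
  define l where "l = n div k + 2"
  define O4 where "O4 = (\<lambda>y. orbit_max T m l y ^ 4)"
  define R where "R = orbit_max T (\<lambda>y. h y - m y) n"
  have RL2: "R \<in> L2_space M" unfolding R_def by (rule L2_orbit_max[OF T hmL2])
  have O4int: "integrable M O4" and O4le: "(\<integral>y. O4 y \<partial>M) \<le> 30000 * K ^ 4 * (real l)\<^sup>2"
    unfolding O4_def by (rule fourth_moment_orbit_max[OF T m K u])+
  have [measurable]: "O4 \<in> borel_measurable M" using O4int by auto
  have O4T: "integrable M (\<lambda>y. O4 ((T ^^ i) y))" "(\<integral>y. O4 ((T ^^ i) y) \<partial>M) = (\<integral>y. O4 y \<partial>M)" for i
    using integrable_measure_preserving[OF measure_preserving_funpow[OF T] O4int]
      integral_measure_preserving[OF measure_preserving_funpow[OF T], of O4] by auto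
  have int1: "integrable M (\<lambda>y. f (partial_sum_process T h n y))"
    using fB[OF D(1)]
    by (intro integrable_bounded measurable_compose[OF measurable_partial_sum_process[OF T L2_measurable[OF h]]
        measurable_borel_of_continuous[OF fc]])
  have int2: "integrable M (\<lambda>y. f (grid_path k (orbit_increment T h n k y)))"
  proof (rule integrable_bounded[OF _ fB[OF D(2)]])
    show "(\<lambda>y. f (grid_path k (orbit_increment T h n k y))) \<in> borel_measurable M"
    proof (rule measurable_compose[OF measurable_coordinatewise_then_product
          borel_measurable_continuous_onI[OF continuous_grid_path[OF fc]]])
      show "(\<lambda>y. orbit_increment T h n k y j) \<in> borel_measurable M" for j
        unfolding orbit_increment_def using L2_measurable[OF L2_orbit_sum[OF T h]] by auto
    qed
  qed
  have "\<bar>(\<integral>y. f (partial_sum_process T h n y) \<partial>M) - (\<integral>y. f (grid_path k (orbit_increment T h n k y)) \<partial>M)\<bar>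
      \<le> (\<integral>y. \<bar>f (partial_sum_process T h n y) - f (grid_path k (orbit_increment T h n k y))\<bar> \<partial>M)"
    using int1 int2 integral_abs_bound[of M "\<lambda>y. f (partial_sum_process T h n y) - f (grid_path k (orbit_increment T h n k y))"]
    by simp
  also have "\<dots> \<le> (\<integral>y. L * \<epsilon> + 2 * B * ((\<Sum>j\<le>k. O4 ((T ^^ grid n k j) y) / c ^ 4) + 4 / c\<^sup>2 * (R y)\<^sup>2) \<partial>M)"
  proof (rule integral_mono)
    fix y
    show "\<bar>f (partial_sum_process T h n y) - f (grid_path k (orbit_increment T h n k y))\<bar>
      \<le> L * \<epsilon> + 2 * B * ((\<Sum>j\<le>k. O4 ((T ^^ grid n k j) y) / c ^ 4) + 4 / c\<^sup>2 * (R y)\<^sup>2)"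
      using Lipschitz_discretization[OF k n0 \<epsilon> L fB fL, of T h y m]
      unfolding c_def[symmetric] l_def[symmetric] O4_def R_def by (simp add: power_divide power_mult_distrib)
  qed (use int1 int2 O4T L2_square_integrable[OF RL2] in auto)
  also have "\<dots> = L * \<epsilon> + 2 * B * ((\<Sum>j\<le>k. (\<integral>y. O4 y \<partial>M) / c ^ 4) + 4 / c\<^sup>2 * (L2_norm M R)\<^sup>2)"
    using O4T L2_square_integrable[OF RL2] by (simp add: prob_space L2_norm_square)
  also have "\<dots> \<le> L * \<epsilon> + 2 * B * (3840000 * K ^ 4 / (\<epsilon> ^ 4 * real k) + 16 * \<delta>\<^sup>2 / \<epsilon>\<^sup>2)"
  proof (intro add_left_mono mult_left_mono add_mono)
    have l: "real l \<le> 2 * real n / real k"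
    proof -
      have "real (n div k) \<le> real n / real k" using floor_divide_of_nat_eq[where ?'a = real, of n k] by linarith
      moreover have "2 \<le> real n / real k"
      proof -
        have "2 * real k \<le> real n" using n by (metis of_nat_le_iff of_nat_mult of_nat_numeral)
        then show ?thesis using k by (simp add: pos_le_divide_eq)
      qed
      ultimately show ?thesis by (simp add: l_def)
    qed
    have c4: "c ^ 4 = \<epsilon> ^ 4 / 16 * (real n)\<^sup>2"
    proof -
      have "sqrt (real n) ^ 4 = ((sqrt (real n))\<^sup>2)\<^sup>2" by (simp only: power_mult[symmetric]) simp
      then show ?thesis by (simp add: c_def power_mult_distrib power_divide)
    qed
    have "(\<Sum>j\<le>k. (\<integral>y. O4 y \<partial>M) / c ^ 4) = real (k + 1) * ((\<integral>y. O4 y \<partial>M) / c ^ 4)" by simp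
    also have "\<dots> \<le> (2 * real k) * (30000 * K ^ 4 * (2 * real n / real k)\<^sup>2 / c ^ 4)"
    proof (intro mult_mono divide_right_mono order_trans[OF O4le] mult_left_mono power_mono l)
      show "0 \<le> (\<integral>y. O4 y \<partial>M) / c ^ 4" by (simp add: O4_def)
    qed (use k K0 in auto)
    also have "(2 * real k) * (30000 * K ^ 4 * (2 * real n / real k)\<^sup>2 / c ^ 4) = 3840000 * K ^ 4 / (\<epsilon> ^ 4 * real k)"
      unfolding c4 using k n0 \<epsilon> by (simp add: field_simps power2_eq_square)
    finally show "(\<Sum>j\<le>k. (\<integral>y. O4 y \<partial>M) / c ^ 4) \<le> 3840000 * K ^ 4 / (\<epsilon> ^ 4 * real k)" .
    have "4 / c\<^sup>2 * (L2_norm M R)\<^sup>2 \<le> 4 / c\<^sup>2 * (\<delta> * sqrt (real n))\<^sup>2"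
      using assms(6) unfolding R_def by (intro mult_left_mono power_mono) auto
    also have "\<dots> = 16 * \<delta>\<^sup>2 / \<epsilon>\<^sup>2"
      using n0 \<epsilon> by (simp add: c_def power_mult_distrib power_divide field_simps)
    finally show "4 / c\<^sup>2 * (L2_norm M R)\<^sup>2 \<le> 16 * \<delta>\<^sup>2 / \<epsilon>\<^sup>2" .
  qed (use B0 in auto)
  finally show ?thesis .
qed

section \<open>The invariance principle\<close>

text \<open>
  The test function is compared along the chain: process, its grid version, the grid version of the
  limit, the limit. The first and last comparison are good for a fine grid, the middle one for a fixed
  grid and large \<open>n\<close>; so the tolerance \<open>\<epsilon>\<close>, the martingale difference, the grid and \<open>n\<close> are chosen in
  this order.
\<close>

lemma invariance_principle:
  fixes Q :: "'b measure"
  assumes T: "measure_preserving_map M T" and h: "h \<in> L2_space M" and h': "h' \<in> L2_space M"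
    and h'0: "is_transfer M T h' (\<lambda>_. 0)"
    and lim: "(\<lambda>n. L2_norm M (orbit_max T (\<lambda>y. h y - h' y) n) / sqrt (real n)) \<longlonglongrightarrow> 0"
    and w: "standard_brownian_motion Q w"
    and E: "independent_copy M (real_cond_exp M (invariant_algebra M T) (\<lambda>y. (h' y)\<^sup>2)) Q E w"
  shows "conv_in_distr skorohod_topology M (partial_sum_process T h) Q (\<lambda>\<omega>. \<lambda>t\<in>{0..1}. sqrt (E \<omega>) * w t \<omega>)"
proof -
  interpret Q: prob_space Q using w by (simp add: standard_brownian_motion_def)
  interpret I: sigma_finite_subalgebra M "invariant_algebra M T"
    by (rule sigma_finite_subalgebra_invariant[OF measurable_measure_preserving[OF T]])
  define \<eta> where "\<eta> = real_cond_exp M (invariant_algebra M T) (\<lambda>y. (h' y)\<^sup>2)"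
  have \<eta>m: "\<eta> \<in> borel_measurable M" unfolding \<eta>_def by simp
  have \<eta>0: "AE y in M. 0 \<le> \<eta> y"
    unfolding \<eta>_def using L2_square_integrable[OF h'] by (intro I.real_cond_exp_pos) auto
  have hd: "(\<lambda>y. h y - h' y) \<in> L2_space M" by (rule L2_diff[OF h h'])
  have approx: "\<exists>m K. m \<in> borel_measurable M \<and> (\<forall>y. \<bar>m y\<bar> \<le> K) \<and> is_transfer M T m (\<lambda>_. 0) \<and>
      L2_norm M (\<lambda>y. h' y - m y) \<le> \<delta> \<and>
      (\<forall>\<^sub>F n in sequentially. L2_norm M (orbit_max T (\<lambda>y. h y - m y) n) \<le> \<delta> * sqrt (real n))"
    if \<delta>: "0 < \<delta>" for \<delta>
  proof -
    obtain m K where m: "m \<in> borel_measurable M" "\<And>y. \<bar>m y\<bar> \<le> K" "is_transfer M T m (\<lambda>_. 0)"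
      "L2_norm M (\<lambda>y. h' y - m y) \<le> \<delta> / 10"
      using bounded_martingale_approximation[OF T h' h'0, of "\<delta> / 10"] \<delta> by auto
    have mL2: "m \<in> L2_space M" using m by (intro L2_bounded) auto
    have dL2: "(\<lambda>y. h' y - m y) \<in> L2_space M" by (rule L2_diff[OF h' mL2])
    have d0: "is_transfer M T (\<lambda>y. h' y - m y) (\<lambda>_. 0)"
      using is_transfer_diff[OF T L2_integrable[OF h'] L2_integrable[OF mL2] h'0 m(3)] by simp
    have "\<forall>\<^sub>F n in sequentially. L2_norm M (orbit_max T (\<lambda>y. h y - h' y) n) / sqrt (real n) < \<delta> / 2"
      using order_tendstoD(2)[OF lim, of "\<delta> / 2"] \<delta> by simp
    then have "\<forall>\<^sub>F n in sequentially. L2_norm M (orbit_max T (\<lambda>y. h y - m y) n) \<le> \<delta> * sqrt (real n)"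
      using eventually_gt_at_top[of 0]
    proof eventually_elim
      case (elim n)
      have "(\<lambda>y. h y - m y) = (\<lambda>y. (h y - h' y) + (h' y - m y))" by simp
      then have "L2_norm M (orbit_max T (\<lambda>y. h y - m y) n)
          \<le> L2_norm M (orbit_max T (\<lambda>y. h y - h' y) n) + L2_norm M (orbit_max T (\<lambda>y. h' y - m y) n)"
        using L2_norm_orbit_max_triangle[OF T hd dL2, of n] by simp
      moreover have "L2_norm M (orbit_max T (\<lambda>y. h y - h' y) n) \<le> \<delta> / 2 * sqrt (real n)"
        using elim by (simp add: pos_divide_less_eq)
      moreover have "L2_norm M (orbit_max T (\<lambda>y. h' y - m y) n) \<le> \<delta> / 2 * sqrt (real n)"
      proof -
        have "5 * sqrt (real n) * L2_norm M (\<lambda>y. h' y - m y) \<le> 5 * sqrt (real n) * (\<delta> / 10)"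
          using m(4) by (intro mult_left_mono) auto
        then show ?thesis using L2_norm_orbit_max_martingale[OF T dL2 d0, of n] by simp
      qed
      ultimately show ?case by (simp add: field_simps)
    qed
    moreover have "L2_norm M (\<lambda>y. h' y - m y) \<le> \<delta>" using m(4) \<delta> by simp
    ultimately show ?thesis using m(1-3) by blast
  qed
  have wm: "w t \<in> borel_measurable Q" if "t \<in> {0..1}" for t using w that by (simp add: standard_brownian_motion_def)
  have w0: "AE \<omega> in Q. w 0 \<omega> = 0" using w by (simp add: standard_brownian_motion_def)
  have wc: "continuous_on {0..1} (\<lambda>t. w t \<omega>)" if "\<omega> \<in> space Q" for \<omega>
    using w that by (simp add: standard_brownian_motion_def)
  have [measurable]: "E \<in> borel_measurable Q" using E by (simp add: independent_copy_def)
  define Z where "Z = (\<lambda>\<omega>. \<lambda>t\<in>{0..1}. sqrt (E \<omega>) * w t \<omega>)"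
  have Wm: "(\<lambda>\<omega>. sqrt (E \<omega>) * w t \<omega>) \<in> borel_measurable Q" if "t \<in> {0..1}" for t
    using wm[OF that] by measurable
  have Wc: "continuous_on {0..1} (\<lambda>t. sqrt (E \<omega>) * w t \<omega>)" if "\<omega> \<in> space Q" for \<omega>
    by (intro continuous_intros wc that)
  have Zm: "Z \<in> measurable Q (borel_of skorohod_topology)"
    unfolding Z_def by (rule measurable_continuous_process[OF Wm Wc])
  have ZD: "Z \<omega> \<in> skorohod_space" if "\<omega> \<in> space Q" for \<omega>
    unfolding Z_def by (rule continuous_in_skorohod[OF Wc[OF that]])
  have Vm: "partial_sum_process T h n \<in> measurable M (borel_of skorohod_topology)" for n
    by (rule measurable_partial_sum_process[OF T L2_measurable[OF h]])
  define Zk where "Zk = (\<lambda>k \<omega> j. if j < k then sqrt (E \<omega>) * (w (real (Suc j) / real k) \<omega> - w (real j / real k) \<omega>) else 0)"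
  have Zkm: "(\<lambda>\<omega>. Zk k \<omega> j) \<in> borel_measurable Q" for k j
  proof (cases "j < k")
    case True
    then have "real (Suc j) / real k \<in> {0..1}" "real j / real k \<in> {0..1}" by auto
    from wm[OF this(1)] wm[OF this(2)] show ?thesis using True unfolding Zk_def by simp
  qed (simp add: Zk_def)
  obtain c where c: "\<And>n. L2_norm M (orbit_max T h n) / sqrt (real n) \<le> c"
  proof -
    obtain c where c: "\<And>n. norm (L2_norm M (orbit_max T (\<lambda>y. h y - h' y) n) / sqrt (real n)) \<le> c"
      using convergent_imp_Bseq[OF convergentI[OF lim]] by (auto simp: Bseq_def)
    have "L2_norm M (orbit_max T h n) / sqrt (real n) \<le> c + 5 * L2_norm M h'" for n
    proof -
      have "(\<lambda>y. (h y - h' y) + h' y) = h" by simp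
      then have "L2_norm M (orbit_max T h n) \<le> L2_norm M (orbit_max T (\<lambda>y. h y - h' y) n) + 5 * sqrt (real n) * L2_norm M h'"
        using L2_norm_orbit_max_triangle[OF T hd h', of n] L2_norm_orbit_max_martingale[OF T h' h'0, of n] by simp
      then have "L2_norm M (orbit_max T h n) / sqrt (real n)
          \<le> (L2_norm M (orbit_max T (\<lambda>y. h y - h' y) n) + 5 * sqrt (real n) * L2_norm M h') / sqrt (real n)"
        by (rule divide_right_mono) simp
      also have "\<dots> \<le> c + 5 * L2_norm M h'"
        using c[of n] by (cases "n = 0") (auto simp: add_divide_distrib)
      finally show ?thesis .
    qed
    then show ?thesis by (rule that)
  qed
  have Xm: "(\<lambda>y. orbit_increment T h n k y j) \<in> borel_measurable M" for n k j
    unfolding orbit_increment_def using L2_measurable[OF L2_orbit_sum[OF T h]] by auto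
  have tight: "integrable M (\<lambda>y. orbit_increment T h n k y j)" "(\<integral>y. \<bar>orbit_increment T h n k y j\<bar> \<partial>M) \<le> 2 * c" for n k j
  proof -
    note OL2 = L2_orbit_max[OF T h, of n]
    have oint: "integrable M (\<lambda>y. 2 * orbit_max T h n y / sqrt (real n))" using L2_integrable[OF OL2] by simp
    show int: "integrable M (\<lambda>y. orbit_increment T h n k y j)"
      by (rule Bochner_Integration.integrable_bound[OF oint Xm])
         (use abs_orbit_increment_le[of T h n k _ j] orbit_max_nonneg[of T h n] in auto)
    have "(\<integral>y. \<bar>orbit_increment T h n k y j\<bar> \<partial>M) \<le> (\<integral>y. 2 * orbit_max T h n y / sqrt (real n) \<partial>M)"
      using int oint abs_orbit_increment_le[of T h n k _ j] by (intro integral_mono) auto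
    also have "\<dots> = 2 * ((\<integral>y. \<bar>orbit_max T h n y\<bar> \<partial>M) / sqrt (real n))"
      using orbit_max_nonneg[of T h n] by simp
    also have "\<dots> \<le> 2 * (L2_norm M (orbit_max T h n) / sqrt (real n))"
      using integral_abs_le_L2_norm[OF OL2] by (intro mult_left_mono divide_right_mono) auto
    also have "\<dots> \<le> 2 * c" using c[of n] by simp
    finally show "(\<integral>y. \<bar>orbit_increment T h n k y j\<bar> \<partial>M) \<le> 2 * c" .
  qed
  have main: "(\<lambda>n. \<integral>y. f (partial_sum_process T h n y) \<partial>M) \<longlonglongrightarrow> (\<integral>\<omega>. f (Z \<omega>) \<partial>Q)"
    if L: "0 \<le> L" and fB: "\<And>x. x \<in> skorohod_space \<Longrightarrow> \<bar>f x\<bar> \<le> B"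
      and fL: "\<And>x y. x \<in> skorohod_space \<Longrightarrow> y \<in> skorohod_space \<Longrightarrow> \<bar>f x - f y\<bar> \<le> L * skorohod_dist x y"
    for f L B
  proof (rule LIMSEQ_I)
    fix e :: real assume e: "0 < e"
    have fc: "continuous_map skorohod_topology euclideanreal f"
      unfolding skorohod_topology_def by (rule Skorohod.continuous_map_Lipschitz[OF fL])
    have gD: "grid_path k x \<in> skorohod_space" for k x by (simp add: grid_path_def step_path_in_skorohod)
    define \<epsilon> where "\<epsilon> = e / (5 * (L + 1))"
    have \<epsilon>: "0 < \<epsilon>" using e L by (simp add: \<epsilon>_def)
    have L\<epsilon>: "L * \<epsilon> < e / 4"
    proof -
      have "L * \<epsilon> \<le> (L + 1) * \<epsilon>" using \<epsilon> by (intro mult_right_mono) auto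
      also have "\<dots> = e / 5" using L by (simp add: \<epsilon>_def field_simps)
      finally show ?thesis using e by simp
    qed
    have "(\<lambda>s. 2 * B * (16 * (inverse (real (Suc s)))\<^sup>2 / \<epsilon>\<^sup>2)) \<longlonglongrightarrow> 2 * B * (16 * 0\<^sup>2 / \<epsilon>\<^sup>2)"
      using \<epsilon> by (intro tendsto_intros LIMSEQ_inverse_real_of_nat) auto
    from order_tendstoD(2)[OF this, of "e / 8"] e
    obtain s :: nat where s: "2 * B * (16 * (inverse (real (Suc s)))\<^sup>2 / \<epsilon>\<^sup>2) < e / 8"
      by (auto simp: eventually_sequentially)
    define \<delta> where "\<delta> = inverse (real (Suc s))"
    have \<delta>: "0 < \<delta>" by (simp add: \<delta>_def)
    obtain m K where m: "m \<in> borel_measurable M" "\<And>y. \<bar>m y\<bar> \<le> K" "is_transfer M T m (\<lambda>_. 0)"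
      and ev: "\<forall>\<^sub>F n in sequentially. L2_norm M (orbit_max T (\<lambda>y. h y - m y) n) \<le> \<delta> * sqrt (real n)"
      using approx[OF \<delta>] by blast
    have "(\<lambda>k. 2 * B * (3840000 * K ^ 4 / \<epsilon> ^ 4 * inverse (real (Suc k)))) \<longlonglongrightarrow> 2 * B * (3840000 * K ^ 4 / \<epsilon> ^ 4 * 0)"
      using \<epsilon> by (intro tendsto_intros LIMSEQ_inverse_real_of_nat) auto
    from order_tendstoD(2)[OF this, of "e / 8"] e
    have ev1: "\<forall>\<^sub>F k in sequentially. 2 * B * (3840000 * K ^ 4 / \<epsilon> ^ 4 * inverse (real (Suc k))) < e / 8" by simp
    have "(\<lambda>k. \<integral>\<omega>. f (grid_path (Suc k) (Zk (Suc k) \<omega>)) \<partial>Q) \<longlonglongrightarrow> (\<integral>\<omega>. f (Z \<omega>) \<partial>Q)"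
    proof (rule integral_dominated_convergence[where w = "\<lambda>_. B"])
      show "(\<lambda>\<omega>. f (Z \<omega>)) \<in> borel_measurable Q"
        by (rule measurable_compose[OF Zm measurable_borel_of_continuous[OF fc]])
      show "(\<lambda>\<omega>. f (grid_path (Suc k) (Zk (Suc k) \<omega>))) \<in> borel_measurable Q" for k
        by (rule measurable_compose[OF measurable_coordinatewise_then_product
              borel_measurable_continuous_onI[OF continuous_grid_path[OF fc]]]) (rule Zkm)
      show "AE \<omega> in Q. (\<lambda>k. f (grid_path (Suc k) (Zk (Suc k) \<omega>))) \<longlonglongrightarrow> f (Z \<omega>)"
        using w0 AE_space
      proof eventually_elim
        case (elim \<omega>)
        have eq: "grid_path (Suc k) (Zk (Suc k) \<omega>)
            = step_path (Suc k) (\<lambda>j. sqrt (E \<omega>) * w (min 1 (real j / real (Suc k))) \<omega>)" for k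
          unfolding grid_path_def
        proof (rule step_path_cong)
          fix j assume j: "j \<le> Suc k"
          have "(\<Sum>i<j. Zk (Suc k) \<omega> i)
              = (\<Sum>i<j. sqrt (E \<omega>) * w (real (Suc i) / real (Suc k)) \<omega> - sqrt (E \<omega>) * w (real i / real (Suc k)) \<omega>)"
            using j by (intro sum.cong) (auto simp: Zk_def right_diff_distrib)
          also have "\<dots> = sqrt (E \<omega>) * w (real j / real (Suc k)) \<omega>"
            by (subst sum_lessThan_telescope) (simp add: elim)
          also have "real j / real (Suc k) = min 1 (real j / real (Suc k))" using j by simp
          finally show "(\<Sum>i<j. Zk (Suc k) \<omega> i) = sqrt (E \<omega>) * w (min 1 (real j / real (Suc k))) \<omega>" .
        qed
        have "(\<lambda>k. L * skorohod_dist (grid_path (Suc k) (Zk (Suc k) \<omega>)) (Z \<omega>)) \<longlonglongrightarrow> L * 0"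
          unfolding eq Z_def by (intro tendsto_mult tendsto_const step_path_tendsto_continuous[OF Wc[OF elim(2)]])
        then have "(\<lambda>k. L * skorohod_dist (grid_path (Suc k) (Zk (Suc k) \<omega>)) (Z \<omega>)) \<longlonglongrightarrow> 0" by simp
        then have "(\<lambda>k. f (grid_path (Suc k) (Zk (Suc k) \<omega>)) - f (Z \<omega>)) \<longlonglongrightarrow> 0"
        proof (rule Lim_null_comparison[rotated], intro always_eventually allI)
          fix k
          show "norm (f (grid_path (Suc k) (Zk (Suc k) \<omega>)) - f (Z \<omega>))
              \<le> L * skorohod_dist (grid_path (Suc k) (Zk (Suc k) \<omega>)) (Z \<omega>)"
            unfolding real_norm_def by (rule fL[OF gD ZD[OF elim(2)]])
        qed
        then show ?case by (simp add: LIM_zero_iff)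
      qed
    qed (use fB[OF gD] in auto)
    from tendstoD[OF this, of "e / 4"] e
    have ev2: "\<forall>\<^sub>F k in sequentially. \<bar>(\<integral>\<omega>. f (grid_path (Suc k) (Zk (Suc k) \<omega>)) \<partial>Q) - (\<integral>\<omega>. f (Z \<omega>) \<partial>Q)\<bar> < e / 4"
      by (simp add: dist_real_def)
    obtain k' where k': "2 * B * (3840000 * K ^ 4 / \<epsilon> ^ 4 * inverse (real (Suc k'))) < e / 8"
      "\<bar>(\<integral>\<omega>. f (grid_path (Suc k') (Zk (Suc k') \<omega>)) \<partial>Q) - (\<integral>\<omega>. f (Z \<omega>) \<partial>Q)\<bar> < e / 4"
      using eventually_happens'[OF sequentially_bot eventually_conj[OF ev1 ev2]] by blast
    define k where "k = Suc k'"
    have k: "0 < k" by (simp add: k_def)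
    have "(\<lambda>n. \<integral>y. f (grid_path k (orbit_increment T h n k y)) \<partial>M) \<longlonglongrightarrow> (\<integral>\<omega>. f (grid_path k (Zk k \<omega>)) \<partial>Q)"
    proof (rule char_tendsto_imp_continuous_tendsto[OF prob_space_axioms Q.prob_space_axioms, 
          where k = k and c = "2 * c" and B = B and X = "\<lambda>n. orbit_increment T h n k" and Z = "Zk k"
            and g = "\<lambda>x. f (grid_path k x)"])
      fix a :: "nat \<Rightarrow> real"
      have "(\<integral>\<omega>. exp (\<i> * complex_of_real (\<Sum>j<k. a j * Zk k \<omega> j)) \<partial>Q)
          = (\<integral>y. complex_of_real (exp (- (\<eta> y * (\<Sum>j<k. (a j)\<^sup>2) / real k) / 2)) \<partial>M)"
        using brownian_mixture_char[OF w E[folded \<eta>_def] \<eta>m \<eta>0 k, of a] by (simp add: Zk_def)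
      then show "(\<lambda>n. \<integral>y. exp (\<i> * complex_of_real (\<Sum>j<k. a j * orbit_increment T h n k y j)) \<partial>M)
          \<longlonglongrightarrow> (\<integral>\<omega>. exp (\<i> * complex_of_real (\<Sum>j<k. a j * Zk k \<omega> j)) \<partial>Q)"
        using finite_dimensional_char_tendsto[OF T h h' k approx, of a] by (simp add: \<eta>_def)
    qed (use Xm Zkm tight continuous_grid_path[OF fc] fB[OF gD] in \<open>auto simp: orbit_increment_def Zk_def\<close>)
    from tendstoD[OF this, of "e / 4"] e
    have "\<forall>\<^sub>F n in sequentially. \<bar>(\<integral>y. f (grid_path k (orbit_increment T h n k y)) \<partial>M)
        - (\<integral>\<omega>. f (grid_path k (Zk k \<omega>)) \<partial>Q)\<bar> < e / 4"
      by (simp add: dist_real_def)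
    then have "\<forall>\<^sub>F n in sequentially. norm ((\<integral>y. f (partial_sum_process T h n y) \<partial>M) - (\<integral>\<omega>. f (Z \<omega>) \<partial>Q)) < e"
      using ev eventually_ge_at_top[of "2 * k"]
    proof eventually_elim
      case (elim n)
      have "2 * B * (3840000 * K ^ 4 / (\<epsilon> ^ 4 * real k) + 16 * \<delta>\<^sup>2 / \<epsilon>\<^sup>2)
          = 2 * B * (3840000 * K ^ 4 / \<epsilon> ^ 4 * inverse (real k)) + 2 * B * (16 * \<delta>\<^sup>2 / \<epsilon>\<^sup>2)"
        by (simp add: divide_inverse algebra_simps)
      also have "\<dots> < e / 8 + e / 8"
        using k'(1) s unfolding k_def \<delta>_def by (rule add_strict_mono)
      finally have "\<bar>(\<integral>y. f (partial_sum_process T h n y) \<partial>M) - (\<integral>y. f (grid_path k (orbit_increment T h n k y)) \<partial>M)\<bar>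
          < e / 4 + e / 4"
        using discretization_error[OF T h m elim(2) k elim(3) \<epsilon> L fB fL] L\<epsilon> by linarith
      then show ?case using elim(1) k'(2) unfolding k_def[symmetric] real_norm_def by linarith
    qed
    then show "\<exists>N. \<forall>n\<ge>N. norm ((\<integral>y. f (partial_sum_process T h n y) \<partial>M) - (\<integral>\<omega>. f (Z \<omega>) \<partial>Q)) < e"
      by (simp only: eventually_sequentially)
  qed
  have "weak_conv_on skorohod_topology (\<lambda>n. distr M (borel_of skorohod_topology) (partial_sum_process T h n))
      (distr Q (borel_of skorohod_topology) Z)"
    unfolding skorohod_topology_def
  proof (rule Skorohod.weak_conv_on_Lipschitz[OF prob_space_axioms Q.prob_space_axioms])
    show "skorohod_space \<noteq> {}" using step_path_in_skorohod by blast
    fix f :: "(real \<Rightarrow> real) \<Rightarrow> real" and L B assume "0 \<le> L" "\<And>x. x \<in> skorohod_space \<Longrightarrow> \<bar>f x\<bar> \<le> B"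
      "\<And>x y. x \<in> skorohod_space \<Longrightarrow> y \<in> skorohod_space \<Longrightarrow> \<bar>f x - f y\<bar> \<le> L * skorohod_dist x y"
    then show "(\<lambda>n. \<integral>y. f (partial_sum_process T h n y) \<partial>M) \<longlonglongrightarrow> (\<integral>\<omega>. f (Z \<omega>) \<partial>Q)" by (rule main)
  qed (use Vm Zm in \<open>simp_all add: skorohod_topology_def\<close>)
  then show ?thesis unfolding conv_in_distr_def Z_def[symmetric] using Vm Zm by blast
qed

end

theorem theorem1:
  fixes M :: "'a measure" and T :: "'a \<Rightarrow> 'a" and h :: "'a \<Rightarrow> real"
  assumes "prob_space M"
    and "measure_preserving_map M T"
    and "h \<in> L2_space M"
    and "(\<integral>y. h y \<partial>M) = 0"
    and "summable (\<lambda>n. real (Suc n) powr (- (3 / 2)) *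
           L2_norm M (\<lambda>y. \<Sum>k<Suc n. (transfer_operator M T ^^ k) h y))"
  shows "\<exists>h' \<in> L2_space M.
           (AE y in M. transfer_operator M T h' y = 0) \<and>
           (\<lambda>n. L2_norm M (\<lambda>y. 1 / sqrt (real n) *
              (\<Sum>j<n. h ((T ^^ j) y) - h' ((T ^^ j) y)))) \<longlonglongrightarrow> 0 \<and>
           (let \<eta> = real_cond_exp M (invariant_algebra M T) (\<lambda>y. (h' y)\<^sup>2) in
              \<forall>(Q :: 'b measure) w E.
                standard_brownian_motion Q w \<and> independent_copy M \<eta> Q E w \<longrightarrow>
                conv_in_distr skorohod_topology M (partial_sum_process T h)
                  Q (\<lambda>\<omega>. \<lambda>t\<in>{0..1}. sqrt (E \<omega>) * w t \<omega>))"
proof -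
  interpret prob_space M by fact
  let ?p = "\<lambda>k. (transfer_operator M T ^^ k) h"
  note T = assms(2) and h = assms(3)
  note p = iterated_transfer[OF T h]
  have "\<exists>m. m \<in> L2_space M \<and> is_transfer M T m (\<lambda>_. 0) \<and>
      (\<forall>\<^sub>F n in sequentially. L2_norm M (orbit_max T (\<lambda>y. h y - m y) n) \<le> \<epsilon> * sqrt (real n))"
    if \<epsilon>: "0 < \<epsilon>" for \<epsilon>
  proof -
    obtain m where "m \<in> L2_space M" "is_transfer M T m (\<lambda>_. 0)"
      "\<forall>\<^sub>F n in sequentially. L2_norm M (orbit_max T (\<lambda>y. ?p 0 y - m y) n) \<le> \<epsilon> * sqrt (real n)"
      by (rule martingale_approximation_step[OF T p assms(5) \<epsilon>])
    then show ?thesis by auto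
  qed
  from martingale_approximation[OF T h this] obtain h' where h': "h' \<in> L2_space M" "is_transfer M T h' (\<lambda>_. 0)"
    and lim: "(\<lambda>n. L2_norm M (orbit_max T (\<lambda>y. h y - h' y) n) / sqrt (real n)) \<longlonglongrightarrow> 0"
    by blast
  have hd: "(\<lambda>y. h y - h' y) \<in> L2_space M" by (rule L2_diff[OF h h'(1)])
  have "AE y in M. transfer_operator M T h' y = 0"
    using is_transfer_unique_AE[OF T _ _ _ is_transfer_transfer_operator[OF assms(1) T L2_integrable[OF h'(1)]] h'(2)]
      L2_measurable[OF h'(1)] by simp
  moreover have "(\<lambda>n. L2_norm M (\<lambda>y. 1 / sqrt (real n) * (\<Sum>j<n. h ((T ^^ j) y) - h' ((T ^^ j) y)))) \<longlonglongrightarrow> 0"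
  proof (rule tendsto_sandwich[OF _ _ tendsto_const lim])
    show "\<forall>\<^sub>F n in sequentially. L2_norm M (\<lambda>y. 1 / sqrt (real n) * (\<Sum>j<n. h ((T ^^ j) y) - h' ((T ^^ j) y)))
        \<le> L2_norm M (orbit_max T (\<lambda>y. h y - h' y) n) / sqrt (real n)"
    proof (rule always_eventually, rule allI)
      fix n
      have "L2_norm M (orbit_sum T (\<lambda>y. h y - h' y) n) / sqrt (real n)
          \<le> L2_norm M (orbit_max T (\<lambda>y. h y - h' y) n) / sqrt (real n)"
        by (intro divide_right_mono L2_norm_orbit_sum_le_orbit_max[OF T hd]) simp
      then show "L2_norm M (\<lambda>y. 1 / sqrt (real n) * (\<Sum>j<n. h ((T ^^ j) y) - h' ((T ^^ j) y)))
          \<le> L2_norm M (orbit_max T (\<lambda>y. h y - h' y) n) / sqrt (real n)"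
        unfolding L2_norm_cmult by (simp add: orbit_sum_def[abs_def])
    qed
  qed (simp add: always_eventually)
  ultimately show ?thesis
    unfolding Let_def using invariance_principle[OF T h h' lim] h'(1) by blast
qed

end
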